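(* Let $\alpha$ be a mixing action of a polycyclic-by-finite group $G$ with polynomial subgroup growth and Hirsch length at least $2$ by automorphisms of a compact connected finite dimensional abelian group $X$. If the formal power series for $\zeta_\alpha$ has integer coefficients, then $\zeta_\alpha$ has the unit circle as a natural boundary.
   Context: For a finitely generated group $G$, $\mathcal{L}_G$ denotes the set of finite index subgroups of $G$, $[L]=[G:L]$ for $L\in\mathcal{L}_G$, and $a_G(n)$ is the (finite) number of subgroups of index $n$. $G$ has polynomial subgroup growth (is a PSG group) if $a_G(n)$ grows at most polynomially in $n$. If $G$ is polycyclic-by-finite, there is a finite index subgroup $G_m\leqslant G$ with a subnormal series $\{1\}=G_0\lhd G_1\lhd\dots\lhd G_m$ with each $G_k/G_{k-1}$ infinite cyclic; the number $m$ is an invariant of $G$, called its Hirsch length. For a $G$-action $\alpha$ on a set $X$ and $L\in\mathcal{L}_G$, $\mathsf{F}_\alpha(L)$ is the cardinality of $\{x\in X: gx=x\text{ for all }g\in L\}$. The dynamical zeta function of $\alpha$ is the formal power series $\zeta_\alpha(z)=\exp\sum_{L\in\mathcal{L}_G}\frac{\mathsf{F}_\alpha(L)}{[L]}z^{[L]}$, defined when all $\mathsf{F}_\alpha(L)$ are finite (which holds for the mixing actions considered here). Automorphisms of a compact group are continuous. The action is mixing if it is mixing with respect to normalized Haar measure $m$ on $X$: $m(E\cap gF)\to m(E)m(F)$ as $g\to\infty$ in $G$ (i.e. as $g$ leaves every finite subset of $G$), for all Borel sets $E,F\subset X$. A power series with radius of convergence $R\in(0,\infty)$ has the circle $|z|=R$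 as a natural boundary if the function it defines on $|z|<R$ cannot be continued analytically across any point of that circle. *)

theory Defs
  imports
    "HOL-Algebra.Group_Action"
    "HOL-Algebra.Elementary_Groups"
    "HOL-Complex_Analysis.Complex_Analysis"
begin

section \<open>Finite index subgroups and subgroup growth\<close>

definition finite_index_subgroups :: "('g, 'b) monoid_scheme \<Rightarrow> 'g set set" where
  "finite_index_subgroups G = {L. subgroup L G \<and> finite (rcosets\<^bsub>G\<^esub> L)}"

definition index :: "('g, 'b) monoid_scheme \<Rightarrow> 'g set \<Rightarrow> nat" where
  "index G L = card (rcosets\<^bsub>G\<^esub> L)"

definition subgroups_of_index :: "('g, 'b) monoid_scheme \<Rightarrow> nat \<Rightarrow> 'g set set" where
  "subgroups_of_index G n = {L \<in> finite_index_subgroups G. index G L = n}"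

text \<open>The finiteness conjunct is automatic for finitely generated groups, in particular for
  polycyclic-by-finite ones; it only guards against \<^const>\<open>card\<close> of an infinite set being 0.\<close>

definition polynomial_subgroup_growth :: "('g, 'b) monoid_scheme \<Rightarrow> bool" where
  "polynomial_subgroup_growth G \<longleftrightarrow>
     (\<exists>(C::real) (d::nat). \<forall>n\<ge>1. finite (subgroups_of_index G n) \<and>
        real (card (subgroups_of_index G n)) \<le> C * real n ^ d)"


section \<open>Polycyclic-by-finite groups and Hirsch length\<close>

definition subnormal_series ::
  "('g set monoid \<Rightarrow> bool) \<Rightarrow> ('g, 'b) monoid_scheme \<Rightarrow> (nat \<Rightarrow> 'g set) \<Rightarrow> nat \<Rightarrow> bool" where
  "subnormal_series P G S m \<longleftrightarrow>
     S 0 = {\<one>\<^bsub>G\<^esub>} \<and> (\<forall>k\<le>m. subgroup (S k) G) \<and>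
     (\<forall>k<m. S k \<lhd> G\<lparr>carrier := S (Suc k)\<rparr> \<and> P (G\<lparr>carrier := S (Suc k)\<rparr> Mod S k))"

definition polycyclic_by_finite :: "('g, 'b) monoid_scheme \<Rightarrow> bool" where
  "polycyclic_by_finite G \<longleftrightarrow>
     group G \<and> (\<exists>S m. subnormal_series cyclic_group G S m \<and> S m \<lhd> G \<and>
       S m \<in> finite_index_subgroups G)"

text \<open>The Hirsch length as a relation between a group and a number: for polycyclic-by-finite
  groups there is exactly one such number.\<close>

definition has_Hirsch_length :: "('g, 'b) monoid_scheme \<Rightarrow> nat \<Rightarrow> bool" where
  "has_Hirsch_length G m \<longleftrightarrow>
     (\<exists>S. subnormal_series (\<lambda>Q. cyclic_group Q \<and> infinite (carrier Q)) G S m \<and>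
       S m \<in> finite_index_subgroups G)"


section \<open>Actions by automorphisms of compact abelian groups\<close>

text \<open>The group acted upon is the whole type. On a compact Hausdorff group every continuous
  bijective endomorphism is a topological automorphism, so continuity of the inverse need not
  be stated (it is also the map by which the inverse group element acts).\<close>

definition acts_by_automorphisms ::
  "('g, 'b) monoid_scheme \<Rightarrow> ('g \<Rightarrow> 'x \<Rightarrow> 'x :: topological_ab_group_add) \<Rightarrow> bool" where
  "acts_by_automorphisms G \<alpha> \<longleftrightarrow> group_action G UNIV \<alpha> \<and>
     (\<forall>g\<in>carrier G. continuous_on UNIV (\<alpha> g) \<and> (\<forall>x y. \<alpha> g (x + y) = \<alpha> g x + \<alpha> g y))"

definition normalized_Haar_measure ::
  "('x :: {topological_ab_group_add, t2_space}) measure \<Rightarrow> bool" where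
  "normalized_Haar_measure M \<longleftrightarrow>
     sets M = sets borel \<and> emeasure M UNIV = 1 \<and>
     (\<forall>x. \<forall>E\<in>sets borel. emeasure M ((\<lambda>y. x + y) ` E) = emeasure M E) \<and>
     (\<forall>E\<in>sets borel. emeasure M E = (SUP K\<in>{K. compact K \<and> K \<subseteq> E}. emeasure M K)) \<and>
     (\<forall>E\<in>sets borel. emeasure M E = (INF U\<in>{U. open U \<and> E \<subseteq> U}. emeasure M U))"

definition mixing ::
  "('g, 'b) monoid_scheme \<Rightarrow> ('g \<Rightarrow> 'x \<Rightarrow> 'x) \<Rightarrow> ('x :: topological_space) measure \<Rightarrow> bool" where
  "mixing G \<alpha> M \<longleftrightarrow>
     (\<forall>E\<in>sets borel. \<forall>F\<in>sets borel.
        ((\<lambda>g. measure M (E \<inter> \<alpha> g ` F)) \<longlongrightarrow> measure M E * measure M F)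
          (inf cofinite (principal (carrier G))))"

text \<open>Finite dimensionality is taken with respect to the library's (small inductive) dimension,
  which on compact groups coincides with the Lebesgue covering dimension.\<close>

definition finite_dimensional_space :: "'x topology \<Rightarrow> bool" where
  "finite_dimensional_space X \<longleftrightarrow> (\<exists>n::int. X dim_le n)"


section \<open>The dynamical zeta function\<close>

definition fixed_points :: "('g \<Rightarrow> 'x \<Rightarrow> 'x) \<Rightarrow> 'g set \<Rightarrow> 'x set" where
  "fixed_points \<alpha> L = {x. \<forall>g\<in>L. \<alpha> g x = x}"

text \<open>The sum over all finite index subgroups is grouped by index. It is meaningful when
  every \<^term>\<open>fixed_points \<alpha> L\<close> and every \<^term>\<open>subgroups_of_index G n\<close> is finite; there are no
  subgroups of index 0, so the constant term is 0 and composition with the exponential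
  series is the usual formal exponential.\<close>

definition dynamical_zeta ::
  "('g, 'b) monoid_scheme \<Rightarrow> ('g \<Rightarrow> 'x \<Rightarrow> 'x) \<Rightarrow> complex fps" where
  "dynamical_zeta G \<alpha> =
     fps_exp 1 oo Abs_fps (\<lambda>n. \<Sum>L\<in>subgroups_of_index G n.
       of_nat (card (fixed_points \<alpha> L)) / of_nat (index G L))"


section \<open>Natural boundaries\<close>

definition has_natural_boundary_circle :: "complex fps \<Rightarrow> real \<Rightarrow> bool" where
  "has_natural_boundary_circle f R \<longleftrightarrow>
     0 < R \<and> fps_conv_radius f = ereal R \<and>
     (\<forall>w. norm w = R \<longrightarrow>
        \<not> (\<exists>U g. open U \<and> w \<in> U \<and> g holomorphic_on U \<and>
              (\<forall>z\<in>U \<inter> ball 0 R. g z = eval_fps f z)))"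

end

theory Submission
  imports Defs "HOL-Algebra.Multiplicative_Group" "HOL-Probability.Probability_Measure"
    "HOL-Computational_Algebra.Fundamental_Theorem_Algebra" "HOL-Real_Asymp.Real_Asymp"
    "Jordan_Normal_Form.Determinant"
begin

text \<open>
  Write \<open>\<zeta> = exp b\<close>, where \<open>n\<close> times the \<open>n\<close>-th coefficient of \<open>b\<close> is the sum \<open>a n\<close> of the numbers of
  fixed points of the subgroups of index \<open>n\<close>. By the theorem of Polya and Carlson, an integral power
  series that converges in the unit disc and extends across a point of the unit circle is rational.

  \<^item> If \<open>\<zeta>\<close> were rational, its logarithmic derivative would be a combination of the fractions \<open>1 / (z - r)\<close>
    with \<open>\<bar>r\<bar> \<ge> 1\<close>, because \<open>exp b\<close> has neither zeros nor poles in the disc; so \<open>a\<close> would be bounded. But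
    \<open>a n\<close> is at least the number of subgroups of index \<open>n\<close>, and Hirsch length at least 2 makes this
    number unbounded.
  \<^item> \<open>\<zeta>\<close> converges in the unit disc: by the pigeonhole principle a subgroup of index \<open>n\<close> contains an element
    \<open>g\<close> of infinite order which is a word of length \<open>O(\<surd>n)\<close> in two fixed elements. By duality, the fixed
    points of \<open>g\<close> are at most as many as the cosets of the range of \<open>g - 1\<close> on the character group.
    Finite dimension makes the rank of the character group finite, and mixing makes \<open>g - 1\<close> injective
    there, so the number of cosets is exponential in the word length, that is \<open>exp (O(\<surd>n))\<close>.
\<close>

section \<open>The theorem of Polya and Carlson\<close>

text \<open>Hirsch length 2 is what produces the square root: one element of infinite order only
  gives words of length O(n), hence an exponential bound and possibly a radius below 1, whereas the
  \<open>(s + 1)\<^sup>2\<close> products \<open>x^i y^j\<close> with i, j \<le> s bring the length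
  down to the order of the root of the index. Finite dimension is used only for the rank of the
  dual: N independent characters embed the N-cube into X. Placing the cube there needs the half of
  Pontryagin duality which says that every homomorphism from the dual to the circle is evaluation at
  a point. The topology of X is not assumed to be second countable, so Borel sets of X x X are
  avoided: characters come from convolution of continuous functions, and Fubini from uniform
  approximation. In the theorem of Polya and Carlson integrality serves one purpose: Hankel
  determinants are integers, so it is enough that they tend to 0. They do, because a contour pushed
  out near one point and in elsewhere carries a monic polynomial in 1/z of modulus below 1, which
  shows that the inverted curve has capacity below 1.\<close>

text \<open>Pade approximation. Reversed kernel vectors are denominators \<open>Q n\<close> of
  degree below \<open>n\<close> for which \<open>Q n * F\<close> has no coefficients in the degrees
  from \<open>n - 1\<close> to \<open>2 * n - 2\<close>; the part below this gap is the numerator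
  \<open>P n\<close>. The gap is so long that neighbouring fractions must coincide, and a fraction
  that approximates \<open>F\<close> to every order is \<open>F\<close>.\<close>

lemma fps_rational_if_Hankel_kernels:
  fixes F :: "'a::field fps" and v :: "nat \<Rightarrow> nat \<Rightarrow> 'a"
  assumes nz: "\<And>n. n \<ge> N \<Longrightarrow> \<exists>i<n. v n i \<noteq> 0"
    and ker: "\<And>n j. n \<ge> N \<Longrightarrow> j < n \<Longrightarrow> (\<Sum>i<n. fps_nth F (i + j) * v n i) = 0"
  shows "\<exists>P Q. Q \<noteq> 0 \<and> fps_of_poly Q * F = fps_of_poly P"
proof -
  define Q where "Q = (\<lambda>n. Abs_fps (\<lambda>k. if k < n then v n (n - 1 - k) else 0))"
  define P where "P = (\<lambda>n. Abs_fps (\<lambda>k. if k < n - 1 then fps_nth (Q n * F) k else 0))"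
  define E where "E = (\<lambda>n. Q n * F - P n)"
  have Qd: "fps_nth (Q n) k = 0" if "k \<ge> n" for n k using that by (simp add: Q_def)
  have Pd: "fps_nth (P n) k = 0" if "k \<ge> n - 1" for n k using that by (simp add: P_def)
  have E0: "fps_nth (E n) k = 0" if n: "n \<ge> N" and k: "k < 2 * n - 1" for n k
  proof (cases "k < n - 1")
    case True
    then show ?thesis by (simp add: E_def P_def)
  next
    case False
    define j where "j = k - (n - 1)"
    have j: "j < n" "k = n - 1 + j" using False k by (auto simp: j_def)
    have "fps_nth (E n) k = (\<Sum>i=0..k. fps_nth (Q n) i * fps_nth F (k - i))"
      using False by (simp add: E_def P_def fps_mult_nth)
    also have "\<dots> = (\<Sum>i<n. fps_nth (Q n) i * fps_nth F (k - i))"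
      using j by (intro sum.mono_neutral_right) (auto simp: Qd)
    also have "\<dots> = (\<Sum>i<n. fps_nth F (i + j) * v n i)"
      using j by (intro sum.reindex_bij_witness[of _ "\<lambda>i. n - 1 - i" "\<lambda>i. n - 1 - i"])
        (auto simp: Q_def mult.commute algebra_simps)
    finally show ?thesis using ker[OF n j(1)] by simp
  qed
  have Q0: "Q n \<noteq> 0" if n: "n \<ge> N" for n
  proof -
    obtain i where "i < n" "v n i \<noteq> 0" using nz[OF n] by blast
    then have "fps_nth (Q n) (n - 1 - i) \<noteq> 0" by (simp add: Q_def)
    then show ?thesis by auto
  qed
  have low: "fps_nth (A * B) k = 0" if "\<And>i. i < m \<Longrightarrow> fps_nth A i = 0" "k < m" for A B :: "'a fps" and k m
    using that by (auto simp: fps_mult_nth intro!: sum.neutral)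
  have high: "fps_nth (A * B) k = 0"
    if "\<And>i. i \<ge> a \<Longrightarrow> fps_nth A i = 0" "\<And>i. i \<ge> b \<Longrightarrow> fps_nth B i = 0" "k + 1 \<ge> a + b" for A B :: "'a fps" and k a b
    unfolding fps_mult_nth
  proof (intro sum.neutral ballI)
    fix i assume "i \<in> {0..k}"
    then show "fps_nth A i * fps_nth B (k - i) = 0" using that by (cases "i \<ge> a") auto
  qed
  \<comment> \<open>By degrees, \<open>R\<close> has no coefficients from \<open>2 * n - 1\<close>
    on; written through the errors \<open>E\<close>, it has none below.\<close>
  have step: "P n * Q (Suc n) = P (Suc n) * Q n" if n: "n \<ge> N" for n
  proof -
    define R where "R = P n * Q (Suc n) - P (Suc n) * Q n"
    have R: "R = E (Suc n) * Q n - E n * Q (Suc n)"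
      unfolding R_def E_def by (simp add: algebra_simps)
    have "fps_nth R k = 0" for k
    proof (cases "k < 2 * n - 1")
      case True
      have "fps_nth (E (Suc n) * Q n) k = 0" by (rule low[of "2*n-1"]) (use True n E0[of "Suc n"] in auto)
      moreover have "fps_nth (E n * Q (Suc n)) k = 0" by (rule low[of "2*n-1"]) (use True n E0[of n] in auto)
      ultimately show ?thesis by (simp add: R)
    next
      case False
      have "fps_nth (P n * Q (Suc n)) k = 0" by (rule high[of "n-1" _ "Suc n"]) (use False Pd Qd nz[OF n] in auto)
      moreover have "fps_nth (P (Suc n) * Q n) k = 0" by (rule high[of n _ n]) (use False Pd Qd nz[OF n] in auto)
      ultimately show ?thesis by (simp add: R_def)
    qed
    then have "R = 0" by (simp add: fps_eq_iff)
    then show ?thesis by (simp add: R_def)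
  qed
  have cross: "P N * Q n = P n * Q N" if "n \<ge> N" for n
    using that
  proof (induction n rule: dec_induct)
    case (step n)
    have "(P N * Q (Suc n)) * Q n = (P N * Q n) * Q (Suc n)" by (simp add: mult_ac)
    also have "\<dots> = (P n * Q (Suc n)) * Q N" using step.IH by (simp add: mult_ac)
    also have "\<dots> = (P (Suc n) * Q N) * Q n" using \<open>\<And>n. n \<ge> N \<Longrightarrow> P n * Q (Suc n) = P (Suc n) * Q n\<close>[OF step.hyps(1)] by (simp add: mult_ac)
    finally show ?case using Q0[OF step.hyps(1)] by simp
  qed simp
  define D where "D = Q N * F - P N"
  have "fps_nth D k = 0" for k
  proof -
    \<comment> \<open>As \<open>k < n\<close>, a nonzero \<open>D\<close> of order at most
      \<open>k\<close> would give \<open>Q n * D\<close> an order of at most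
      \<open>(n - 1) + k\<close>, which is below the order \<open>2 * n - 1\<close> that
      \<open>E n\<close> guarantees.\<close>
    define n where "n = N + k + 1"
    have n: "n \<ge> N" "k < n" by (auto simp: n_def)
    have eq: "Q n * D = E n * Q N"
      unfolding D_def E_def using cross[OF n(1)] by (simp add: algebra_simps)
    show ?thesis
    proof (rule ccontr)
      assume "fps_nth D k \<noteq> 0"
      then have D0: "D \<noteq> 0" "subdegree D \<le> k" by (auto intro: subdegree_leI)
      obtain i where i: "i < n" "fps_nth (Q n) i \<noteq> 0"
        using Q0[OF n(1)] Qd by (metis fps_nonzero_nth not_le_imp_less)
      have "subdegree (Q n * D) \<le> i + k"
        using D0 Q0[OF n(1)] subdegree_leI[OF i(2)] by simp
      moreover have "subdegree (Q n * D) \<ge> 2 * n - 1"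

      proof (rule subdegree_geI)
        show "Q n * D \<noteq> 0" using D0 Q0[OF n(1)] by simp
        show "fps_nth (Q n * D) i = 0" if "i < 2 * n - 1" for i
          unfolding eq by (rule low[OF E0[OF n(1)] that])
      qed
      ultimately show False using i n by linarith
    qed
  qed
  then have "D = 0" by (simp add: fps_eq_iff)
  then have "Q N * F = P N" by (simp add: D_def)
  moreover have "\<exists>p. A = fps_of_poly p" if "\<And>k. k \<ge> m \<Longrightarrow> fps_nth A k = 0" for A :: "'a fps" and m
  proof
    show "A = fps_of_poly (\<Sum>k<m. Polynomial.monom (fps_nth A k) k)"
      using that by (intro fps_ext) (simp add: coeff_sum sum.delta leI)
  qed
  ultimately show ?thesis using Qd[of N] Pd[of N] Q0[of N]
    by (metis fps_of_poly_0 order_refl)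
qed

section \<open>Hankel determinants as Gram determinants\<close>

text \<open>The linear functional whose moments are the coefficients of \<open>F\<close>. Its Gram
  matrix in the basis of monomials is the Hankel matrix, so the determinant can be estimated in a
  better adapted basis.\<close>

definition coeff_functional :: "'a::comm_ring_1 fps \<Rightarrow> 'a poly \<Rightarrow> 'a" where
  "coeff_functional F p = (\<Sum>k\<le>degree p. Polynomial.coeff p k * fps_nth F k)"

lemma coeff_functional_eq:
  "degree p < n \<Longrightarrow> coeff_functional F p = (\<Sum>k<n. Polynomial.coeff p k * fps_nth F k)"
  unfolding coeff_functional_def
  by (rule sum.mono_neutral_left) (auto simp: coeff_eq_0)

lemma coeff_functional_mult:
  assumes "degree p < n" "degree q < n"
  shows "coeff_functional F (p * q) = (\<Sum>k<n. \<Sum>l<n. Polynomial.coeff p k * Polynomial.coeff q l * fps_nth F (k + l))"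
proof -
  have d: "degree (p * q) < 2 * n" using degree_mult_le[of p q] assms by linarith
  have "coeff_functional F (p * q) = (\<Sum>m<2*n. (\<Sum>i\<le>m. Polynomial.coeff p i * Polynomial.coeff q (m - i)) * fps_nth F m)"
    using coeff_functional_eq[OF d, of F] by (simp add: coeff_mult)
  also have "\<dots> = (\<Sum>m<2*n. \<Sum>i\<le>m. Polynomial.coeff p i * Polynomial.coeff q (m - i) * fps_nth F (i + (m - i)))"
    by (simp add: sum_distrib_right)
  also have "\<dots> = (\<Sum>(i,j)\<in>{(i,j). i + j < 2*n}. Polynomial.coeff p i * Polynomial.coeff q j * fps_nth F (i + j))"
    by (rule sum.triangle_reindex[symmetric])
  also have "\<dots> = (\<Sum>(i,j)\<in>{..<n}\<times>{..<n}. Polynomial.coeff p i * Polynomial.coeff q j * fps_nth F (i + j))"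
  proof (rule sum.mono_neutral_right)
    have "{(i,j). i + j < 2*n} \<subseteq> {..<2*n} \<times> {..<2*n}" by auto
    then show "finite {(i,j). i + j < 2*n}" by (rule finite_subset) auto
    show "\<forall>x\<in>{(i, j). i + j < 2 * n} - {..<n} \<times> {..<n}. (case x of (i, j) \<Rightarrow> Polynomial.coeff p i * Polynomial.coeff q j * fps_nth F (i + j)) = 0"
    proof
      fix x assume x: "x \<in> {(i, j). i + j < 2 * n} - {..<n} \<times> {..<n}"
      obtain i j where ij: "x = (i, j)" by (cases x)
      then have "n \<le> i \<or> n \<le> j" using x by auto
      then have "Polynomial.coeff p i = 0 \<or> Polynomial.coeff q j = 0" using assms by (auto intro: coeff_eq_0)
      then show "(case x of (i, j) \<Rightarrow> Polynomial.coeff p i * Polynomial.coeff q j * fps_nth F (i + j)) = 0" using ij by auto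
    qed
  qed auto
  also have "\<dots> = (\<Sum>k<n. \<Sum>l<n. Polynomial.coeff p k * Polynomial.coeff q l * fps_nth F (k + l))"
    by (simp add: sum.cartesian_product)
  finally show ?thesis .
qed

definition Hankel :: "'a fps \<Rightarrow> nat \<Rightarrow> 'a::comm_ring_1 mat" where
  "Hankel F n = mat n n (\<lambda>(i,j). fps_nth F (i + j))"

lemma Hankel_carrier [simp]: "Hankel F n \<in> carrier_mat n n"
  by (simp add: Hankel_def)

text \<open>The matrix that expresses the monic polynomials \<open>p i\<close> through monomials is
  triangular with ones on the diagonal.\<close>

lemma det_Hankel_monic:
  fixes F :: "'a::idom fps"
  assumes deg: "\<And>i. i < n \<Longrightarrow> degree (p i) = i" and lc: "\<And>i. i < n \<Longrightarrow> lead_coeff (p i) = 1"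
  shows "Determinant.det (mat n n (\<lambda>(i,j). coeff_functional F (p i * p j))) = Determinant.det (Hankel F n)"
proof -
  define A where "A = mat n n (\<lambda>(i,j). Polynomial.coeff (p i) j)"
  have A: "A \<in> carrier_mat n n" by (simp add: A_def)
  have "Determinant.det A = prod_list (diag_mat A)"
    by (rule det_lower_triangular[OF _ A]) (auto simp: A_def deg coeff_eq_0)
  also have "\<dots> = 1"
    unfolding prod_list_diag_prod by (rule prod.neutral) (use lc deg in \<open>auto simp: A_def\<close>)
  finally have dA: "Determinant.det A = 1" .
  have "mat n n (\<lambda>(i,j). coeff_functional F (p i * p j)) = A * (Hankel F n * transpose_mat A)"
  proof (rule eq_matI)
    fix i j assume "i < dim_row (A * (Hankel F n * transpose_mat A))" "j < dim_col (A * (Hankel F n * transpose_mat A))"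
    then have ij: "i < n" "j < n" by (auto simp: A_def)
    have "(A * (Hankel F n * transpose_mat A)) $$ (i, j) = (\<Sum>k<n. Polynomial.coeff (p i) k * (\<Sum>l<n. fps_nth F (k + l) * Polynomial.coeff (p j) l))"
      using ij by (simp add: A_def Hankel_def times_mat_def scalar_prod_def atLeast0LessThan)
    also have "\<dots> = coeff_functional F (p i * p j)"
      using ij by (subst coeff_functional_mult[of _ n]) (auto simp: deg sum_distrib_left mult_ac)
    finally show "mat n n (\<lambda>(i,j). coeff_functional F (p i * p j)) $$ (i, j) = (A * (Hankel F n * transpose_mat A)) $$ (i, j)"
      using ij by simp
  qed (auto simp: A_def)
  moreover have AT: "transpose_mat A \<in> carrier_mat n n" using A by simp
  ultimately show ?thesis
    by (simp add: det_mult[OF A mult_carrier_mat[OF Hankel_carrier AT]]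
        det_mult[OF Hankel_carrier AT] det_transpose[OF A] dA)
qed

text \<open>All terms of the Leibniz expansion acquire the same unimodular factor. This lets the
  point of continuation be rotated to 1, although the rotated series need not be integral any
  more.\<close>

lemma norm_det_Hankel_rotate:
  fixes a :: "nat \<Rightarrow> complex"
  assumes w: "norm w = 1"
  shows "norm (Determinant.det (Hankel (Abs_fps (\<lambda>k. a k * w ^ k)) n)) = norm (Determinant.det (Hankel (Abs_fps a) n))"
proof -
  have pr: "(\<Prod>i=0..<n. a (i + p i) * w ^ (i + p i)) = (\<Prod>i=0..<n. w^i)^2 * (\<Prod>i=0..<n. a (i + p i))"
    if p: "p permutes {0..<n}" for p
  proof -
    have "(\<Prod>i=0..<n. w ^ p i) = (\<Prod>i=0..<n. w^i)"
      using prod.permute[OF p, of "\<lambda>i. w ^ i"] by (simp add: o_def)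
    then show ?thesis by (simp add: power_add prod.distrib power2_eq_square mult_ac)
  qed
  have "Determinant.det (Hankel (Abs_fps (\<lambda>k. a k * w ^ k)) n) = (\<Prod>i=0..<n. w^i)^2 * Determinant.det (Hankel (Abs_fps a) n)"
    unfolding det_def'[OF Hankel_carrier] sum_distrib_left
  proof (rule sum.cong[OF refl])
    fix p assume "p \<in> {p. p permutes {0..<n}}"
    then have p: "p permutes {0..<n}" by simp
    have "p i < n" if "i < n" for i using permutes_in_image[OF p, of i] that by simp
    then show "signof p * (\<Prod>i = 0..<n. Hankel (Abs_fps (\<lambda>k. a k * w ^ k)) n $$ (i, p i)) =
       (\<Prod>i=0..<n. w^i)^2 * (signof p * (\<Prod>i = 0..<n. Hankel (Abs_fps a) n $$ (i, p i)))"
      using pr[OF p] by (simp add: Hankel_def mult_ac)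
  qed
  moreover have "norm (\<Prod>i=0..<n. w^i) = 1" using w by (simp add: norm_power prod_norm[symmetric])
  ultimately show ?thesis by (simp add: norm_mult norm_power)
qed

lemma norm_det_le:
  fixes A :: "complex mat"
  assumes A: "A \<in> carrier_mat n n" and bd: "\<And>i j. i < n \<Longrightarrow> j < n \<Longrightarrow> norm (A $$ (i,j)) \<le> C * b i * b j"
    and b: "\<And>i. b i \<ge> 0" and C: "C \<ge> 0"
  shows "norm (Determinant.det A) \<le> fact n * C ^ n * (\<Prod>i=0..<n. b i)^2"
proof -
  have "norm (Determinant.det A) \<le> (\<Sum>p | p permutes {0..<n}. norm (signof p * (\<Prod>i = 0..<n. A $$ (i, p i)) :: complex))"
    unfolding det_def'[OF A] by (rule norm_sum)
  also have "\<dots> \<le> (\<Sum>p | p permutes {0..<n}. C ^ n * (\<Prod>i=0..<n. b i)^2)"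
  proof (rule sum_mono)
    fix p assume "p \<in> {p. p permutes {0..<n}}"
    then have p: "p permutes {0..<n}" by simp
    have pn: "p i < n" if "i < n" for i using permutes_in_image[OF p, of i] that by simp
    have "norm (signof p * (\<Prod>i = 0..<n. A $$ (i, p i)) :: complex) = (\<Prod>i = 0..<n. norm (A $$ (i, p i)))"
      by (simp add: norm_mult sign_def prod_norm)
    also have "\<dots> \<le> (\<Prod>i=0..<n. C * b i * b (p i))"
      using bd pn by (intro prod_mono) auto
    also have "\<dots> = C ^ n * (\<Prod>i=0..<n. b i) * (\<Prod>i=0..<n. b (p i))"
      by (simp add: prod.distrib)
    also have "(\<Prod>i=0..<n. b (p i)) = (\<Prod>i=0..<n. b i)"
      using prod.permute[OF p, of b] by (simp add: o_def)
    finally show "norm (signof p * (\<Prod>i = 0..<n. A $$ (i, p i)) :: complex) \<le> C ^ n * (\<Prod>i=0..<n. b i)^2"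
      by (simp add: power2_eq_square mult_ac)
  qed
  also have "\<dots> = fact n * C ^ n * (\<Prod>i=0..<n. b i)^2"
    by (simp add: card_permutations)
  finally show ?thesis .
qed

text \<open>An integer of modulus below 1 is 0, so all large Hankel matrices are singular and have
  kernel vectors.\<close>

lemma fps_rational_if_det_Hankel_small:
  fixes F :: "complex fps"
  assumes int: "\<And>n. fps_nth F n \<in> \<int>"
    and small: "eventually (\<lambda>n. norm (Determinant.det (Hankel F n)) < 1) sequentially"
  shows "\<exists>P Q. Q \<noteq> 0 \<and> fps_of_poly Q * F = fps_of_poly P"
proof -
  have det_int: "Determinant.det (Hankel F n) \<in> \<int>" for n
    unfolding det_def'[OF Hankel_carrier]
  proof (intro Ints_sum Ints_mult Ints_prod)
    fix p i assume "p \<in> {p. p permutes {0..<n}}" "i \<in> {0..<n}"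
    then have "p i < n" "i < n" using permutes_in_image[of p "{0..<n}" i] by auto
    then show "Hankel F n $$ (i, p i) \<in> \<int>" using int by (simp add: Hankel_def)
  qed (auto simp: sign_def)
  obtain N where N: "\<And>n. n \<ge> N \<Longrightarrow> norm (Determinant.det (Hankel F n)) < 1"
    using small by (auto simp: eventually_sequentially)
  have "\<exists>v. (\<exists>i<n. v i \<noteq> 0) \<and> (\<forall>j<n. (\<Sum>i<n. fps_nth F (i + j) * v i) = 0)" if n: "n \<ge> N" for n
  proof -
    obtain m where m: "Determinant.det (Hankel F n) = of_int m" using det_int by (auto elim: Ints_cases)
    then have "\<bar>m\<bar> < 1" using N[OF n] by simp
    then have "Determinant.det (Hankel F n) = 0" using m by simp
    then obtain v where v: "v \<in> carrier_vec n" "v \<noteq> 0\<^sub>v n" "Hankel F n *\<^sub>v v = 0\<^sub>v n"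
      using det_0_iff_vec_prod_zero[OF Hankel_carrier] by blast
    have "\<exists>i<n. vec_index v i \<noteq> 0" using v(1,2) by (metis eq_vecI carrier_vecD index_zero_vec)
    moreover have "(\<Sum>i<n. fps_nth F (i + j) * vec_index v i) = 0" if "j < n" for j
    proof -
      have "vec_index (Hankel F n *\<^sub>v v) j = 0" using v(3) that by simp
      then show ?thesis using that v(1) by (simp add: Hankel_def scalar_prod_def atLeast0LessThan add.commute)
    qed
    ultimately show ?thesis by blast
  qed
  then obtain v where "\<And>n. n \<ge> N \<Longrightarrow> (\<exists>i<n. v n i \<noteq> 0) \<and> (\<forall>j<n. (\<Sum>i<n. fps_nth F (i + j) * v n i) = 0)"
    by metis
  then show ?thesis by (intro fps_rational_if_Hankel_kernels[of N v]) auto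
qed

text \<open>On the unit circle the real part of \<open>geo_mean M w\<close> is \<open>(F - 1) / 2\<close> for the Fejer kernel \<open>F\<close>, so it is large
  at 1 and close to \<open>- 1/2\<close> away from 1. Hence \<open>bulge M s\<close> maps the circle to a curve that leaves the closed disc near 1
  only; \<open>bulge_poly M s\<close> is a monic polynomial whose values at the inverses of the points of this curve
  are smaller than 1.\<close>

definition geo_mean :: "nat \<Rightarrow> complex \<Rightarrow> complex" where
  "geo_mean M w = (\<Sum>k<M. \<Sum>j=1..k. w ^ j) / of_nat M"

lemma Re_circle_quotient:
  assumes "norm w = 1" "w \<noteq> 1"
  shows "Re (w / (1 - w)) = -1/2"
proof -
  have n: "(Re w)\<^sup>2 + (Im w)\<^sup>2 = 1" using assms(1) by (simp add: cmod_def)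
  then have "Re w \<noteq> 1" using assms(2) by (auto simp: complex_eq_iff)
  moreover have "Re (w / (1 - w)) = (Re w * (1 - Re w) - (Im w)\<^sup>2) / ((1 - Re w)\<^sup>2 + (Im w)\<^sup>2)"
    by (simp add: Re_divide power2_eq_square)
  moreover have "(1 - Re w)\<^sup>2 + (Im w)\<^sup>2 = 2 * (1 - Re w)" using n by (simp add: power2_eq_square algebra_simps)
  moreover have "Re w * (1 - Re w) - (Im w)\<^sup>2 = - (1 - Re w)" using n by (simp add: power2_eq_square algebra_simps)
  ultimately have "Re (w / (1 - w)) = - (1 - Re w) / (2 * (1 - Re w))" by metis
  moreover have "- x / (2 * x) = - 1 / 2" if "x \<noteq> 0" for x :: real using that by simp
  ultimately show ?thesis using \<open>Re w \<noteq> 1\<close> by (metis right_minus_eq)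
qed

lemma geo_mean_eq:
  assumes "w \<noteq> 1" "M > 0"
  shows "geo_mean M w = w / (1 - w) - w * (1 - w ^ M) / (of_nat M * (1 - w)\<^sup>2)"
proof -
  have "(\<Sum>j=1..k. w ^ j) * (1 - w) = w - w * w ^ k" for k
  proof (induction k)
    case (Suc k)
    have "(\<Sum>j=1..Suc k. w ^ j) * (1 - w) = (\<Sum>j=1..k. w ^ j) * (1 - w) + w * w ^ k * (1 - w)"
      by (simp add: distrib_right)
    also have "\<dots> = (w - w * w ^ k) + w * w ^ k * (1 - w)" by (simp only: Suc)
    also have "\<dots> = w - w * w ^ Suc k" by (simp add: algebra_simps)
    finally show ?case .
  qed simp
  then have s: "(\<Sum>j=1..k. w ^ j) = (w - w * w ^ k) / (1 - w)" for k
    using assms(1) by (simp add: eq_divide_eq)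
  have "(\<Sum>k<M. \<Sum>j=1..k. w ^ j) = (of_nat M * w - w * (\<Sum>k<M. w ^ k)) / (1 - w)"
    unfolding s by (simp add: sum_divide_distrib[symmetric] sum_subtractf sum_distrib_left)
  also have "(\<Sum>k<M. w ^ k) = (1 - w ^ M) / (1 - w)"
    using assms(1) by (simp add: sum_gp_strict)
  finally show ?thesis using assms unfolding geo_mean_def by (simp add: divide_simps power2_eq_square)
qed

text \<open>In the closed form the main term has real part \<open>- 1/2\<close>, and the remainder
  is at most \<open>2 / (M * \<eta>\<^sup>2)\<close>; the constant 8 makes that at most 1/4.\<close>

lemma Re_geo_mean_le:
  assumes "norm w = 1" "norm (w - 1) \<ge> \<eta>" "\<eta> > 0" "M > 0" "8 \<le> M * \<eta>\<^sup>2"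
  shows "Re (geo_mean M w) \<le> -1/4"
proof -
  have w1: "w \<noteq> 1" using assms by auto
  have "norm (w * (1 - w ^ M) / (of_nat M * (1 - w)\<^sup>2)) = norm (1 - w ^ M) / (M * norm (w - 1) ^ 2)"
    using assms by (simp add: norm_divide norm_mult norm_power norm_minus_commute)
  also have "\<dots> \<le> 2 / (M * \<eta>\<^sup>2)"
  proof (rule frac_le)
    show "norm (1 - w ^ M) \<le> 2" using norm_triangle_ineq4[of 1 "w ^ M"] assms by (simp add: norm_power)
    show "M * \<eta>\<^sup>2 \<le> M * norm (w - 1) ^ 2" using assms by (intro mult_left_mono power_mono) auto
  qed (use assms in auto)
  also have "\<dots> \<le> 1/4" using assms by (simp add: field_simps)
  finally have "- Re (w * (1 - w ^ M) / (of_nat M * (1 - w)\<^sup>2)) \<le> 1/4"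
    using complex_Re_le_cmod[of "- (w * (1 - w ^ M) / (of_nat M * (1 - w)\<^sup>2))"] by simp
  then show ?thesis using Re_circle_quotient[OF assms(1) w1] geo_mean_eq[OF w1 assms(4)] by simp
qed

lemma norm_geo_mean_le:
  assumes "norm w \<le> 1" "M > 0"
  shows "norm (geo_mean M w) \<le> M"
proof -
  have "norm (\<Sum>k<M. \<Sum>j=1..k. w ^ j) \<le> (\<Sum>k<M. \<Sum>j=1..k. 1)"
    using assms by (intro sum_norm_le) (auto simp: norm_power power_le_one)
  also have "\<dots> = (\<Sum>k<M. real k)" by simp
  also have "\<dots> \<le> (\<Sum>k<M. real M)" by (intro sum_mono) auto
  finally have "norm (\<Sum>k<M. \<Sum>j=1..k. w ^ j) \<le> real M * real M" by simp
  then show ?thesis using assms by (simp add: geo_mean_def norm_divide field_simps)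
qed

lemma abs_power_diff_one_le:
  fixes \<rho> :: real
  assumes "0 \<le> \<rho>" "\<rho> \<le> 2"
  shows "\<bar>\<rho> ^ j - 1\<bar> \<le> 2 ^ j * \<bar>\<rho> - 1\<bar>"
proof -
  have "\<bar>\<rho> ^ j - 1\<bar> \<le> (2 ^ j - 1) * \<bar>\<rho> - 1\<bar>"
  proof (induction j)
    case (Suc j)
    have "\<bar>\<rho> ^ Suc j - 1\<bar> = \<bar>\<rho> * (\<rho> ^ j - 1) + (\<rho> - 1)\<bar>" by (simp add: algebra_simps)
    also have "\<dots> \<le> \<rho> * \<bar>\<rho> ^ j - 1\<bar> + \<bar>\<rho> - 1\<bar>"
      using abs_triangle_ineq[of "\<rho> * (\<rho> ^ j - 1)" "\<rho> - 1"] assms by (simp add: abs_mult)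
    also have "\<dots> \<le> 2 * ((2 ^ j - 1) * \<bar>\<rho> - 1\<bar>) + \<bar>\<rho> - 1\<bar>"
      using Suc assms by (intro add_right_mono mult_mono) auto
    finally show ?case by (simp add: algebra_simps)
  qed simp
  also have "\<dots> \<le> 2 ^ j * \<bar>\<rho> - 1\<bar>" by (intro mult_right_mono) auto
  finally show ?thesis .
qed

lemma geo_mean_lipschitz:
  fixes \<rho> :: real and w :: complex
  assumes "norm w = 1" "0 \<le> \<rho>" "\<rho> \<le> 2" "M > 0"
  shows "norm (geo_mean M (w * \<rho>) - geo_mean M w) \<le> M * 2 ^ M * \<bar>\<rho> - 1\<bar>"
proof -
  have "norm ((\<Sum>k<M. \<Sum>j=1..k. (w * \<rho>) ^ j) - (\<Sum>k<M. \<Sum>j=1..k. w ^ j))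
     = norm (\<Sum>k<M. \<Sum>j=1..k. w ^ j * (\<rho> ^ j - 1))"
    by (simp add: sum_subtractf[symmetric] power_mult_distrib algebra_simps)
  also have "\<dots> \<le> (\<Sum>k<M. \<Sum>j=1..k. 2 ^ M * \<bar>\<rho> - 1\<bar>)"
  proof (intro sum_norm_le)
    fix k j assume kj: "k \<in> {..<M}" "j \<in> {1..k}"
    have "norm (w ^ j * (\<rho> ^ j - 1)) = \<bar>\<rho> ^ j - 1\<bar>"

    proof -
      have "w ^ j * (\<rho> ^ j - 1) = w ^ j * of_real (\<rho> ^ j - 1)" by simp
      then show ?thesis using assms(1) by (simp only: norm_mult norm_power norm_of_real) simp
    qed
    also have "\<dots> \<le> 2 ^ j * \<bar>\<rho> - 1\<bar>" using abs_power_diff_one_le assms by auto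
    also have "\<dots> \<le> 2 ^ M * \<bar>\<rho> - 1\<bar>" using kj by (intro mult_right_mono power_increasing) auto
    finally show "norm (w ^ j * (\<rho> ^ j - 1)) \<le> 2 ^ M * \<bar>\<rho> - 1\<bar>" .
  qed
  also have "\<dots> = (\<Sum>k<M. real k) * (2 ^ M * \<bar>\<rho> - 1\<bar>)" by (simp add: sum_distrib_right)
  also have "\<dots> \<le> (\<Sum>k<M. real M) * (2 ^ M * \<bar>\<rho> - 1\<bar>)" by (intro mult_right_mono sum_mono) auto
  finally have "norm ((\<Sum>k<M. \<Sum>j=1..k. (w * \<rho>) ^ j) - (\<Sum>k<M. \<Sum>j=1..k. w ^ j)) \<le> M * (M * 2 ^ M * \<bar>\<rho> - 1\<bar>)"
    by (simp add: algebra_simps)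
  then show ?thesis using assms(4)
    by (simp add: geo_mean_def norm_divide flip: diff_divide_distrib) (simp add: divide_simps mult_ac)
qed

text \<open>This is \<open>2 * a \<le> 1 + a\<^sup>2\<close> for \<open>a = norm (1 + x)\<close>. It
  linearises the modulus at 1 with an error of second order.\<close>

lemma norm_one_plus_le: "norm (1 + x :: complex) \<le> 1 + Re x + (norm x)\<^sup>2 / 2"
proof -
  have "(norm (1 + x))\<^sup>2 = 1 + 2 * Re x + (norm x)\<^sup>2"
    by (simp add: cmod_power2) (simp add: power2_eq_square algebra_simps)
  moreover have "2 * norm (1 + x) \<le> 1 + (norm (1 + x))\<^sup>2"
    using sum_squares_bound[of 1 "norm (1 + x)"] by simp
  ultimately show ?thesis by simp
qed

text \<open>On the circle the inverse of \<open>w\<close> is its conjugate, so the average is the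
  real part of \<open>geo_mean\<close>, written in a form that is holomorphic off 0; hence the image
  of the circle is a valid path. The shift 1/8 leaves the radial factor below 1 wherever the real
  part is at most \<open>- 1/4\<close>, and it is also the margin that pays for second order
  errors.\<close>

definition bulge :: "nat \<Rightarrow> real \<Rightarrow> complex \<Rightarrow> complex" where
  "bulge M s w = w * (1 + of_real s * ((geo_mean M w + geo_mean M (inverse w)) / 2 + 1/8))"

lemma bulge_circle:
  assumes "norm w = 1"
  shows "bulge M s w = w * of_real (1 + s * (Re (geo_mean M w) + 1/8))"
proof -
  have "inverse w = cnj w" using complex_norm_square[of w] assms by (intro inverse_unique) simp
  then have "geo_mean M (inverse w) = cnj (geo_mean M w)" by (simp add: geo_mean_def)
  then show ?thesis by (simp add: bulge_def complex_add_cnj)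
qed

text \<open>A perturbation of \<open>x ^ M\<close> which at \<open>x = 1 / z\<close> equals
  \<open>(1 + s * M * geo_mean M z) / z ^ M\<close>.\<close>

definition bulge_poly :: "nat \<Rightarrow> real \<Rightarrow> complex poly" where
  "bulge_poly M s = Polynomial.monom 1 M + Polynomial.smult (of_real s) (\<Sum>k<M. \<Sum>j=1..k. Polynomial.monom 1 (M - j))"

lemma degree_bulge_poly:
  assumes "M > 0"
  shows "degree (bulge_poly M s) = M" "lead_coeff (bulge_poly M s) = 1"
proof -
  have "degree (\<Sum>k<M. \<Sum>j=1..k. Polynomial.monom (1::complex) (M - j)) < M"
    using assms by (intro degree_sum_less) (auto intro!: le_less_trans[OF degree_monom_le])
  then have d: "degree (Polynomial.smult (of_real s) (\<Sum>k<M. \<Sum>j=1..k. Polynomial.monom (1::complex) (M - j))) < M"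
    using degree_smult_le le_less_trans by blast
  then show *: "degree (bulge_poly M s) = M" unfolding bulge_poly_def
    by (subst degree_add_eq_left) (auto simp: degree_monom_eq)
  show "lead_coeff (bulge_poly M s) = 1" unfolding * unfolding bulge_poly_def using coeff_eq_0[OF d] by simp
qed

lemma poly_bulge_poly:
  assumes "z \<noteq> 0" "M > 0"
  shows "poly (bulge_poly M s) (inverse z) = inverse z ^ M * (1 + of_real (s * M) * geo_mean M z)"
proof -
  have "(\<Sum>k<M. \<Sum>j=1..k. inverse z ^ (M - j)) = inverse z ^ M * (\<Sum>k<M. \<Sum>j=1..k. z ^ j)"
    unfolding sum_distrib_left using assms
    by (intro sum.cong refl) (auto simp: power_diff field_simps)
  then show ?thesis using assms(2)
    by (simp add: bulge_poly_def poly_monom poly_sum geo_mean_def algebra_simps)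
qed

text \<open>Let \<open>U\<close> be the real part of \<open>geo_mean\<close> at \<open>w\<close> and
  \<open>V = U + 1/8\<close>. To first order in \<open>s\<close>, the factor \<open>z ^ M\<close> in
  the denominator has modulus \<open>1 + s * M * V\<close> on the curve and the numerator has
  modulus \<open>1 + s * M * U\<close>, so the quotient is about \<open>1 - s * M / 8\<close>. The
  hypothesis \<open>s2\<close> says that the second order terms, divided by \<open>s\<close>, stay
  below \<open>M / 8\<close>.\<close>

lemma bulge_poly_small:
  assumes M: "M > 0" and s: "0 < s" "s * (M + 1) \<le> 1/2"
    and s2: "s * (M * (M * 2 ^ M * (M + 1)) + M ^ 4) < M / 8" and w: "norm w = 1"
  shows "norm (poly (bulge_poly M s) (inverse (bulge M s w))) < 1" "bulge M s w \<noteq> 0"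
proof -
  define U where "U = Re (geo_mean M w)"
  define V where "V = U + 1/8"
  define \<rho> where "\<rho> = 1 + s * V"
  have g: "norm (geo_mean M w) \<le> M" using norm_geo_mean_le w M by simp
  then have "\<bar>U\<bar> \<le> M" using abs_Re_le_cmod[of "geo_mean M w"] by (simp add: U_def)
  then have V: "\<bar>V\<bar> \<le> M + 1" by (simp add: V_def)
  have sV: "\<bar>s * V\<bar> \<le> s * (M + 1)" using V s by (simp add: abs_mult)
  then have \<rho>: "1/2 \<le> \<rho>" "\<rho> \<le> 2" using s by (auto simp: \<rho>_def)
  have b: "bulge M s w = w * of_real \<rho>" unfolding bulge_circle[OF w] by (simp add: \<rho>_def V_def U_def)
  show nz: "bulge M s w \<noteq> 0" using b w \<rho> by auto
  have lip: "norm (geo_mean M (w * \<rho>) - geo_mean M w) \<le> M * 2 ^ M * (s * (M + 1))"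
  proof -
    have "real M * 2 ^ M * \<bar>\<rho> - 1\<bar> \<le> real M * 2 ^ M * (s * (real M + 1))"
      using sV by (intro mult_left_mono) (auto simp: \<rho>_def add.commute)
    then have "norm (geo_mean M (w * \<rho>) - geo_mean M w) \<le> real M * 2 ^ M * (s * (real M + 1))"
      using geo_mean_lipschitz[OF w, of \<rho> M] \<rho> M by linarith
    then show ?thesis by (simp add: add.commute)
  qed
  have "norm (1 + of_real (s * M) * geo_mean M (w * \<rho>)) \<le>
      norm (1 + of_real (s * M) * geo_mean M w) + norm (of_real (s * M) * (geo_mean M (w * \<rho>) - geo_mean M w))"
    using norm_triangle_ineq[of "1 + of_real (s * M) * geo_mean M w" "of_real (s * M) * (geo_mean M (w * \<rho>) - geo_mean M w)"]
    by (simp add: algebra_simps)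
  also have "norm (1 + of_real (s * M) * geo_mean M w) \<le> 1 + s * M * U + (s * M * M)\<^sup>2 / 2"
  proof -
    have "(norm (of_real (s * M) * geo_mean M w))\<^sup>2 \<le> (s * M * M)\<^sup>2"
      using g s by (intro power_mono) (auto simp: norm_mult intro!: mult_left_mono)
    then show ?thesis using norm_one_plus_le[of "of_real (s * M) * geo_mean M w"] by (simp add: U_def)
  qed
  also have "norm (of_real (s * M) * (geo_mean M (w * \<rho>) - geo_mean M w)) \<le> s * M * (M * 2 ^ M * (s * (M + 1)))"
    using lip s by (simp add: norm_mult mult_left_mono)
  also have "1 + s * M * U + (s * M * M)\<^sup>2 / 2 + s * M * (M * 2 ^ M * (s * (M + 1))) \<le>
     1 + s * M * U + s * (s * (M * (M * 2 ^ M * (M + 1)) + M ^ 4))"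
    using s(1) by (simp add: power2_eq_square algebra_simps power4_eq_xxxx)
  also have "\<dots> < 1 + s * M * U + s * (M / 8)"
    using s2 s(1) by (intro add_strict_left_mono mult_strict_left_mono) auto
  also have "\<dots> = 1 + M * (s * V)" by (simp add: V_def algebra_simps)
  also have "\<dots> \<le> \<rho> ^ M" unfolding \<rho>_def
    using sV s by (intro Bernoulli_inequality) linarith
  finally have lt: "norm (1 + of_real (s * M) * geo_mean M (w * \<rho>)) < \<rho> ^ M" by simp
  have "norm (poly (bulge_poly M s) (inverse (bulge M s w))) = norm (1 + of_real (s * M) * geo_mean M (w * \<rho>)) / \<rho> ^ M"
  proof -
    have nb: "norm (bulge M s w) = \<rho>" using b w \<rho> by (simp add: norm_mult)
    have "norm (poly (bulge_poly M s) (inverse (bulge M s w))) =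
        inverse \<rho> ^ M * norm (1 + of_real (s * M) * geo_mean M (bulge M s w))"
      unfolding poly_bulge_poly[OF nz M] by (simp only: norm_mult norm_power norm_inverse nb)
    then show ?thesis by (simp only: b) (simp add: divide_inverse power_inverse mult.commute)
  qed
  also have "\<dots> < 1" using lt \<rho>(1) by (subst divide_less_eq_1_pos) auto
  finally show "norm (poly (bulge_poly M s) (inverse (bulge M s w))) < 1" .
qed

section \<open>Moving the contour\<close>

lemma ball_subset_eball:
  assumes "1 \<le> R"
  shows "ball 0 1 \<subseteq> eball (0::complex) R"
proof
  fix z :: complex assume "z \<in> ball 0 1"
  then have "ereal (norm z) < ereal 1" by simp
  also have "ereal 1 \<le> R" using assms by (simp add: one_ereal_def)
  finally show "z \<in> eball 0 R" by (simp add: in_eball_iff)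
qed

lemma contour_integral_coeff_functional:
  assumes rad: "fps_conv_radius G \<ge> 1" and eq: "\<And>z. norm z < 1 \<Longrightarrow> h z = eval_fps G z"
  shows "((\<lambda>z. h z * poly p (inverse z) * inverse z) has_contour_integral 2 * pi * \<i> * coeff_functional G p) (circlepath 0 (1/4))"
proof -
  have "cball 0 (1/4) \<subseteq> ball (0::complex) 1" by auto
  then have sub: "cball (0::complex) (1/4) \<subseteq> eball 0 (fps_conv_radius G)"
    using ball_subset_eball[OF rad] by blast
  have hol: "eval_fps G holomorphic_on cball 0 (1/4)" by (intro holomorphic_on_eval_fps sub)
  have r0: "fps_conv_radius G > 0" by (rule less_le_trans[OF _ rad]) simp
  have one: "((\<lambda>z. eval_fps G z / z ^ Suc k) has_contour_integral 2 * pi * \<i> * fps_nth G k) (circlepath 0 (1/4))" for k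
    using Cauchy_has_contour_integral_higher_derivative_circlepath[of 0 "1/4" "eval_fps G" 0 k]
      holomorphic_on_imp_continuous_on[OF hol] holomorphic_on_subset[OF hol ball_subset_cball] fps_nth_conv_deriv[OF r0, of k]
    by (simp add: mult_ac)
  have "((\<lambda>z. \<Sum>k\<le>degree p. Polynomial.coeff p k * (eval_fps G z / z ^ Suc k)) has_contour_integral
      (\<Sum>k\<le>degree p. Polynomial.coeff p k * (2 * pi * \<i> * fps_nth G k))) (circlepath 0 (1/4))"
    by (intro has_contour_integral_sum has_contour_integral_lmul one) auto
  moreover have "(\<Sum>k\<le>degree p. Polynomial.coeff p k * (2 * pi * \<i> * fps_nth G k)) = 2 * pi * \<i> * coeff_functional G p"
    by (simp add: coeff_functional_def sum_distrib_left mult_ac)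
  ultimately have 1: "((\<lambda>z. \<Sum>k\<le>degree p. Polynomial.coeff p k * (eval_fps G z / z ^ Suc k)) has_contour_integral
      2 * pi * \<i> * coeff_functional G p) (circlepath 0 (1/4))" by simp
  show ?thesis
  proof (rule has_contour_integral_eq[OF 1])
    fix z :: complex assume "z \<in> path_image (circlepath 0 (1/4))"
    then have "norm z = 1/4" by simp
    then show "(\<Sum>k\<le>degree p. Polynomial.coeff p k * (eval_fps G z / z ^ Suc k)) = h z * poly p (inverse z) * inverse z"
      using eq[of z] unfolding poly_altdef sum_distrib_left sum_distrib_right
      by (intro sum.cong refl) (simp add: field_simps)
  qed
qed

lemma holomorphic_bulge: "bulge M s holomorphic_on - {0}"
  unfolding bulge_def geo_mean_def by (intro holomorphic_intros) auto

lemma circlepath_unit: "circlepath 0 r t = of_real r * circlepath 0 1 t" "norm (circlepath 0 1 t) = 1"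
  by (auto simp: circlepath_def part_circlepath_def linepath_def norm_exp_eq_Re)

text \<open>The functional is a contour integral of \<open>h z * poly p (1 / z) / z\<close>, and the contour may be moved to the
  bulging curve, where the powers of \<open>q\<close> decay.\<close>

lemma coeff_functional_decay:
  assumes rad: "fps_conv_radius G \<ge> 1" and r: "r > 0"
    and hol: "h holomorphic_on (ball 0 1 \<union> ball 1 r)" and eq: "\<And>z. norm z < 1 \<Longrightarrow> h z = eval_fps G z"
  obtains q M \<rho> C where "degree q = M" "M > 0" "lead_coeff q = 1" "0 < \<rho>" "\<rho> < 1" "C \<ge> 0"
    "\<And>j e. e < 2 * M \<Longrightarrow> norm (coeff_functional G (q ^ j * Polynomial.monom 1 e)) \<le> C * \<rho> ^ j"
proof -
  \<comment> \<open>Half of \<open>r\<close> is spent on the distance from \<open>w\<close> to 1,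
    the other half on the distance from \<open>w\<close> to the point of the segment.\<close>
  define \<eta> where "\<eta> = r / 2"
  have \<eta>: "\<eta> > 0" using r by (simp add: \<eta>_def)
  obtain M :: nat where M: "real M > 8 / \<eta>\<^sup>2" using reals_Archimedean2 by blast
  have M0: "M > 0" using M \<eta> by (cases M) (auto simp: not_less)
  have M8: "8 \<le> M * \<eta>\<^sup>2" using M \<eta> by (simp add: field_simps)
  define K where "K = M * (M * 2 ^ M * (M + 1)) + M ^ 4"
  \<comment> \<open>The first bound keeps the radial factor at least 1/2 and within
    \<open>\<eta>\<close> of 1; the second one yields the smallness required by
    \<open>bulge_poly_small\<close>.\<close>
  define s where "s = min (min (1/2) \<eta> / (M + 1)) (M / (16 * (real K + 1)))"
  have s0: "0 < s" using M0 \<eta> by (simp add: s_def)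
  have "s \<le> min (1/2) \<eta> / (M + 1)" by (simp add: s_def)
  then have "s * (M + 1) \<le> min (1/2) \<eta>" by (subst (asm) pos_le_divide_eq) auto
  then have s: "0 < s" "s * (M + 1) \<le> 1/2" "s * (M + 1) \<le> \<eta>" using s0 by auto
  have "s * K \<le> M / (16 * (real K + 1)) * K" by (intro mult_right_mono) (auto simp: s_def)
  also have "\<dots> \<le> M / 16" using M0 by (simp add: field_simps)
  also have "\<dots> < M / 8" using M0 by simp
  finally have sK: "s * (M * (M * 2 ^ M * (M + 1)) + M ^ 4) < M / 8" by (simp add: K_def)
  define q where "q = bulge_poly M s"
  define D where "D = (ball 0 1 \<union> ball 1 r) - {0::complex}"
  have D: "open D" unfolding D_def by auto
  have hD: "h holomorphic_on D" using hol by (rule holomorphic_on_subset) (auto simp: D_def)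
  define \<gamma> where "\<gamma> = bulge M s \<circ> circlepath 0 1"
  have v\<gamma>: "valid_path \<gamma>" unfolding \<gamma>_def
    by (rule valid_path_compose_holomorphic[OF _ holomorphic_bulge]) auto
  \<comment> \<open>Each segment is radial, so it avoids 0. It can leave the unit disc only over a
    point \<open>w\<close> where the curve bulges outwards, and such a \<open>w\<close> is close to
    1.\<close>
  have seg: "closed_segment (\<gamma> t) (circlepath 0 (1/4) t) \<subseteq> D" for t
  proof
    fix z assume z: "z \<in> closed_segment (\<gamma> t) (circlepath 0 (1/4) t)"
    define w where "w = circlepath 0 1 t"
    have w: "norm w = 1" by (simp add: w_def circlepath_unit(2))
    define V where "V = Re (geo_mean M w) + 1/8"
    have g: "\<gamma> t = w * of_real (1 + s * V)" unfolding \<gamma>_def o_def w_def[symmetric] V_def by (rule bulge_circle[OF w])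
    have "norm (geo_mean M w) \<le> M" using norm_geo_mean_le w M0 by simp
    then have "\<bar>V\<bar> \<le> M + 1" using abs_Re_le_cmod[of "geo_mean M w"] by (simp add: V_def)
    then have sV: "\<bar>s * V\<bar> \<le> s * (M + 1)" using s by (simp add: abs_mult)
    have c: "circlepath 0 (1/4) t = w * of_real (1/4)" unfolding w_def by (metis circlepath_unit(1) mult.commute)
    obtain u where u: "0 \<le> u" "u \<le> 1" "z = (1 - u) *\<^sub>R \<gamma> t + u *\<^sub>R circlepath 0 (1/4) t"
      using z by (auto simp: closed_segment_def)
    define \<sigma> where "\<sigma> = (1 - u) * (1 + s * V) + u * (1/4)"
    have "z = of_real (1 - u) * (w * of_real (1 + s * V)) + of_real u * (w * of_real (1/4))"
      unfolding u(3) g c by (simp only: scaleR_conv_of_real)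
    then have z\<sigma>: "z = w * of_real \<sigma>" unfolding \<sigma>_def of_real_add of_real_mult by (simp only: distrib_left mult_ac)
    have "1/2 \<le> 1 + s * V" using sV s(2) by linarith
    then have "\<sigma> \<ge> (1 - u) * (1/2) + u * (1/4)" unfolding \<sigma>_def using u by (intro add_right_mono mult_left_mono) auto
    then have \<sigma>0: "\<sigma> > 0" using u by (simp add: field_simps)
    show "z \<in> D"
    proof (cases "\<sigma> < 1")
      case True
      then show ?thesis using \<sigma>0 w by (auto simp: D_def z\<sigma> norm_mult)
    next
      case False
      have "(1 - u) * (1 + s * V) \<le> (1 - u) * (1 + \<bar>s * V\<bar>)" using u by (intro mult_left_mono) auto
      then have "\<sigma> \<le> (1 - u) * (1 + \<bar>s * V\<bar>) + u * (1 + \<bar>s * V\<bar>)" unfolding \<sigma>_def using u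
        by (intro add_mono mult_left_mono) auto
      then have \<sigma>1: "\<sigma> \<le> 1 + \<bar>s * V\<bar>" by (simp add: algebra_simps)
      \<comment> \<open>For negative \<open>V\<close> both ends of the segment have modulus below 1,
        and so has \<open>z\<close>.\<close>
      have "V \<ge> 0"
      proof (rule ccontr)
        assume V: "\<not> V \<ge> 0"
        then have "s * V < 0" using s(1) by (simp add: mult_pos_neg)
        then have "(1 - u) * (1 + s * V) \<le> (1 - u) * 1" using u by (intro mult_left_mono) auto
        moreover have "1 \<le> (1 - u) * (1 + s * V) + u * (1/4)" using False by (simp add: \<sigma>_def)
        ultimately have "1 \<le> (1 - u) * 1 + u * (1/4)" by (rule order.trans[OF _ add_right_mono, rotated])
        then have "u \<le> 0" by simp
        then have "u = 0" using u(1) by simp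
        then show False using False \<open>s * V < 0\<close> by (simp add: \<sigma>_def)
      qed
      then have "norm (w - 1) < \<eta>"
        using Re_geo_mean_le[OF w _ \<eta> M0 M8] by (force simp: V_def)
      moreover have "norm (z - w) \<le> s * (M + 1)"
      proof -
        have "z - w = w * of_real (\<sigma> - 1)" by (simp add: z\<sigma> algebra_simps)
        then have "norm (z - w) = \<bar>\<sigma> - 1\<bar>" using w by (simp only: norm_mult norm_of_real) simp
        then show ?thesis using \<sigma>1 False sV by linarith
      qed
      ultimately have "norm (z - 1) < r" using norm_triangle_ineq[of "z - w" "w - 1"] s(3) by (simp add: \<eta>_def)
      then show ?thesis using \<sigma>0 w by (auto simp: D_def z\<sigma> dist_norm norm_minus_commute)
    qed
  qed
  have hom: "homotopic_loops D \<gamma> (circlepath 0 (1/4))"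
  proof (rule homotopic_loops_linear)
    show "pathfinish \<gamma> = pathstart \<gamma>" by (simp add: \<gamma>_def pathfinish_compose pathstart_compose)
    show "path \<gamma>" using v\<gamma> by (rule valid_path_imp_path)
  qed (use seg in auto)
  have im: "path_image \<gamma> \<subseteq> D" using seg unfolding path_image_def by force
  have comp: "compact (path_image \<gamma>)" using v\<gamma> by (simp add: compact_path_image valid_path_imp_path)
  have ne: "path_image \<gamma> \<noteq> {}" by simp
  define N where "N = (\<lambda>z. poly q (inverse z))"
  have Nhol: "N holomorphic_on D" unfolding N_def by (intro holomorphic_intros) (auto simp: D_def)
  have inv_hol: "inverse holomorphic_on D" by (intro holomorphic_intros) (auto simp: D_def)
  have cont: "continuous_on (path_image \<gamma>) (\<lambda>z. norm (f z))" if "f holomorphic_on D" for f :: "complex \<Rightarrow> complex"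
    using continuous_on_subset[OF holomorphic_on_imp_continuous_on[OF that] im] by (rule continuous_on_norm)
  obtain z0 where z0: "z0 \<in> path_image \<gamma>" "\<And>z. z \<in> path_image \<gamma> \<Longrightarrow> norm (N z) \<le> norm (N z0)"
    using continuous_attains_sup[OF comp ne cont[OF Nhol]] by blast
  obtain z1 :: complex where z1: "\<And>z. z \<in> path_image \<gamma> \<Longrightarrow> norm (h z) \<le> norm (h z1)"
    using continuous_attains_sup[OF comp ne cont[OF hD]] by blast
  obtain z2 :: complex where z2: "\<And>z. z \<in> path_image \<gamma> \<Longrightarrow> norm (inverse z) \<le> norm (inverse z2)"
    using continuous_attains_sup[OF comp ne cont[OF inv_hol]] by blast
  have N1: "norm (N z0) < 1"
  proof -
    obtain t where "z0 = bulge M s (circlepath 0 1 t)" using z0(1) by (auto simp: path_image_def \<gamma>_def)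
    then show ?thesis unfolding N_def q_def using bulge_poly_small(1)[OF M0 s(1,2) sK circlepath_unit(2)] by blast
  qed
  define \<rho> where "\<rho> = (norm (N z0) + 1) / 2"
  have \<rho>: "norm (N z0) < \<rho>" "0 < \<rho>" "\<rho> < 1" using N1 by (auto simp: \<rho>_def intro: add_nonneg_pos)
  define B where "B = norm (h z1) + 1"
  define B2 where "B2 = norm (inverse z2) + 1"
  have B: "B \<ge> 1" "B2 \<ge> 1" by (auto simp: B_def B2_def)
  \<comment> \<open>The constant \<open>L\<close> has to serve all \<open>j\<close> and
    \<open>e\<close> at once and is available for functions bounded on an open neighbourhood of the
    curve. So the maxima on the curve are relaxed: \<open>\<rho>\<close> lies between the maximum of
    \<open>N\<close> and 1, and \<open>B\<close>, \<open>B2\<close> exceed the other two maxima by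
    1.\<close>
  define S where "S = (D \<inter> N -` ball 0 \<rho>) \<inter> (D \<inter> h -` ball 0 B) \<inter> (D \<inter> inverse -` ball 0 B2)"
  have S: "open S" unfolding S_def
    by (intro open_Int continuous_open_preimage holomorphic_on_imp_continuous_on Nhol hD inv_hol D open_ball)
  have imS: "path_image \<gamma> \<subseteq> S"
  proof
    fix z assume z: "z \<in> path_image \<gamma>"
    then show "z \<in> S" using im z0(2)[OF z] z1[OF z] z2[OF z] \<rho> by (auto simp: S_def B_def B2_def)
  qed
  obtain L where L: "L > 0" "\<And>f b. f holomorphic_on S \<Longrightarrow> (\<And>z. z \<in> S \<Longrightarrow> norm (f z) \<le> b) \<Longrightarrow> norm (contour_integral \<gamma> f) \<le> L * b"
    using contour_integral_bound_exists[OF S v\<gamma> imS] by metis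
  define C where "C = L * (B * B2 ^ (2 * M))"
  have "norm (coeff_functional G (q ^ j * Polynomial.monom 1 e)) \<le> C * \<rho> ^ j" if e: "e < 2 * M" for j e
  proof -
    define f where "f = (\<lambda>z. h z * poly (q ^ j * Polynomial.monom 1 e) (inverse z) * inverse z)"
    have fD: "f holomorphic_on D" unfolding f_def by (intro holomorphic_intros hD) (auto simp: D_def)
    have "2 * pi * \<i> * coeff_functional G (q ^ j * Polynomial.monom 1 e) = contour_integral (circlepath 0 (1/4)) f"
      using contour_integral_coeff_functional[OF rad eq, of "q ^ j * Polynomial.monom 1 e"] unfolding f_def
      by (metis contour_integral_unique)
    also have "\<dots> = contour_integral \<gamma> f"
      by (rule Cauchy_theorem_homotopic_loops[OF hom D fD v\<gamma>, symmetric]) auto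
    finally have 1: "2 * pi * \<i> * coeff_functional G (q ^ j * Polynomial.monom 1 e) = contour_integral \<gamma> f" .
    have "norm (f z) \<le> B * \<rho> ^ j * B2 ^ (2 * M)" if z: "z \<in> S" for z
    proof -
      have b: "norm (N z) \<le> \<rho>" "norm (h z) \<le> B" "norm (inverse z) \<le> B2" using z by (auto simp: S_def)
      have "norm (f z) = norm (h z) * norm (N z) ^ j * norm (inverse z) ^ Suc e"
        by (simp add: f_def N_def poly_monom norm_mult norm_power mult_ac)
      also have "\<dots> \<le> B * \<rho> ^ j * B2 ^ Suc e"
        using b B \<rho> by (intro mult_mono power_mono) auto
      also have "\<dots> \<le> B * \<rho> ^ j * B2 ^ (2 * M)"
        using e B \<rho> by (intro mult_left_mono power_increasing) auto
      finally show ?thesis .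
    qed
    then have "norm (contour_integral \<gamma> f) \<le> L * (B * \<rho> ^ j * B2 ^ (2 * M))"
      using fD by (intro L(2)) (auto intro: holomorphic_on_subset simp: S_def)
    then have "2 * pi * norm (coeff_functional G (q ^ j * Polynomial.monom 1 e)) \<le> C * \<rho> ^ j"
      unfolding 1[symmetric] by (simp add: norm_mult C_def mult_ac)
    moreover have "1 * norm (coeff_functional G (q ^ j * Polynomial.monom 1 e)) \<le> 2 * pi * norm (coeff_functional G (q ^ j * Polynomial.monom 1 e))"
      using pi_ge_two by (intro mult_right_mono) auto
    ultimately show ?thesis by linarith
  qed
  then show ?thesis
    using that[of q M \<rho> C] degree_bulge_poly[OF M0] M0 \<rho> L(1) B by (auto simp: q_def C_def)
qed

text \<open>The polynomials \<open>q ^ (i div M) * x ^ (i mod M)\<close> are monic of degree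
  \<open>i\<close>, and two remainders add up to less than \<open>2 * M\<close>, so the entries of
  the Gram matrix decay in both indices. Multiplied over a permutation, this gives a factor
  exponentially small in the square of \<open>n\<close>, against which \<open>n!\<close> and
  \<open>C ^ n\<close> are harmless.\<close>

lemma det_Hankel_tendsto_0:
  assumes rad: "fps_conv_radius G \<ge> 1" and r: "r > 0"
    and hol: "h holomorphic_on (ball 0 1 \<union> ball 1 r)" and eq: "\<And>z. norm z < 1 \<Longrightarrow> h z = eval_fps G z"
  shows "eventually (\<lambda>n. norm (Determinant.det (Hankel G n)) < 1) sequentially"
proof -
  obtain q M \<rho> C where q: "degree q = M" "M > 0" "lead_coeff q = 1" and \<rho>: "0 < \<rho>" "\<rho> < 1" and C: "C \<ge> 0"
    and bd: "\<And>j e. e < 2 * M \<Longrightarrow> norm (coeff_functional G (q ^ j * Polynomial.monom 1 e)) \<le> C * \<rho> ^ j"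
    using coeff_functional_decay[OF assms] by metis
  define p where "p = (\<lambda>i. q ^ (i div M) * Polynomial.monom 1 (i mod M))"
  have q0: "q \<noteq> 0" using q by auto
  have lcp: "lead_coeff (p i) = 1" for i
    using q(3) by (simp add: p_def lead_coeff_mult lead_coeff_power degree_monom_eq)
  have degp: "degree (p i) = i" for i
    using q0 q by (simp add: p_def degree_mult_eq degree_power_eq degree_monom_eq monom_eq_0_iff)
  define b where "b = (\<lambda>i. \<rho> ^ (i div M))"
  have le: "norm (Determinant.det (Hankel G n)) \<le> fact n * C ^ n * (\<Prod>i=0..<n. b i)^2" for n
    unfolding det_Hankel_monic[of n p G, OF degp lcp, symmetric]
  proof (rule norm_det_le)
    fix i j assume ij: "i < n" "j < n"
    have "p i * p j = q ^ (i div M + j div M) * Polynomial.monom 1 (i mod M + j mod M)"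
      by (simp add: p_def power_add mult_monom mult_ac)
    moreover have "i mod M < M" "j mod M < M" using q(2) by auto
    then have "norm (coeff_functional G (q ^ (i div M + j div M) * Polynomial.monom 1 (i mod M + j mod M))) \<le> C * \<rho> ^ (i div M + j div M)"
      by (intro bd) linarith
    ultimately have "norm (coeff_functional G (p i * p j)) \<le> C * \<rho> ^ (i div M + j div M)" by metis
    then show "norm (mat n n (\<lambda>(i, j). coeff_functional G (p i * p j)) $$ (i, j)) \<le> C * b i * b j"
      using ij by (simp add: b_def power_add mult.assoc)
  qed (use C \<rho> in \<open>auto simp: b_def\<close>)
  \<comment> \<open>The decay per block of length \<open>M\<close> is spread over the single
    indices; the rounding in \<open>i div M\<close> costs one factor
    \<open>1 / \<rho>\<close>.\<close>
  define \<sigma> where "\<sigma> = \<rho> powr (1 / M)"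
  have \<sigma>: "0 < \<sigma>" "\<sigma> < 1" using \<rho> q(2) powr_less_mono2[of "1 / M" \<rho> 1] by (auto simp: \<sigma>_def)
  have b_le: "b i \<le> \<sigma> ^ i / \<rho>" for i
  proof -
    have "real i = real (i div M) * M + real (i mod M)" by (metis div_mult_mod_eq of_nat_add of_nat_mult)
    moreover have "i mod M < M" using q(2) by simp
    ultimately have "real i / M \<le> real (i div M) + 1" using q(2) by (simp add: field_simps)
    then have "\<rho> powr (real (i div M) + 1) \<le> \<rho> powr (real i / M)" using \<rho> by (intro powr_mono') auto
    moreover have "\<rho> powr (real i / M) = \<sigma> ^ i" using \<rho> \<sigma>
      by (simp add: \<sigma>_def powr_powr flip: powr_realpow)
    ultimately show ?thesis using \<rho> by (simp add: b_def powr_add powr_realpow field_simps)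
  qed
  have prod_le: "(\<Prod>i=0..<n. b i)^2 \<le> (\<sigma> ^ (n - 1) / \<rho>\<^sup>2) ^ n" for n
  proof -
    have "(\<Prod>i=0..<n. b i) \<le> (\<Prod>i=0..<n. \<sigma> ^ i / \<rho>)" using b_le \<rho> by (intro prod_mono) (auto simp: b_def)
    also have "\<dots> = \<sigma> ^ (\<Sum>i=0..<n. i) / \<rho> ^ n" by (simp add: prod_dividef power_sum)
    finally have "(\<Prod>i=0..<n. b i)^2 \<le> (\<sigma> ^ (\<Sum>i=0..<n. i) / \<rho> ^ n)^2"
      using \<rho> by (intro power_mono prod_nonneg) (auto simp: b_def)
    also have "\<dots> = \<sigma> ^ (2 * (\<Sum>i=0..<n. i)) / \<rho> ^ (2 * n)"
      by (simp add: power_divide power_mult mult.commute flip: power_mult)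
    also have "2 * (\<Sum>i=0..<n. i) = (n - 1) * n" by (induction n) (auto simp: algebra_simps diff_mult_distrib)
    finally show ?thesis by (simp add: power_divide flip: power_mult)
  qed
  have tend: "(\<lambda>n. real n * (C * (\<sigma> ^ (n - 1) / \<rho>\<^sup>2))) \<longlonglongrightarrow> 0"
  proof -
    have "(\<lambda>n. of_nat n * \<sigma> ^ n) \<longlonglongrightarrow> 0" by (rule powser_times_n_limit_0) (use \<sigma> in auto)
    then have "(\<lambda>n. (C / \<rho>\<^sup>2 / \<sigma>) * (of_nat n * \<sigma> ^ n)) \<longlonglongrightarrow> (C / \<rho>\<^sup>2 / \<sigma>) * 0" by (intro tendsto_mult tendsto_const)
    moreover have "eventually (\<lambda>n. (C / \<rho>\<^sup>2 / \<sigma>) * (of_nat n * \<sigma> ^ n) = real n * (C * (\<sigma> ^ (n - 1) / \<rho>\<^sup>2))) sequentially"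
      using eventually_gt_at_top[of 0]
    proof eventually_elim
      case (elim n)
      then have "\<sigma> ^ n = \<sigma> * \<sigma> ^ (n - 1)" by (cases n) auto
      then show ?case using \<sigma> by simp
    qed
    ultimately show ?thesis by (simp add: filterlim_cong)
  qed
  have "eventually (\<lambda>n. real n * (C * (\<sigma> ^ (n - 1) / \<rho>\<^sup>2)) < 1) sequentially"
    using order_tendstoD(2)[OF tend, of 1] by simp
  with eventually_gt_at_top[of 0] show ?thesis
  proof eventually_elim
    case (elim n)
    have "norm (Determinant.det (Hankel G n)) \<le> fact n * C ^ n * (\<sigma> ^ (n - 1) / \<rho>\<^sup>2) ^ n"
      using C by (intro order.trans[OF le[of n]] mult_left_mono[OF prod_le[of n]]) simp
    also have "\<dots> \<le> real n ^ n * C ^ n * (\<sigma> ^ (n - 1) / \<rho>\<^sup>2) ^ n"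
      using C \<sigma> fact_le_power[of n, where 'a = real] by (intro mult_right_mono) auto
    also have "\<dots> = (real n * (C * (\<sigma> ^ (n - 1) / \<rho>\<^sup>2))) ^ n" by (simp only: power_mult_distrib mult.assoc)
    also have "\<dots> < 1" using elim C \<sigma> by (intro power_less_one_iff[THEN iffD2]) auto
    finally show ?case .
  qed
qed

text \<open>After rotating \<open>w\<close> to 1, the series and its continuation are glued to one
  function on the union of two discs. The determinant estimate is made for the rotated series and
  carried back to \<open>F\<close>, where integrality is available.\<close>

theorem Polya_Carlson:
  fixes F :: "complex fps"
  assumes int: "\<And>n. fps_nth F n \<in> \<int>" and rad: "fps_conv_radius F \<ge> 1"
    and w: "norm w = 1" and U: "open U" "w \<in> U" and g: "g holomorphic_on U"
    and eq: "\<And>z. z \<in> U \<Longrightarrow> norm z < 1 \<Longrightarrow> g z = eval_fps F z"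
  shows "\<exists>P Q. Q \<noteq> 0 \<and> fps_of_poly Q * F = fps_of_poly P"
proof -
  obtain r where r: "r > 0" "ball w r \<subseteq> U" using U open_contains_ball by blast
  define G where "G = Abs_fps (\<lambda>k. fps_nth F k * w ^ k)"
  have GF: "eval_fps G z = eval_fps F (w * z)" for z
    by (simp add: eval_fps_def G_def power_mult_distrib mult_ac)
  have "conv_radius (\<lambda>k. w ^ k * fps_nth F k) = conv_radius (fps_nth F)"
    using w by (intro conv_radius_cong always_eventually allI) (auto simp: norm_mult norm_power)
  then have radG: "fps_conv_radius G \<ge> 1"
    using rad by (simp add: fps_conv_radius_def G_def mult.commute)
  have sub: "ball (0::complex) 1 \<subseteq> eball 0 (fps_conv_radius G)"
    by (rule ball_subset_eball[OF radG])
  define h where "h = (\<lambda>z. if z \<in> ball 0 1 then eval_fps G z else g (w * z))"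
  have img: "w * z \<in> U" if "z \<in> ball 1 r" for z
  proof -
    have "norm (w * z - w) = norm (z - 1)" using w by (simp flip: right_diff_distrib[of w z 1, simplified] add: norm_mult)
    then show ?thesis using that r by (auto simp: dist_norm norm_minus_commute)
  qed
  have "h holomorphic_on (ball 0 1 \<union> ball 1 r)"
    unfolding h_def
  proof (rule holomorphic_on_If_Un)
    show "eval_fps G holomorphic_on ball 0 1" by (intro holomorphic_on_eval_fps sub)
    show "(\<lambda>z. g (w * z)) holomorphic_on ball 1 r"
      by (rule holomorphic_on_compose_gen[OF _ g, unfolded o_def]) (use img in \<open>auto intro!: holomorphic_intros\<close>)
    show "eval_fps G z = g (w * z)" if "z \<in> ball 0 1" "z \<in> ball 1 r" for z
      using eq[OF img[OF that(2)]] that w by (simp add: GF norm_mult)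
  qed auto
  then have "eventually (\<lambda>n. norm (Determinant.det (Hankel G n)) < 1) sequentially"
    by (rule det_Hankel_tendsto_0[OF radG r(1)]) (simp add: h_def)
  then have "eventually (\<lambda>n. norm (Determinant.det (Hankel F n)) < 1) sequentially"
    unfolding G_def norm_det_Hankel_rotate[OF w] by (simp add: fps_nth_inverse)
  then show ?thesis by (intro fps_rational_if_det_Hankel_small int)
qed

section \<open>Exponentials of power series\<close>

lemma conv_radius_ge_1_if_subexponential:
  fixes f :: "nat \<Rightarrow> complex"
  assumes f: "\<And>n. n \<ge> 1 \<Longrightarrow> norm (f n) \<le> K * real n ^ d * exp (c * sqrt (real n))" and c: "c > 0"
  shows "conv_radius f \<ge> 1"
proof (rule conv_radius_geI_ex')
  fix r :: real assume r: "0 < r" "ereal r < 1"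
  define k where "k = - ln r"
  have k: "k > 0" using r by (simp add: k_def)
  have rk: "r ^ n = exp (- k * real n)" for n using r exp_of_nat_mult[of n "ln r"] by (simp add: k_def mult.commute)
  define p where "p = real d"
  have p: "p \<ge> 0" by (simp add: p_def)
  have "(\<lambda>n. norm (f n * of_real r ^ n)) \<in> O(\<lambda>n. real n powr p * exp (c * sqrt (real n) - k * real n))"
  proof (rule bigoI[of _ "\<bar>K\<bar>"], rule eventually_sequentiallyI[of 1])
    fix n :: nat assume n: "n \<ge> 1"
    have "norm (norm (f n * of_real r ^ n)) = norm (f n) * exp (- k * real n)"
      using r by (simp add: norm_mult norm_power rk)
    also have "\<dots> \<le> (K * real n ^ d * exp (c * sqrt (real n))) * exp (- k * real n)"
      by (intro mult_right_mono f n) simp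
    also have "\<dots> = K * (real n powr p * exp (c * sqrt (real n) - k * real n))"
      using n by (simp add: p_def powr_realpow exp_diff exp_minus divide_inverse)
    also have "\<dots> \<le> \<bar>K\<bar> * norm (real n powr p * exp (c * sqrt (real n) - k * real n))"
      using mult_right_mono[OF abs_ge_self[of K], of "norm (real n powr p * exp (c * sqrt (real n) - k * real n))"] by simp
    finally show "norm (norm (f n * of_real r ^ n)) \<le> \<bar>K\<bar> * norm (real n powr p * exp (c * sqrt (real n) - k * real n))" .
  qed
  also have "(\<lambda>n. real n powr p * exp (c * sqrt (real n) - k * real n)) \<in> O(\<lambda>n. inverse ((real n)\<^sup>2))"
    using k c by real_asymp
  finally have "(\<lambda>n. norm (f n * of_real r ^ n)) \<in> O(\<lambda>n. inverse ((real n)\<^sup>2))" .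
  moreover have "summable (\<lambda>n. norm (inverse ((real n)\<^sup>2)))"
    using inverse_power_summable[of 2] by simp
  ultimately have "summable (\<lambda>n. norm (f n * of_real r ^ n))" by (rule summable_comparison_test_bigo[rotated])
  then show "summable (\<lambda>n. f n * of_real r ^ n)" by (rule summable_norm_cancel)
qed

text \<open>Every root \<open>r\<close>, counted with multiplicity, contributes the expansion of
  \<open>1 / (z - r)\<close>, whose coefficients \<open>- ((1 / r) ^ Suc n)\<close> have modulus at
  most 1.\<close>

lemma logarithmic_derivative_bounded:
  fixes P :: "complex poly"
  assumes "P \<noteq> 0" "\<And>z. poly P z = 0 \<Longrightarrow> norm z \<ge> 1"
  shows "\<exists>A. fps_of_poly P * A = fps_deriv (fps_of_poly P) \<and> (\<forall>n. norm (fps_nth A n) \<le> degree P)"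
  using assms
proof (induction "degree P" arbitrary: P)
  case 0
  then obtain c where "P = [:c:]" by (metis degree_eq_zeroE)
  then show ?case by (intro exI[of _ 0]) (simp add: fps_of_poly_const)
next
  case (Suc m)
  then have "P \<noteq> [:a:]" for a by auto
  then obtain r where r: "poly P r = 0"
    using fundamental_theorem_of_algebra_alt[of P] by blast
  then obtain P1 where P1: "P = [:- r, 1:] * P1" by (metis poly_eq_0_iff_dvd dvdE)
  have P10: "P1 \<noteq> 0" using Suc.prems P1 by auto
  then have deg: "degree P = Suc (degree P1)" by (simp add: P1 degree_mult_eq del: mult_pCons_left)
  obtain A where A: "fps_of_poly P1 * A = fps_deriv (fps_of_poly P1)" "\<And>n. norm (fps_nth A n) \<le> degree P1"
    using Suc.hyps(1)[of P1] Suc.hyps(2) deg P10 Suc.prems(2) by (auto simp: P1)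
  have r1: "norm r \<ge> 1" using Suc.prems(2) r by blast
  then have r0: "r \<noteq> 0" by auto
  define U where "U = Abs_fps (\<lambda>n. - ((1 / r) ^ Suc n))"
  have U: "fps_of_poly [:- r, 1:] * U = 1"
  proof (rule fps_ext)
    fix n show "fps_nth (fps_of_poly [:- r, 1:] * U) n = fps_nth 1 n"
      using r0 by (cases n) (simp_all add: fps_of_poly_pCons U_def fps_mult_left_const_nth algebra_simps)
  qed
  have dl: "fps_deriv (fps_of_poly [:- r, 1:]) = 1" by (simp add: fps_of_poly_pCons)
  have "fps_of_poly P * (A + U) = fps_of_poly [:- r, 1:] * (fps_of_poly P1 * A) + fps_of_poly P1 * (fps_of_poly [:- r, 1:] * U)"
    unfolding P1 fps_of_poly_mult by (simp only: algebra_simps)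
  also have "\<dots> = fps_deriv (fps_of_poly P)"
    unfolding P1 fps_of_poly_mult fps_deriv_mult U dl A by (simp add: algebra_simps)
  finally have 1: "fps_of_poly P * (A + U) = fps_deriv (fps_of_poly P)" .
  have 2: "norm (fps_nth (A + U) n) \<le> degree P" for n
  proof -
    have "norm (fps_nth U n) = (1 / norm r) ^ Suc n" by (simp only: U_def fps_nth_Abs_fps norm_minus_cancel norm_power norm_divide norm_one)
    also have "\<dots> \<le> 1" using r1 by (intro power_le_one) (auto simp: divide_le_eq_1)
    finally show ?thesis using norm_triangle_ineq[of "fps_nth A n" "fps_nth U n"] A(2)[of n] deg by simp
  qed
  show ?case using 1 2 by blast
qed

lemma rational_fps_reduced:
  fixes Z :: "'a::field fps"
  assumes "fps_of_poly Q * Z = fps_of_poly P" "Q \<noteq> 0"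
  shows "\<exists>P Q. Q \<noteq> 0 \<and> fps_of_poly Q * Z = fps_of_poly P \<and> (\<forall>z. \<not> (poly P z = 0 \<and> poly Q z = 0))"
  using assms
proof (induction "degree Q" arbitrary: P Q rule: less_induct)
  case less
  show ?case
  proof (cases "\<exists>z. poly P z = 0 \<and> poly Q z = 0")
    case True
    then obtain z where "poly P z = 0" "poly Q z = 0" by blast
    then obtain P1 Q1 where PQ: "P = [:- z, 1:] * P1" "Q = [:- z, 1:] * Q1" by (metis poly_eq_0_iff_dvd dvdE)
    have nz: "fps_of_poly [:- z, 1:] \<noteq> 0" using fps_of_poly_eq_iff[of "[:- z, 1:]" 0] by simp
    have Q10: "Q1 \<noteq> 0" using less.prems PQ by auto
    then have "degree Q1 < degree Q" by (simp add: PQ degree_mult_eq del: mult_pCons_left)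
    moreover have "fps_of_poly [:- z, 1:] * (fps_of_poly Q1 * Z) = fps_of_poly [:- z, 1:] * fps_of_poly P1"
      using less.prems(1) unfolding PQ fps_of_poly_mult by (simp only: mult.assoc)
    then have "fps_of_poly Q1 * Z = fps_of_poly P1" using nz by (simp only: mult_left_cancel simp_thms)
    ultimately show ?thesis using less.hyps[of Q1 P1] Q10 by blast
  qed (use less.prems in blast)
qed

context
  fixes b :: "complex fps"
  assumes b0: "fps_nth b 0 = 0" and conv: "fps_conv_radius b \<ge> 1"
begin

lemma eval_fps_exp_compose:
  shows "fps_conv_radius (fps_exp 1 oo b) \<ge> 1"
    and "norm z < 1 \<Longrightarrow> eval_fps (fps_exp 1 oo b) z = exp (eval_fps b z)"
proof -
  have "(0::ereal) < 1" by simp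
  then have pos: "fps_conv_radius b > 0" using conv by (rule less_le_trans)
  have h1: "(exp \<circ> eval_fps b) has_fps_expansion (fps_exp 1 oo b)"
    using pos b0 by (intro has_fps_expansion_compose has_fps_expansion_exp1 eval_fps_has_fps_expansion)
  have h2: "exp \<circ> eval_fps b holomorphic_on eball 0 1"
    unfolding o_def by (intro holomorphic_intros eball_mono conv)
  show "fps_conv_radius (fps_exp 1 oo b) \<ge> 1"
    by (rule holomorphic_on_imp_fps_conv_radius_ge[OF h1 h2])
  show "eval_fps (fps_exp 1 oo b) z = exp (eval_fps b z)" if "norm z < 1"
    using has_fps_expansion_imp_eval_fps_eq[OF h1 that] h2 by (simp add: one_ereal_def)
qed

lemma deriv_bounded_if_exp_rational:
  assumes PQ: "fps_of_poly Q * (fps_exp 1 oo b) = fps_of_poly P" "Q \<noteq> 0"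
  shows "\<exists>K. \<forall>n. norm (fps_nth (fps_deriv b) n) \<le> K"
proof -
  define Z where "Z = fps_exp 1 oo b"
  note Z = eval_fps_exp_compose[folded Z_def]
  have dZ: "fps_deriv Z = Z * fps_deriv b"
    unfolding Z_def by (subst fps_compose_deriv[OF b0]) simp
  obtain P Q where PQ: "Q \<noteq> 0" "fps_of_poly Q * Z = fps_of_poly P" "\<And>z. \<not> (poly P z = 0 \<and> poly Q z = 0)"
    using rational_fps_reduced[OF PQ] unfolding Z_def by blast
  have Z0: "fps_nth Z 0 = 1" by (simp add: Z_def)
  then have "Z \<noteq> 0" by auto
  then have P0: "P \<noteq> 0" using PQ(1,2) by auto
  have ev: "poly Q z * exp (eval_fps b z) = poly P z" if "norm z < 1" for z
  proof -
    have "ereal (norm z) < fps_conv_radius Z" using Z(1) that by (metis ereal_less(3) less_le_trans)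
    then have "eval_fps (fps_of_poly Q * Z) z = eval_fps (fps_of_poly Q) z * eval_fps Z z"
      by (intro eval_fps_mult) auto
    then show ?thesis using Z(2)[OF that] by (simp add: PQ(2))
  qed
  \<comment> \<open>In the disc \<open>Q z * exp (..) = P z\<close> with a nonzero exponential, so
    \<open>P\<close> and \<open>Q\<close> would vanish together, which the reduced form
    excludes.\<close>
  have "norm z \<ge> 1" if "poly P z = 0" for z using ev[of z] PQ(3)[of z] that by force
  then obtain A where A: "fps_of_poly P * A = fps_deriv (fps_of_poly P)" "\<And>n. norm (fps_nth A n) \<le> degree P"
    using logarithmic_derivative_bounded[OF P0] by blast
  have "norm z \<ge> 1" if "poly Q z = 0" for z using ev[of z] PQ(3)[of z] that by force
  then obtain A' where A': "fps_of_poly Q * A' = fps_deriv (fps_of_poly Q)" "\<And>n. norm (fps_nth A' n) \<le> degree Q"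
    using logarithmic_derivative_bounded[OF PQ(1)] by blast
  have "fps_of_poly P * A = fps_deriv (fps_of_poly Q * Z)" by (simp only: A PQ(2))
  also have "\<dots> = fps_of_poly Q * (Z * fps_deriv b) + (fps_of_poly Q * A') * Z"
    by (simp only: fps_deriv_mult dZ A'(1))
  also have "\<dots> = fps_of_poly P * (fps_deriv b + A')" unfolding PQ(2)[symmetric] by (simp only: algebra_simps)
  finally have "A = fps_deriv b + A'" using P0 by simp
  then have e: "fps_deriv b = A - A'" by simp
  have "norm (fps_nth (fps_deriv b) n) \<le> real (degree P) + real (degree Q)" for n
    unfolding e fps_sub_nth using norm_triangle_ineq4[of "fps_nth A n" "fps_nth A' n"] A(2)[of n] A'(2)[of n] by linarith
  then show ?thesis by blast
qed

lemma natural_boundary_exp: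
  assumes unb: "\<And>K. \<exists>n. norm (fps_nth (fps_deriv b) n) > K" and int: "\<forall>n. fps_nth (fps_exp 1 oo b) n \<in> \<int>"
  shows "has_natural_boundary_circle (fps_exp 1 oo b) 1"
proof -
  define Z where "Z = fps_exp 1 oo b"
  have Z1: "fps_conv_radius Z \<ge> 1" using eval_fps_exp_compose(1) by (simp add: Z_def)
  have notrat: "Q = 0" if "fps_of_poly Q * Z = fps_of_poly P" for P Q
    using deriv_bounded_if_exp_rational[of Q P] unb that unfolding Z_def by (metis linorder_not_less)
  \<comment> \<open>With a larger radius the coefficients would be integers tending to 0, and
    \<open>Z\<close> would be a polynomial, contrary to irrationality.\<close>
  have "\<not> fps_conv_radius Z > 1"
  proof
    assume "fps_conv_radius Z > 1"
    then have "summable (\<lambda>n. fps_nth Z n * 1 ^ n)" by (intro summable_fps) (simp add: one_ereal_def)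
    then have "(\<lambda>n. fps_nth Z n) \<longlonglongrightarrow> 0" using summable_LIMSEQ_zero by fastforce
    then have "eventually (\<lambda>n. norm (fps_nth Z n) < 1) sequentially"
      using tendstoD[of "\<lambda>n. fps_nth Z n" 0 sequentially 1] by simp
    then obtain N where N: "\<And>n. n \<ge> N \<Longrightarrow> norm (fps_nth Z n) < 1" unfolding eventually_sequentially by blast
    have "fps_nth Z n = 0" if "n \<ge> N" for n
    proof -
      obtain k where k: "fps_nth Z n = of_int k" using int unfolding Z_def by (meson Ints_cases)
      then have "\<bar>k\<bar> < 1" using N[OF that] by simp
      then show ?thesis using k by simp
    qed
    then have "Polynomial.coeff (Abs_poly (fps_nth Z)) = fps_nth Z" by (intro coeff_Abs_poly[of N]) simp
    then have "fps_of_poly 1 * Z = fps_of_poly (Abs_poly (fps_nth Z))" by (intro fps_ext) (simp add: fps_of_poly_nth)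
    then show False using notrat[of 1] by simp
  qed
  then have "fps_conv_radius Z = ereal 1" using Z1 by (simp add: one_ereal_def order_antisym_conv)
  moreover have "\<not> (\<exists>U g. open U \<and> w \<in> U \<and> g holomorphic_on U \<and> (\<forall>z\<in>U \<inter> ball 0 1. g z = eval_fps Z z))"
    if w: "norm w = 1" for w
  proof clarify
    fix U g assume U: "open U" "w \<in> U" "g holomorphic_on U" "\<forall>z\<in>U \<inter> ball 0 1. g z = eval_fps Z z"
    have "\<exists>P Q. Q \<noteq> 0 \<and> fps_of_poly Q * Z = fps_of_poly P"
      by (rule Polya_Carlson[OF _ Z1 w U(1-3)]) (use int U(4) in \<open>auto simp: Z_def\<close>)
    then show False using notrat by blast
  qed
  ultimately show ?thesis unfolding has_natural_boundary_circle_def Z_def[symmetric] by auto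
qed

end

section \<open>Embeddings of cubes\<close>

text \<open>Being colourable with \<open>c\<close> colours is a metric form of having dimension less than \<open>c\<close>: the map \<open>t\<close> splits
  each colour class into clusters that are small and uniformly separated.\<close>

definition colouring :: "nat \<Rightarrow> 'a::metric_space set \<Rightarrow> real \<Rightarrow> real \<Rightarrow> ('a \<Rightarrow> nat) \<Rightarrow> ('a \<Rightarrow> nat) \<Rightarrow> bool" where
  "colouring c K \<delta> \<eta> k t \<longleftrightarrow> \<eta> > 0 \<and> (\<forall>x\<in>K. k x < c) \<and>
     (\<forall>x\<in>K. \<forall>y\<in>K. k x = k y \<longrightarrow> (if t x = t y then dist x y < \<delta> else \<eta> \<le> dist x y))"

definition colourable :: "nat \<Rightarrow> 'a::metric_space set \<Rightarrow> bool" where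
  "colourable c K \<longleftrightarrow> (\<forall>\<delta>>0. \<exists>\<eta> k t. colouring c K \<delta> \<eta> k t)"

lemma colouringD:
  assumes "colouring c K \<delta> \<eta> k t"
  shows "\<eta> > 0" "\<And>x. x \<in> K \<Longrightarrow> k x < c"
    "\<And>x y. \<lbrakk>x \<in> K; y \<in> K; k x = k y; t x = t y\<rbrakk> \<Longrightarrow> dist x y < \<delta>"
    "\<And>x y. \<lbrakk>x \<in> K; y \<in> K; k x = k y; t x \<noteq> t y\<rbrakk> \<Longrightarrow> \<eta> \<le> dist x y"
  using assms unfolding colouring_def by presburger+

lemma colourable_empty [simp]: "colourable c {}"
  unfolding colourable_def colouring_def by (auto intro: exI[of _ 1])

text \<open>A sum theorem. \<open>A\<close> is coloured first; \<open>B\<close> is then coloured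
  with clusters tiny compared to the separation of the clusters in \<open>A\<close>. A cluster of
  \<open>B\<close> that comes close to a point of \<open>A\<close> of its colour is merged into the
  cluster of that point. It cannot touch two different clusters of \<open>A\<close>, because these
  are at least \<open>8 * e\<close> apart, and clusters grow only by a small multiple of
  \<open>e\<close>.\<close>

lemma colourable_Un:
  assumes A: "colourable c A" and B: "colourable c B"
  shows "colourable c (A \<union> B)"
  unfolding colourable_def
proof (intro allI impI)
  fix \<delta> :: real assume \<delta>: "\<delta> > 0"
  then have d3: "\<delta>/3 > 0" by simp
  obtain \<eta>1 k1 t1 where A': "colouring c A (\<delta>/3) \<eta>1 k1 t1"
    using A d3 unfolding colourable_def by blast
  note 1 = colouringD[OF A']
  define e where "e = min \<eta>1 \<delta> / 8"
  have e: "e > 0" "8 * e \<le> \<eta>1" "8 * e \<le> \<delta>" using \<delta> 1(1) by (auto simp: e_def)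
  obtain \<eta>2 k2 t2 where B': "colouring c B e \<eta>2 k2 t2"
    using B e(1) unfolding colourable_def by blast
  note 2 = colouringD[OF B']
  \<comment> \<open>The cluster of \<open>x\<close> in \<open>B\<close> comes within
    \<open>e\<close> of the point \<open>a\<close> of the same colour. The condition depends on
    \<open>x\<close> only through its colour and cluster.\<close>
  define att where "att = (\<lambda>x a. a \<in> A \<and> k1 a = k2 x \<and> (\<exists>b\<in>B. k2 b = k2 x \<and> t2 b = t2 x \<and> dist a b < e))"
  have att_close: "dist a x < 2 * e" if "att x a" "x \<in> B" for x a
  proof -
    from that obtain b where b: "b \<in> B" "k2 b = k2 x" "t2 b = t2 x" "dist a b < e"
      unfolding att_def by auto
    have "dist b x < e" using 2(3) b that by auto
    then show ?thesis using dist_triangle[of a x b] b by linarith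
  qed
  define k where "k = (\<lambda>x. if x \<in> A then k1 x else k2 x)"
  \<comment> \<open>Even values name clusters of \<open>A\<close>, including what is merged into
    them; odd values name clusters of \<open>B\<close> left alone.\<close>
  define t where "t = (\<lambda>x. if x \<in> A then 2 * t1 x else if \<exists>a. att x a then 2 * t1 (SOME a. att x a) else 2 * t2 x + 1)"
  define \<eta> where "\<eta> = min \<eta>2 e"
  have same: "t1 a = t1 a'" if "att x a" "att x a'" "x \<in> B" for x a a'
  proof (rule ccontr)
    assume "t1 a \<noteq> t1 a'"
    then have "\<eta>1 \<le> dist a a'" using 1(4)[of a a'] that unfolding att_def by auto
    moreover have "dist a a' \<le> dist a x + dist a' x" by (metis dist_triangle2 )
    ultimately show False using att_close[of x a] att_close[of x a'] that e by linarith
  qed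
  have t_att: "t x = 2 * t1 a" if "att x a" "x \<in> B" "x \<notin> A" for x a
  proof -
    have "att x (SOME a. att x a)" using that(1) by (rule someI)
    then have "t1 (SOME a. att x a) = t1 a" using same that(1,2) by blast
    moreover have "\<exists>a. att x a" using that(1) by blast
    ultimately show ?thesis using that(3) unfolding t_def by presburger
  qed
  have t_noatt: "t x = 2 * t2 x + 1" if "\<And>a. \<not> att x a" "x \<notin> A" for x
    using that unfolding t_def by auto
  have AB: "if t x = t y then dist x y < \<delta> else \<eta> \<le> dist x y"
    if x: "x \<in> A" and y: "y \<in> B" "y \<notin> A" and k: "k1 x = k2 y" for x y
  proof (cases "\<exists>a. att y a")
    case True
    then obtain a where a: "att y a" by blast
    note ty = t_att[OF a y]
    have aA: "a \<in> A" "k1 a = k2 y" using a unfolding att_def by auto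
    show ?thesis
    proof (cases "t1 x = t1 a")
      case True
      then have "dist x a < \<delta>/3" using 1(3) x aA k by auto
      then have "dist x y < \<delta>" using dist_triangle[of x y a] att_close[OF a y(1)] e by linarith
      then show ?thesis using ty True x by (simp add: t_def)
    next
      case False
      have "\<not> dist x y < e"
      proof
        assume "dist x y < e"
        then have "att y x" unfolding att_def using x y k by auto
        then show False using same a y False by blast
      qed
      then show ?thesis using ty False x by (simp add: t_def \<eta>_def)
    qed
  next
    case False
    then have "t y = 2 * t2 y + 1" using t_noatt y by blast
    moreover have "t x = 2 * t1 x" using x by (simp add: t_def)
    ultimately have "t x \<noteq> t y" by presburger
    moreover have "\<not> dist x y < e" using False x y k unfolding att_def by auto
    ultimately show ?thesis by (simp add: \<eta>_def)
  qed
  have BB: "if t x = t y then dist x y < \<delta> else \<eta> \<le> dist x y"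
    if x: "x \<in> B" "x \<notin> A" and y: "y \<in> B" "y \<notin> A" and k: "k2 x = k2 y" for x y
  proof (cases "t2 x = t2 y")
    case True
    then have "att x = att y" using k unfolding att_def by auto
    then have "t x = t y" using x y True unfolding t_def by auto
    moreover have "dist x y < e" using 2(3) x y k True by auto
    ultimately show ?thesis using e by auto
  next
    case False
    then have "\<eta> \<le> dist x y" using 2(4) x y k by (fastforce simp: \<eta>_def)
    moreover have "dist x y < \<delta>" if txy: "t x = t y"
    proof -
      have "\<exists>a. att x a"
      proof (rule ccontr)
        assume n: "\<nexists>a. att x a"
        then have tx: "t x = 2 * t2 x + 1" using t_noatt x by blast
        have "\<nexists>a. att y a"
        proof
          assume "\<exists>a. att y a"
          then obtain a where "att y a" by blast
          then have "t y = 2 * t1 a" using t_att y by blast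
          then show False using tx txy by presburger
        qed
        then have "t y = 2 * t2 y + 1" using t_noatt y by blast
        then show False using tx txy False by simp
      qed
      then obtain a where a: "att x a" by blast
      have "\<exists>a. att y a"
      proof (rule ccontr)
        assume n: "\<nexists>a. att y a"
        then have ty: "t y = 2 * t2 y + 1" using t_noatt y by blast
        then show False using t_att[OF a x] txy by presburger
      qed
      then obtain a' where a': "att y a'" by blast
      have "t1 a = t1 a'" using t_att[OF a x] t_att[OF a' y] txy by simp
      then have "dist a a' < \<delta>/3" using 1(3)[of a a'] a a' k unfolding att_def by auto
      then show ?thesis
        using att_close[OF a x(1)] att_close[OF a' y(1)] dist_triangle3[of x y a] dist_triangle[of a y a'] e by linarith
    qed
    ultimately show ?thesis by auto
  qed
  have dA: "if t1 x = t1 y then dist x y < \<delta>/3 else \<eta>1 \<le> dist x y" if "x \<in> A" "y \<in> A" "k1 x = k1 y" for x y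
    using 1(3,4) that by simp
  show "\<exists>\<eta> k t. colouring c (A \<union> B) \<delta> \<eta> k t"
    unfolding colouring_def
  proof (rule exI[of _ \<eta>], rule exI[of _ k], rule exI[of _ t], intro conjI ballI impI)
    show "\<eta> > 0" using 2 e by (simp add: \<eta>_def)
    show "k x < c" if "x \<in> A \<union> B" for x using that 1(2) 2(2) by (auto simp: k_def)
    fix x y assume xy: "x \<in> A \<union> B" "y \<in> A \<union> B" "k x = k y"
    consider "x \<in> A" "y \<in> A" | "x \<in> A" "y \<notin> A" "y \<in> B" | "x \<notin> A" "x \<in> B" "y \<in> A" | "x \<notin> A" "x \<in> B" "y \<notin> A" "y \<in> B"
      using xy by blast
    then show "if t x = t y then dist x y < \<delta> else \<eta> \<le> dist x y"
    proof cases
      case 1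
      then have "k1 x = k1 y" using xy(3) by (simp add: k_def)
      with 1 have "if t1 x = t1 y then dist x y < \<delta>/3 else \<eta>1 \<le> dist x y"
        by (rule dA)
      then show ?thesis using 1 e \<delta> by (auto simp: t_def \<eta>_def split: if_splits)
    next
      case 2
      then show ?thesis using AB[of x y] xy(3) by (auto simp: k_def)
    next
      case 3
      then show ?thesis using AB[of y x] xy(3) by (auto simp: k_def dist_commute)
    next
      case 4
      then show ?thesis using BB[of x y] xy(3) by (auto simp: k_def)
    qed
  qed
qed

lemma colourable_UN:
  assumes "finite I" "\<And>i. i \<in> I \<Longrightarrow> colourable c (A i)"
  shows "colourable c (\<Union>i\<in>I. A i)"
  using assms by (induction I rule: finite_induct) (auto intro: colourable_Un)

lemma compact_gap:
  fixes A B :: "'a::metric_space set"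
  assumes "compact A" "compact B" "A \<inter> B = {}"
  shows "\<exists>d>0. \<forall>x\<in>A. \<forall>y\<in>B. d \<le> dist x y"
proof (cases "A = {} \<or> B = {}")
  case True
  then show ?thesis by (auto intro: exI[of _ 1])
next
  case False
  have "continuous_on (A \<times> B) (\<lambda>p. dist (fst p) (snd p))" by (intro continuous_intros)
  then obtain p where p: "p \<in> A \<times> B" "\<forall>q\<in>A \<times> B. dist (fst p) (snd p) \<le> dist (fst q) (snd q)"
    using continuous_attains_inf[OF compact_Times[OF assms(1,2)]] False by blast
  then have "dist (fst p) (snd p) > 0" using assms(3) by auto
  with p show ?thesis by (intro exI[of _ "dist (fst p) (snd p)"]) auto
qed

text \<open>Induction on the dimension. \<open>K\<close> is covered by finitely many small
  relatively open sets whose frontiers have smaller dimension and so are colourable with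
  \<open>n\<close> colours. Points near the union \<open>B\<close> of the frontiers copy the colour
  and cluster of a nearby point of \<open>B\<close>. The remaining points get the new colour
  \<open>n\<close> and are clustered by the first set of the cover that contains them.\<close>

lemma colourable_if_dim_le:
  fixes K :: "'a::metric_space set"
  assumes "compact K" "top_of_set K dim_le (int n - 1)"
  shows "colourable n K"
  using assms
proof (induction n arbitrary: K)
  case 0
  then have "top_of_set K = trivial_topology" by simp
  then have "K = {}" by (metis topspace_euclidean_subtopology topspace_discrete_topology)
  then show ?case by simp
next
  case (Suc n)
  note K = Suc.prems(1)
  have dim: "top_of_set K dim_le int n" using Suc.prems(2) by simp
  show ?case unfolding colourable_def
  proof (intro allI impI)
    fix \<delta> :: real assume \<delta>: "\<delta> > 0"
    have "\<exists>U. a \<in> U \<and> U \<subseteq> ball a (\<delta>/4) \<and> openin (top_of_set K) U \<and>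
        subtopology (top_of_set K) (top_of_set K frontier_of U) dim_le (int n - 1)" if "a \<in> K" for a
    proof -
      have "openin (top_of_set K) (K \<inter> ball a (\<delta>/4))" "a \<in> K \<inter> ball a (\<delta>/4)" using that \<delta> by auto
      then obtain U where "a \<in> U" "U \<subseteq> K \<inter> ball a (\<delta>/4)" "openin (top_of_set K) U"
         "subtopology (top_of_set K) (top_of_set K frontier_of U) dim_le (int n - 1)"
        using dim dimension_le.simps[of "top_of_set K" "int n"] by meson
      then show ?thesis by blast
    qed
    then obtain U where U: "\<And>a. a \<in> K \<Longrightarrow> a \<in> U a" "\<And>a. a \<in> K \<Longrightarrow> U a \<subseteq> ball a (\<delta>/4)"
      "\<And>a. a \<in> K \<Longrightarrow> openin (top_of_set K) (U a)"
      "\<And>a. a \<in> K \<Longrightarrow> subtopology (top_of_set K) (top_of_set K frontier_of (U a)) dim_le (int n - 1)"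
      by metis
    obtain O' where O': "\<And>a. a \<in> K \<Longrightarrow> open (O' a) \<and> U a = K \<inter> O' a"
      using U(3) unfolding openin_open by metis
    have "K \<subseteq> (\<Union>a\<in>K. O' a)" using U(1) O' by blast
    then obtain T where T: "T \<subseteq> K" "finite T" "K \<subseteq> (\<Union>a\<in>T. O' a)"
      using compactE_image[OF K, of K O'] O' by metis
    obtain f and p :: nat where f: "T = f ` {i. i < p}"
      using finite_imp_nat_seg_image_inj_on[OF T(2)] by metis
    define F where "F = (\<lambda>a. top_of_set K frontier_of (U a))"
    have FK: "F a \<subseteq> K" for a unfolding F_def using frontier_of_subset_topspace[of "top_of_set K" "U a"] by simp
    have Fcomp: "compact (F a)" for a
      unfolding F_def using closedin_frontier_of[of "top_of_set K" "U a"] K closedin_compact by blast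
    have UFcomp: "compact (U a \<union> F a)" if "a \<in> K" for a
    proof -
      have "top_of_set K closure_of U a = U a \<union> F a"
        unfolding F_def using U(3)[OF that]
        by (metis closure_of_subset frontier_of_def interior_of_openin Diff_partition openin_subset)
      then show ?thesis using closedin_closure_of[of "top_of_set K" "U a"] K closedin_compact by metis
    qed
    have FU: "F a \<inter> U a = {}" if "a \<in> K" for a
      unfolding F_def frontier_of_def using U(3)[OF that] interior_of_openin by fastforce
    define B where "B = (\<Union>a\<in>T. F a)"
    have Bcol: "colourable n B"
      unfolding B_def
    proof (intro colourable_UN T Suc.IH Fcomp)
      fix a assume "a \<in> T"
      then have "subtopology (top_of_set K) (F a) dim_le (int n - 1)" using U(4) T unfolding F_def by blast
      then show "top_of_set (F a) dim_le int n - 1" using FK[of a]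
        by (simp add: subtopology_subtopology inf.absorb2)
    qed
    have d3: "\<delta>/3 > 0" using \<delta> by simp
    obtain \<eta>0 k t where Bcol': "colouring n B (\<delta>/3) \<eta>0 k t"
    using Bcol d3 unfolding colourable_def by blast
  note kt = colouringD[OF Bcol']
    \<comment> \<open>Replacing two points by neighbours in \<open>B\<close> changes their distance
      by less than \<open>2 * e\<close>, which the margins in \<open>\<delta>/3\<close> and
      \<open>\<eta>0\<close> absorb.\<close>
    define e where "e = min \<eta>0 \<delta> / 9"
    have e: "e > 0" "9 * e \<le> \<eta>0" "9 * e \<le> \<delta>" using \<delta> kt(1) by (auto simp: e_def)
    define N where "N = {x\<in>K. \<exists>b\<in>B. dist x b < e}"
    define K' where "K' = K - N"
    have K'_eq: "K' = K \<inter> (\<Inter>b\<in>B. {x. e \<le> dist x b})" unfolding K'_def N_def by (fastforce simp: not_less not_le)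
    have K'comp: "compact K'" unfolding K'_eq
      by (intro compact_Int_closed K closed_INT ballI closed_Collect_le continuous_intros)
    have K'B: "K' \<inter> B = {}" using e(1) by (force simp: K'_eq)
    \<comment> \<open>Away from the frontiers, \<open>U a\<close> is relatively closed as well as
      open, so the two sides are disjoint compact sets.\<close>
    have gap: "\<exists>d>0. \<forall>x\<in>U a \<inter> K'. \<forall>y\<in>K' - U a. d \<le> dist x y" if "a \<in> T" for a
    proof -
      have aK: "a \<in> K" using that T by auto
      have "U a \<inter> K' = (U a \<union> F a) \<inter> K'" using K'B that B_def by blast
      then have 1: "compact (U a \<inter> K')" using UFcomp[OF aK] K'comp by (simp add: compact_Int)
      have "K' - U a = K' - O' a" using O'[OF aK] K'_def by blast
      then have "compact (K' - U a)" using K'comp O'[OF aK] by (simp add: compact_diff)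
      then show ?thesis using compact_gap[OF 1] by blast
    qed
    then obtain d where d: "\<And>a. a \<in> T \<Longrightarrow> d a > 0" "\<And>a x y. \<lbrakk>a \<in> T; x \<in> U a \<inter> K'; y \<in> K' - U a\<rbrakk> \<Longrightarrow> d a \<le> dist x y"
      by metis
    define \<eta> where "\<eta> = Min (insert e (d ` T))"
    have \<eta>: "\<eta> > 0" "\<eta> \<le> e" "\<And>a. a \<in> T \<Longrightarrow> \<eta> \<le> d a"
      using d(1) e(1) T(2) by (auto simp: \<eta>_def)
    define b where "b = (\<lambda>x. SOME b. b \<in> B \<and> dist x b < e)"
    have b: "b x \<in> B" "dist x (b x) < e" if "x \<in> N" for x
      using that someI_ex[of "\<lambda>b. b \<in> B \<and> dist x b < e"] unfolding b_def N_def by auto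
    define l where "l = (\<lambda>x. LEAST i. i < p \<and> x \<in> U (f i))"
    have l: "l x < p" "x \<in> U (f (l x))" and l_le: "\<And>i. i < p \<Longrightarrow> x \<in> U (f i) \<Longrightarrow> l x \<le> i" if "x \<in> K" for x
    proof -
      have "\<exists>a\<in>T. x \<in> U a" using that T(3) O' T(1) by blast
      then have "\<exists>i. i < p \<and> x \<in> U (f i)" unfolding f by auto
      then show "l x < p" "x \<in> U (f (l x))" unfolding l_def using LeastI_ex[of "\<lambda>i. i < p \<and> x \<in> U (f i)"] by auto
      show "\<And>i. i < p \<Longrightarrow> x \<in> U (f i) \<Longrightarrow> l x \<le> i" unfolding l_def by (simp add: Least_le)
    qed
    have far: "\<eta> \<le> dist x y" if "x \<in> K'" "y \<in> K'" "l x < l y" for x y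
    proof -
      have xy: "x \<in> K" "y \<in> K" using that K'_def by auto
      have T': "f (l x) \<in> T" using l[OF xy(1)] f by auto
      have "y \<notin> U (f (l x))" using l_le[OF xy(2) l(1)[OF xy(1)]] that by auto
      then show ?thesis using d(2)[OF T', of x y] \<eta>(3)[OF T'] l(2)[OF xy(1)] that by fastforce
    qed
    define k' where "k' = (\<lambda>x. if x \<in> N then k (b x) else n)"
    define t' where "t' = (\<lambda>x. if x \<in> N then t (b x) else l x)"
    show "\<exists>\<eta> k t. colouring (Suc n) K \<delta> \<eta> k t"
      unfolding colouring_def
    proof (rule exI[of _ \<eta>], rule exI[of _ k'], rule exI[of _ t'], intro conjI ballI impI)
      show "\<eta> > 0" by fact
      show "k' x < Suc n" for x using kt(2) b by (auto simp: k'_def less_Suc_eq)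
      fix x y assume xy: "x \<in> K" "y \<in> K" "k' x = k' y"
      show "if t' x = t' y then dist x y < \<delta> else \<eta> \<le> dist x y"
      proof (cases "x \<in> N")
        case True
        then have yN: "y \<in> N" using xy kt(2)[OF b(1)[OF True]] by (auto simp: k'_def split: if_splits)
        have k: "k (b x) = k (b y)" using xy True yN by (simp add: k'_def)
        have 1: "dist x y \<le> dist x (b x) + dist (b x) (b y) + dist y (b y)"
          using dist_triangle[of x y "b x"] dist_triangle2[of "b x" y "b y"] by linarith
        have 2: "dist (b x) (b y) \<le> dist x (b x) + dist x y + dist y (b y)"
          using dist_triangle3[of "b x" "b y" x] dist_triangle[of x "b y" y] by linarith
        show ?thesis using 1 2 b[OF True] b[OF yN] kt(3,4)[OF b(1)[OF True] b(1)[OF yN] k] e \<eta>(2)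
          by (auto simp: t'_def True yN)
      next
        case False
        then have yN: "y \<notin> N" using xy kt(2)[OF b(1)] by (force simp: k'_def split: if_splits)
        have K': "x \<in> K'" "y \<in> K'" using False yN xy by (auto simp: K'_def)
        show ?thesis
        proof (cases "l x = l y")
          case True
          have "f (l x) \<in> K" using l(1)[OF xy(1)] f T by auto
          then have "dist (f (l x)) x < \<delta>/4" "dist (f (l x)) y < \<delta>/4"
            using U(2) l(2)[OF xy(1)] l(2)[OF xy(2)] True by (auto simp: subset_iff)
          then have "dist x y < \<delta>" using dist_triangle3[of x y "f (l x)"] \<delta> by linarith
          then show ?thesis using True False yN by (simp add: t'_def)
        next
          case lne: False
          then have "\<eta> \<le> dist x y" using far[OF K'] far[OF K'(2,1)]
            by (metis dist_commute linorder_neqE_nat)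
          then show ?thesis using lne False yN by (simp add: t'_def)
        qed
      qed
    qed
  qed
qed

section \<open>Cubes cannot be coloured with too few colours\<close>

text \<open>The coordinates from \<open>N\<close> on are frozen at 0 instead of using vectors of
  length \<open>N\<close>, so that cubes of all dimensions live in one metric space.\<close>

definition cube :: "nat \<Rightarrow> (nat \<Rightarrow> real) set" where
  "cube N = {x. \<forall>i. if i < N then 0 \<le> x i \<and> x i \<le> 1 else x i = 0}"

lemma cube_eq_PiE: "cube N = Pi\<^sub>E UNIV (\<lambda>i. if i < N then {0..1} else {0})"
  unfolding cube_def by (auto simp: PiE_def Pi_def split: if_splits)

lemma compact_cube: "compact (cube N)"
  proof -
  have "compactin (product_topology (\<lambda>i::nat. euclidean :: real topology) UNIV) (cube N)"
    unfolding cube_eq_PiE compactin_PiE by auto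
  then show ?thesis by (simp add: euclidean_product_topology)
qed

lemma dist_fun_le:
  fixes x y :: "nat \<Rightarrow> real"
  assumes "\<And>i. \<bar>x i - y i\<bar> \<le> e"
  shows "dist x y \<le> 2 * e"
proof -
  have s: "summable (\<lambda>n. (1/2::real)^n)" by (simp add: summable_geometric)
  have "dist x y = (\<Sum>n. (1/2)^n * min (dist (x (from_nat n)) (y (from_nat n))) 1)"
    by (simp add: dist_fun_def)
  also have "\<dots> \<le> (\<Sum>n. (1/2)^n * e)"
  proof (rule suminf_le)
    fix n show "(1/2)^n * min (dist (x (from_nat n)) (y (from_nat n))) 1 \<le> (1/2)^n * e"
      using assms[of "from_nat n"] by (intro mult_left_mono) (auto simp: dist_real_def)
    show "summable (\<lambda>n. (1/2)^n * min (dist (x (from_nat n)) (y (from_nat n))) 1)"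
      by (rule summable_comparison_test'[OF s, of 0]) (auto simp: mult_le_cancel_left1)
    show "summable (\<lambda>n. (1/2::real)^n * e)" by (intro summable_mult2 s)
  qed
  also have "\<dots> = 2 * e" using suminf_mult2[OF s, of e] suminf_geometric[of "1/2::real"] by simp
  finally show ?thesis .
qed

text \<open>Lebesgue's covering theorem by way of Kuhn's combinatorial lemma. For each colour
  \<open>i\<close>, a grid point gets \<open>i\<close>-th label 0 if it is near a cluster of colour
  \<open>i\<close> that comes close to the face where the \<open>i\<close>-th coordinate is 0.
  Kuhn's lemma yields a cell in which every label takes both values. But if \<open>i\<close> is the
  colour of the base point \<open>z\<close>, all corners see only the cluster of \<open>z\<close>
  among the low clusters of colour \<open>i\<close>, and the \<open>i\<close>-th label is
  constant.\<close>

lemma not_colourable_cube: "\<not> colourable N (cube N)"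
proof
  assume col: "colourable N (cube N)"
  have "\<exists>d>0. \<forall>x\<in>cube N. \<forall>y\<in>cube N. dist x y < d \<longrightarrow> \<bar>x i - y i\<bar> < 1/4" for i
  proof -
    have "uniformly_continuous_on (cube N) (\<lambda>x. x i)"
      by (intro compact_uniformly_continuous compact_cube continuous_on_product_coordinates[THEN continuous_on_subset]) auto
    then obtain d where "d > 0" "\<And>x y. x \<in> cube N \<Longrightarrow> y \<in> cube N \<Longrightarrow> dist y x < d \<Longrightarrow> dist (y i) (x i) < 1/4"
      unfolding uniformly_continuous_on_def by (metis zero_less_divide_1_iff zero_less_numeral)
    then show ?thesis by (auto simp: dist_real_def)
  qed
  then obtain d where d: "\<And>i. d i > 0" "\<And>i x y. x \<in> cube N \<Longrightarrow> y \<in> cube N \<Longrightarrow> dist x y < d i \<Longrightarrow> \<bar>x i - y i\<bar> < 1/4"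
    by metis
  define \<delta> where "\<delta> = Min (insert 1 (d ` {..<N}))"
  have \<delta>: "\<delta> > 0" "\<And>i. i < N \<Longrightarrow> \<delta> \<le> d i" using d(1) by (auto simp: \<delta>_def)
  obtain \<eta> k t where col': "colouring N (cube N) \<delta> \<eta> k t"
    using col \<delta>(1) unfolding colourable_def by blast
  note kt = colouringD[OF col']
  \<comment> \<open>A step of \<open>1 / p\<close> in every coordinate moves a point by at most
    \<open>2 / p < \<eta> / 2\<close> in the metric of the product; \<open>5 \<le> p\<close> makes
    one step smaller than the distance 1/4 used to keep away from the faces.\<close>
  obtain p :: nat where p: "p > 0" "5 \<le> p" "4 / p < \<eta>"
  proof -
    obtain p :: nat where "real p > max 5 (4/\<eta>)" using reals_Archimedean2 by blast
    then show ?thesis using kt(1) that[of p] by (auto simp: field_simps)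
  qed
  define pt where "pt = (\<lambda>(x::nat\<Rightarrow>nat) i. if i < N then real (x i) / p else 0)"
  have pt_cube: "pt x \<in> cube N" if "\<forall>i<N. x i \<le> p" for x
    using that p(1) by (auto simp: cube_def pt_def)
  define low where "low = (\<lambda>i u. \<exists>v\<in>cube N. k v = i \<and> k u = i \<and> t v = t u \<and> v i < 1/4)"
  \<comment> \<open>The first two cases are the boundary conditions of Kuhn's lemma. Clusters vary
    by less than 1/4 in each coordinate, so near the base point of the cell these cases will not
    occur with the wrong label.\<close>
  define label where "label = (\<lambda>x i. if x i = 0 then 0 else if x i = p then 1 else
      if (\<exists>u\<in>cube N. low i u \<and> dist (pt x) u < \<eta>/2) then 0 else (1::nat))"
  obtain q where q: "\<forall>i<N. q i < p"
     and q2: "\<forall>i<N. \<exists>r s. (\<forall>j<N. q j \<le> r j \<and> r j \<le> q j + 1) \<and> (\<forall>j<N. q j \<le> s j \<and> s j \<le> q j + 1) \<and> label r i \<noteq> label s i"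
  proof (rule kuhn_lemma[OF p(1), of N label])
    show "\<forall>x. (\<forall>i<N. x i \<le> p) \<longrightarrow> (\<forall>i<N. label x i = 0 \<or> label x i = 1)" by (simp add: label_def)
    show "\<forall>x. (\<forall>i<N. x i \<le> p) \<longrightarrow> (\<forall>i<N. x i = 0 \<longrightarrow> label x i = 0)" by (simp add: label_def)
    show "\<forall>x. (\<forall>i<N. x i \<le> p) \<longrightarrow> (\<forall>i<N. x i = p \<longrightarrow> label x i = 1)" using p(1) by (simp add: label_def)
  qed (rule that)
  define z where "z = pt q"
  have z: "z \<in> cube N" unfolding z_def using q by (intro pt_cube) auto
  define i where "i = k z"
  have i: "i < N" using kt(2) z i_def by auto
  have lab: "label r i = (if low i z then 0 else 1)" if r: "\<forall>j<N. q j \<le> r j \<and> r j \<le> q j + 1" for r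
  proof -
    have rc: "pt r \<in> cube N" using r q by (intro pt_cube) force
    have cl: "\<bar>pt r j - z j\<bar> \<le> 1 / p" for j
    proof (cases "j < N")
      case True
      have "real (r j) - real (q j) \<le> 1" "real (q j) \<le> real (r j)" using r True by force+
      then show ?thesis using True p(1) by (simp add: pt_def z_def flip: diff_divide_distrib) (simp add: divide_right_mono)
    qed (simp add: pt_def z_def)
    have dz: "dist (pt r) z < \<eta> / 2" using dist_fun_le[of "pt r" z, OF cl] p by simp
    have pti: "pt r i = real (r i) / p" using i by (simp add: pt_def)
    have p5: "1 / real p \<le> 1/5" using p by (simp add: field_simps)
    show ?thesis
    proof (cases "low i z")
      case True
      then obtain v where v: "v \<in> cube N" "k v = k z" "t v = t z" "v i < 1/4" unfolding low_def i_def by auto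
      have "dist z v < d i" using kt(3)[OF z v(1)] v \<delta>(2)[OF i] by simp
      then have "z i < 1/2" using d(2)[OF z v(1), of i] v by linarith
      then have "pt r i < 1" using cl[of i] p5 by linarith
      then have "r i \<noteq> p" using pti p(1) by auto
      moreover have "\<exists>u\<in>cube N. low i u \<and> dist (pt r) u < \<eta>/2" using True z dz by blast
      ultimately show ?thesis using True by (simp add: label_def)
    next
      case False
      have "1/4 \<le> z i" using False z unfolding low_def i_def by force
      then have "pt r i > 0" using cl[of i] p5 by linarith
      then have "r i \<noteq> 0" using pti by (intro notI) simp
      moreover have "\<not> (\<exists>u\<in>cube N. low i u \<and> dist (pt r) u < \<eta>/2)"
      proof
        assume "\<exists>u\<in>cube N. low i u \<and> dist (pt r) u < \<eta>/2"
        then obtain u where u: "u \<in> cube N" "low i u" "dist (pt r) u < \<eta>/2" by blast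
        have "dist z u < \<eta>" using dist_triangle3[of z u "pt r"] u(3) dz by linarith
        moreover have ku: "k z = k u" using u(2) unfolding low_def i_def by auto
        ultimately have "t z = t u" using kt(4)[OF z u(1)] by force
        then show False using u(2) False ku unfolding low_def i_def by auto
      qed
      ultimately show ?thesis using False by (auto simp: label_def)
    qed
  qed
  show False using q2 i lab by metis
qed

lemma cube_dim_le_imp_le:
  assumes "top_of_set (cube N) dim_le n"
  shows "int N \<le> n"
proof (rule ccontr)
  assume "\<not> int N \<le> n"
  then have "top_of_set (cube N) dim_le (int N - 1)"
    using dimension_le_mono[OF assms, of "int N - 1"] by simp
  then show False using colourable_if_dim_le compact_cube not_colourable_cube by blast
qed

lemma no_cube_embedding:
  fixes e :: "(nat \<Rightarrow> real) \<Rightarrow> 'x::t2_space"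
  assumes "(euclidean :: 'x topology) dim_le n" "continuous_on (cube N) e" "inj_on e (cube N)"
  shows "int N \<le> n"
proof -
  obtain g where g: "homeomorphism (cube N) (e ` cube N) e g"
    using homeomorphism_compact[OF compact_cube assms(2) refl assms(3)] by blast
  have "top_of_set (e ` cube N) dim_le n" using dimension_le_subtopology[OF assms(1)] .
  moreover have "top_of_set (e ` cube N) homeomorphic_space top_of_set (cube N)"
    using g unfolding homeomorphism_def homeomorphic_space_def homeomorphic_maps_def
    by (intro exI[of _ g] exI[of _ e]) (auto simp: continuous_map_subtopology_eu)
  ultimately show ?thesis using homeomorphic_space_dimension_le cube_dim_le_imp_le by blast
qed

section \<open>Heights on abelian groups of finite rank\<close>

primrec nmul :: "nat \<Rightarrow> 'a::ab_group_add \<Rightarrow> 'a" where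
  "nmul 0 a = 0"
| "nmul (Suc n) a = a + nmul n a"

lemma nmul_add: "nmul (m + n) a = nmul m a + nmul n a"
  by (induction m) (auto simp: add.assoc)

lemma nmul_mult: "nmul (m * n) a = nmul m (nmul n a)"
  by (induction m) (auto simp: nmul_add)

lemma nmul_right_add: "nmul n (a + b) = nmul n a + nmul n b"
  by (induction n) (auto simp: algebra_simps)

lemma nmul_right_diff: "nmul n (a - b) = nmul n a - nmul n b"
  by (induction n) (auto simp: algebra_simps)

definition zmul :: "int \<Rightarrow> 'a::ab_group_add \<Rightarrow> 'a" where
  "zmul k a = nmul (nat k) a - nmul (nat (- k)) a"

lemma zmul_diff: "zmul (int m - int n) a = nmul m a - nmul n a"
proof (cases "n \<le> m")
  case True
  then obtain p where "m = n + p" using le_Suc_ex by blast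
  then show ?thesis by (simp add: zmul_def nmul_add)
next
  case False
  then obtain p where "n = m + p" using le_Suc_ex by (metis nat_le_linear)
  then show ?thesis by (simp add: zmul_def nmul_add)
qed

interpretation zmod: Modules.module "zmul :: int \<Rightarrow> 'a::ab_group_add \<Rightarrow> 'a"
proof
  fix k l :: int and a b :: 'a
  obtain m n where k: "k = int m - int n" by (cases k rule: int_diff_cases)
  obtain p q where l: "l = int p - int q" by (cases l rule: int_diff_cases)
  show "zmul k (a + b) = zmul k a + zmul k b"
    by (simp add: zmul_def nmul_right_add)
  have "k + l = int (m + p) - int (n + q)" by (simp add: k l)
  then have "zmul (k + l) a = nmul (m + p) a - nmul (n + q) a" by (simp only: zmul_diff)
  then show "zmul (k + l) a = zmul k a + zmul l a"
    unfolding k l zmul_diff nmul_add by simp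
  have "k * l = int (m * p + n * q) - int (m * q + n * p)" by (simp add: k l algebra_simps)
  then have kl: "zmul (k * l) a = nmul (m * p + n * q) a - nmul (m * q + n * p) a" by (simp only: zmul_diff)
  show "zmul k (zmul l a) = zmul (k * l) a"
    unfolding kl unfolding k l zmul_diff nmul_add nmul_mult nmul_right_diff by (simp add: algebra_simps)
  show "zmul 1 a = a" by (simp add: zmul_def)
qed

lemma additive_zmul:
  fixes T :: "'a::ab_group_add \<Rightarrow> 'b::ab_group_add"
  assumes "Modules.additive T"
  shows "T (zmul k a) = zmul k (T a)"
proof -
  interpret Modules.additive T by fact
  have "T (nmul n a) = nmul n (T a)" for n by (induction n) (auto simp: add zero)
  then show ?thesis by (simp add: zmul_def diff)
qed

definition torsion_free_type :: "'a::ab_group_add itself \<Rightarrow> bool" where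
  "torsion_free_type TYPE('a) \<longleftrightarrow> (\<forall>k (a::'a). k > 0 \<longrightarrow> zmul k a = 0 \<longrightarrow> a = 0)"

text \<open>Maximality is expressed by multiples: \<open>B\<close> becomes a basis after tensoring
  with the rationals, and its cardinality is the torsion-free rank.\<close>

definition max_independent :: "'a::ab_group_add set \<Rightarrow> bool" where
  "max_independent B \<longleftrightarrow> zmod.independent B \<and> (\<forall>a. \<exists>k>0. zmul k a \<in> zmod.span B)"

lemma max_independent_exists: "\<exists>B::'a::ab_group_add set. max_independent B"
proof -
  have "\<exists>M\<in>{B::'a set. zmod.independent B}. \<forall>X\<in>{B. zmod.independent B}. M \<subseteq> X \<longrightarrow> X = M"
  proof (rule subset_Zorn_nonempty)
    show "{B::'a set. zmod.independent B} \<noteq> {}" using zmod.independent_empty by blast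
    fix C :: "'a set set" assume C: "C \<noteq> {}" "subset.chain {B. zmod.independent B} C"
    have "zmod.independent (\<Union>C)"
    proof
      assume "zmod.dependent (\<Union>C)"
      then obtain t u where t: "finite t" "t \<subseteq> \<Union>C" "(\<Sum>v\<in>t. zmul (u v) v) = 0" "\<exists>v\<in>t. u v \<noteq> 0"
        unfolding zmod.dependent_explicit by blast
      obtain B where "B \<in> C" "t \<subseteq> B"
        using finite_subset_Union_chain[OF t(1,2) C] by blast
      moreover have "zmod.independent B" using C(2) \<open>B \<in> C\<close> by (auto simp: subset.chain_def)
      ultimately show False using t unfolding zmod.dependent_explicit by blast
    qed
    then show "\<Union>C \<in> {B. zmod.independent B}" by simp
  qed
  then obtain M :: "'a set" where M: "zmod.independent M" "\<And>X. zmod.independent X \<Longrightarrow> M \<subseteq> X \<Longrightarrow> X = M" by blast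
  have "\<exists>k>0. zmul k a \<in> zmod.span M" for a
  proof (cases "a \<in> M")
    case True
    then show ?thesis using zmod.span_base[of a M] by (intro exI[of _ 1]) simp
  next
    case False
    then have "zmod.dependent (insert a M)" using M(2) by blast
    then obtain t u where t: "finite t" "t \<subseteq> insert a M" "(\<Sum>v\<in>t. zmul (u v) v) = 0" "\<exists>v\<in>t. u v \<noteq> 0"
      unfolding zmod.dependent_explicit by blast
    have at: "a \<in> t \<and> u a \<noteq> 0"
    proof (rule ccontr)
      assume na: "\<not> (a \<in> t \<and> u a \<noteq> 0)"
      have "(\<Sum>v\<in>t - {a}. zmul (u v) v) = 0" using t(1,3) na by (cases "a \<in> t") (auto simp: sum_diff1)
      moreover have "\<exists>v\<in>t - {a}. u v \<noteq> 0" using t(4) na by blast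
      ultimately show False using M(1) t(1,2) unfolding zmod.dependent_explicit by blast
    qed
    then have "zmul (u a) a = - (\<Sum>v\<in>t - {a}. zmul (u v) v)"
      using t(1,3) by (simp add: sum_diff1 eq_neg_iff_add_eq_0)
    moreover have "(\<Sum>v\<in>t - {a}. zmul (u v) v) \<in> zmod.span M"
      using t(2) by (intro zmod.span_sum zmod.span_scale zmod.span_base) auto
    ultimately have 1: "zmul (u a) a \<in> zmod.span M" using zmod.span_neg by simp
    then have "zmul (- u a) a \<in> zmod.span M" using zmod.span_neg by simp
    then show ?thesis using 1 at by (cases "u a > 0") (auto intro: exI[of _ "u a"] exI[of _ "- u a"])
  qed
  then show ?thesis using M(1) unfolding max_independent_def by blast
qed

text \<open>Real values can be divided by integers, so a map extends from the span to all elements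
  with a multiple in the span. Composed with \<open>cis\<close>, such maps yield homomorphisms from
  the dual group to the circle.\<close>

lemma max_independent_additive_extension:
  fixes f :: "'a::ab_group_add \<Rightarrow> real"
  assumes B: "max_independent B"
  shows "\<exists>F. Modules.additive F \<and> (\<forall>b\<in>B. F b = f b)"
proof -
  have ind: "zmod.independent B" using B by (simp add: max_independent_def)
  obtain n where n: "\<And>a. n a > 0" "\<And>a. zmul (n a) a \<in> zmod.span B" using B unfolding max_independent_def by metis
  define rep where "rep = zmod.representation B"
  define l where "l = (\<lambda>v. \<Sum>b\<in>{b. rep v b \<noteq> 0}. of_int (rep v b) * f b)"
  have l_eq: "l v = (\<Sum>b\<in>S. of_int (rep v b) * f b)" if "finite S" "{b. rep v b \<noteq> 0} \<subseteq> S" for v S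
    unfolding l_def using that by (intro sum.mono_neutral_left) auto
  have fin: "finite {b. rep v b \<noteq> 0}" for v unfolding rep_def by (rule zmod.finite_representation)
  have l_add: "l (v + w) = l v + l w" if "v \<in> zmod.span B" "w \<in> zmod.span B" for v w
  proof -
    define S where "S = {b. rep v b \<noteq> 0} \<union> {b. rep w b \<noteq> 0} \<union> {b. rep (v + w) b \<noteq> 0}"
    have "finite S" using fin by (simp add: S_def)
    then have "l v = (\<Sum>b\<in>S. of_int (rep v b) * f b)" "l w = (\<Sum>b\<in>S. of_int (rep w b) * f b)"
      "l (v + w) = (\<Sum>b\<in>S. of_int (rep (v + w) b) * f b)"
      by (auto intro!: l_eq simp: S_def)
    moreover have "rep (v + w) b = rep v b + rep w b" for b
      using zmod.representation_add[OF ind that(2,1)] by (simp add: rep_def add.commute)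
    ultimately show ?thesis by (simp add: algebra_simps sum.distrib)
  qed
  have l_scale: "l (zmul k v) = of_int k * l v" if "v \<in> zmod.span B" for v k
  proof -
    define S where "S = {b. rep v b \<noteq> 0} \<union> {b. rep (zmul k v) b \<noteq> 0}"
    have "finite S" using fin by (simp add: S_def)
    then have "l v = (\<Sum>b\<in>S. of_int (rep v b) * f b)" "l (zmul k v) = (\<Sum>b\<in>S. of_int (rep (zmul k v) b) * f b)"
      by (auto intro!: l_eq simp: S_def)
    moreover have "rep (zmul k v) b = k * rep v b" for b
      using zmod.representation_scale[OF ind that] by (simp add: rep_def)
    ultimately show ?thesis by (simp add: sum_distrib_left algebra_simps)
  qed
  define F where "F = (\<lambda>a. l (zmul (n a) a) / of_int (n a))"
  have F_eq: "F a = l (zmul k a) / of_int k" if "k > 0" "zmul k a \<in> zmod.span B" for a k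
  proof -
    have "of_int k * l (zmul (n a) a) = l (zmul (k * n a) a)" using l_scale[OF n(2), of k a] by simp
    also have "\<dots> = of_int (n a) * l (zmul k a)" using l_scale[OF that(2), of "n a"] by (simp add: mult.commute)
    finally show ?thesis using that n(1)[of a] by (simp add: F_def field_simps)
  qed
  have "F (a + b) = F a + F b" for a b
  proof -
    define k where "k = n a * n b"
    have k: "k > 0" using n by (simp add: k_def)
    have sa: "zmul k a \<in> zmod.span B" using zmod.span_scale[OF n(2), of "n b" a] by (simp add: k_def mult.commute)
    have sb: "zmul k b \<in> zmod.span B" using zmod.span_scale[OF n(2), of "n a" b] by (simp add: k_def)
    have "zmul k (a + b) \<in> zmod.span B" using zmod.span_add[OF sa sb] by (simp add: zmod.scale_right_distrib)
    then show ?thesis using F_eq[OF k] sa sb l_add[OF sa sb]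
      by (simp add: zmod.scale_right_distrib add_divide_distrib)
  qed
  moreover have "F b = f b" if "b \<in> B" for b
  proof -
    have "b \<in> zmod.span B" using that by (rule zmod.span_base)
    then have "F b = l b" using F_eq[of 1 b] by simp
    also have "rep b = (\<lambda>v. if v = b then 1 else 0)" unfolding rep_def by (rule zmod.representation_basis[OF ind that])
    then have "l b = f b" by (simp add: l_eq[of "{b}"] )
    finally show ?thesis .
  qed
  ultimately show ?thesis by (intro exI[of _ F]) (simp add: additive.intro)
qed

text \<open>\<open>height_le B n r a\<close> says that \<open>a\<close> is a combination of \<open>B\<close> with coefficients of denominator \<open>n\<close> and size
  at most \<open>r / n\<close>.\<close>

definition height_le :: "'a::ab_group_add set \<Rightarrow> int \<Rightarrow> int \<Rightarrow> 'a \<Rightarrow> bool" where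
  "height_le B n r a \<longleftrightarrow> (\<exists>u. zmul n a = (\<Sum>b\<in>B. zmul (u b) b) \<and> (\<forall>b\<in>B. \<bar>u b\<bar> \<le> r))"

lemma height_le_mono: "height_le B n r a \<Longrightarrow> r \<le> r' \<Longrightarrow> height_le B n r' a"
  unfolding height_le_def by (meson order.trans)

lemma height_le_0: "height_le B n 0 0"
  unfolding height_le_def by (intro exI[of _ "\<lambda>_. 0"]) simp

lemma height_le_add:
  assumes "height_le B n r a" "height_le B n r' a'"
  shows "height_le B n (r + r') (a + a')"
proof -
  obtain u u' where u: "zmul n a = (\<Sum>b\<in>B. zmul (u b) b)" "\<forall>b\<in>B. \<bar>u b\<bar> \<le> r"
     and u': "zmul n a' = (\<Sum>b\<in>B. zmul (u' b) b)" "\<forall>b\<in>B. \<bar>u' b\<bar> \<le> r'"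
    using assms(1) assms(2)[unfolded height_le_def] unfolding height_le_def by (elim exE conjE)
  have "\<bar>u b + u' b\<bar> \<le> r + r'" if "b \<in> B" for b using u(2) u'(2) that abs_triangle_ineq[of "u b" "u' b"] by fastforce
  then show ?thesis unfolding height_le_def
    by (intro exI[of _ "\<lambda>b. u b + u' b"]) (simp add: zmod.scale_right_distrib zmod.scale_left_distrib sum.distrib u u')
qed

lemma height_le_minus: "height_le B n r a \<Longrightarrow> height_le B n r (- a)"
  unfolding height_le_def
proof (elim exE conjE)
  fix u assume "zmul n a = (\<Sum>b\<in>B. zmul (u b) b)" "\<forall>b\<in>B. \<bar>u b\<bar> \<le> r"
  then show "\<exists>u. zmul n (- a) = (\<Sum>b\<in>B. zmul (u b) b) \<and> (\<forall>b\<in>B. \<bar>u b\<bar> \<le> r)"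
    by (intro exI[of _ "\<lambda>b. - u b"]) (simp add: sum_negf)
qed

lemma height_le_scale:
  assumes "height_le B n r a" "c \<ge> 0"
  shows "height_le B (n * c) (r * c) a"
proof -
  obtain u where u: "zmul n a = (\<Sum>b\<in>B. zmul (u b) b)" "\<forall>b\<in>B. \<bar>u b\<bar> \<le> r"
    using assms unfolding height_le_def by blast
  have "zmul (n * c) a = zmul c (zmul n a)" by (simp add: mult.commute)
  also have "\<dots> = (\<Sum>b\<in>B. zmul (u b * c) b)" by (simp add: u zmod.scale_sum_right mult.commute)
  finally show ?thesis unfolding height_le_def using u(2) assms(2)
    by (intro exI[of _ "\<lambda>b. u b * c"]) (auto simp: abs_mult intro: mult_right_mono)
qed

text \<open>Multiplication by \<open>n\<close> is injective without torsion, so an element is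
  determined by its numerators, and the denominator does not enter the count.\<close>

lemma card_height_le:
  assumes B: "finite B" and tf: "torsion_free_type TYPE('a::ab_group_add)" and n: "n > 0" and r: "r \<ge> 0"
  shows "finite {a::'a. height_le B n r a}" "card {a::'a. height_le B n r a} \<le> nat (2 * r + 1) ^ card B"
proof -
  let ?S = "{a. height_le B n r a}"
  define P where "P = (\<lambda>a u. zmul n a = (\<Sum>b\<in>B. zmul (u b) b) \<and> (\<forall>b\<in>B. \<bar>u b\<bar> \<le> r))"
  define u where "u = (\<lambda>a. SOME u. P a u)"
  have "P a (u a)" if "a \<in> ?S" for a
    unfolding u_def by (rule someI_ex[of "P a"]) (use that in \<open>simp add: height_le_def P_def\<close>)
  then have u: "zmul n a = (\<Sum>b\<in>B. zmul (u a b) b) \<and> (\<forall>b\<in>B. \<bar>u a b\<bar> \<le> r)" if "a \<in> ?S" for a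
    using that unfolding P_def by blast
  define f where "f = (\<lambda>a. restrict (u a) B)"
  have "inj_on f ?S"
  proof (rule inj_onI)
    fix a a' assume a: "a \<in> ?S" "a' \<in> ?S" "f a = f a'"
    then have "u a b = u a' b" if "b \<in> B" for b using that unfolding f_def by (metis restrict_apply')
    then have "zmul n a = zmul n a'" using u a by simp
    then have "zmul n (a - a') = 0" by (simp add: zmod.scale_right_diff_distrib)
    then show "a = a'" using tf n unfolding torsion_free_type_def by (metis right_minus_eq)
  qed
  note inj = this
  have sub: "f ` ?S \<subseteq> PiE B (\<lambda>_. {-r..r})"
  proof
    fix y assume "y \<in> f ` ?S"
    then obtain a where a: "a \<in> ?S" "y = f a" by blast
    then have "\<bar>u a b\<bar> \<le> r" if "b \<in> B" for b using u that by blast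
    then show "y \<in> PiE B (\<lambda>_. {-r..r})" using a(2) by (force simp: f_def abs_le_iff)
  qed
  have fin: "finite (PiE B (\<lambda>_. {-r..r}))" using B by (intro finite_PiE) auto
  show "finite ?S" by (rule inj_on_finite[OF inj sub fin])
  have "card ?S \<le> card (PiE B (\<lambda>_. {-r..r}))" by (rule card_inj_on_le[OF inj sub fin])
  then show "card ?S \<le> nat (2 * r + 1) ^ card B"
    using B by (simp add: card_PiE algebra_simps)
qed

lemma height_le_exists:
  assumes B: "finite B" and mi: "max_independent B"
  shows "\<exists>n>0. \<exists>r\<ge>1. height_le B n r a"
proof -
  obtain n where n: "n > 0" "zmul n a \<in> zmod.span B" using mi unfolding max_independent_def by blast
  then obtain u where u: "zmul n a = (\<Sum>b\<in>B. zmul (u b) b)" using zmod.span_finite[OF B] by auto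
  have "\<bar>u b\<bar> \<le> Max (insert 1 ((\<lambda>b. \<bar>u b\<bar>) ` B))" if "b \<in> B" for b using B that by (intro Max_ge) auto
  moreover have "1 \<le> Max (insert 1 ((\<lambda>b. \<bar>u b\<bar>) ` B))" using B by (intro Max_ge) auto
  ultimately show ?thesis using n(1) u unfolding height_le_def by blast
qed

lemma height_le_exists_uniform:
  assumes B: "finite B" and mi: "max_independent B" and H: "finite H"
  shows "\<exists>n>0. \<exists>r\<ge>1. \<forall>a\<in>H. height_le B n r a"
  using H
proof (induction H rule: finite_induct)
  case empty
  then show ?case by (auto intro: exI[of _ 1])
next
  case (insert a H)
  then obtain n r where n: "n > 0" "r \<ge> 1" "\<forall>a\<in>H. height_le B n r a" by blast
  obtain n' r' where n': "n' > 0" "r' \<ge> 1" "height_le B n' r' a" using height_le_exists[OF B mi] by blast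
  define R where "R = r * n' + r' * n"
  have R: "1 \<le> r * n'" "0 \<le> r' * n" using n n' mult_mono[of 1 r 1 n'] by auto
  have "height_le B (n * n') R b" if "b \<in> insert a H" for b
  proof (cases "b = a")
    case True
    then have "height_le B (n' * n) (r' * n) b" using height_le_scale[OF n'(3), of n] n by simp
    then show ?thesis using R by (auto simp: R_def mult.commute intro: height_le_mono)
  next
    case False
    then have "height_le B (n * n') (r * n') b" using height_le_scale[of B n r b n'] n n' that by simp
    then show ?thesis using R by (auto simp: R_def intro: height_le_mono)
  qed
  moreover have "n * n' > 0" "R \<ge> 1" unfolding R_def using R n n' by (simp, linarith)
  ultimately show ?case by blast
qed

text \<open>\<open>B\<close> spans only up to multiples, so \<open>T\<close> may enlarge
  denominators. The factor \<open>D\<close> for them is recorded apart from the factor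
  \<open>C\<close> for the numerators because only numerators are counted in the end.\<close>

definition height_growth :: "'a::ab_group_add set \<Rightarrow> int \<Rightarrow> int \<Rightarrow> ('a \<Rightarrow> 'a) \<Rightarrow> bool" where
  "height_growth B D C T \<longleftrightarrow> (\<forall>n r a. n > 0 \<longrightarrow> r \<ge> 0 \<longrightarrow> height_le B n r a \<longrightarrow> height_le B (n * D) (r * C) (T a))"

lemma height_growth_mono: "height_growth B D C T \<Longrightarrow> C \<le> C' \<Longrightarrow> height_growth B D C' T"
  unfolding height_growth_def by (meson height_le_mono mult_left_mono)

lemma height_growth_scale: "height_growth B D C T \<Longrightarrow> c \<ge> 0 \<Longrightarrow> height_growth B (D * c) (C * c) T"
  unfolding height_growth_def by (metis height_le_scale mult.assoc)

lemma height_growth_id: "height_growth B 1 1 id"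
  by (simp add: height_growth_def)

lemma height_growth_comp:
  assumes "height_growth B D C T" "height_growth B D' C' T'" "D' > 0" "C' \<ge> 0"
  shows "height_growth B (D * D') (C * C') (T \<circ> T')"
  unfolding height_growth_def
proof (intro allI impI)
  fix n r :: int and a assume n: "n > 0" "r \<ge> 0" "height_le B n r a"
  then have "height_le B (n * D') (r * C') (T' a)" using assms unfolding height_growth_def by blast
  then have "height_le B (n * D' * D) (r * C' * C) (T (T' a))"
    using assms n unfolding height_growth_def by (meson mult_nonneg_nonneg mult_pos_pos)
  then show "height_le B (n * (D * D')) (r * (C * C')) ((T \<circ> T') a)" by (simp add: mult_ac)
qed

lemma height_growth_minus_id:
  assumes "height_growth B D C T" "D > 0" "D \<le> C"
  shows "height_growth B D (2 * C) (\<lambda>a. T a - a)"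
  unfolding height_growth_def
proof (intro allI impI)
  fix n r :: int and a assume n: "n > 0" "r \<ge> 0" "height_le B n r a"
  then have 1: "height_le B (n * D) (r * C) (T a)" using assms unfolding height_growth_def by blast
  have "height_le B (n * D) (r * D) a" by (rule height_le_scale) (use n assms in auto)
  moreover have "r * D \<le> r * C" using assms n by (intro mult_left_mono) auto
  ultimately have "height_le B (n * D) (r * C) (- a)"
    using height_le_minus height_le_mono by blast
  then show "height_le B (n * D) (r * (2 * C)) (T a - a)"
    using height_le_add[OF 1, of "r * C" "- a"] by (simp add: mult_ac)
qed

lemma height_growth_exists:
  assumes B: "finite B" and mi: "max_independent B" and T: "Modules.additive T"
  shows "\<exists>D>0. \<exists>C\<ge>D. height_growth B D C T"
proof -
  interpret T: Modules.additive T by fact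
  obtain D r where D: "D > 0" "r \<ge> 1" "\<forall>a\<in>T ` B. height_le B D r a"
    using height_le_exists_uniform[OF B mi, of "T ` B"] B by blast
  then have "\<forall>b\<in>B. \<exists>v. zmul D (T b) = (\<Sum>c\<in>B. zmul (v c) c) \<and> (\<forall>c\<in>B. \<bar>v c\<bar> \<le> r)"
    unfolding height_le_def by simp
  then obtain v where v: "\<And>b. b \<in> B \<Longrightarrow> zmul D (T b) = (\<Sum>c\<in>B. zmul (v b c) c)" "\<And>b c. b \<in> B \<Longrightarrow> c \<in> B \<Longrightarrow> \<bar>v b c\<bar> \<le> r"
    by metis
  have "height_growth B D (int (card B) * r) T"
    unfolding height_growth_def
  proof (intro allI impI)
    fix n s :: int and a assume n: "n > 0" "s \<ge> 0" "height_le B n s a"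
    then obtain u where u: "zmul n a = (\<Sum>b\<in>B. zmul (u b) b)" "\<forall>b\<in>B. \<bar>u b\<bar> \<le> s" unfolding height_le_def by blast
    have "zmul (n * D) (T a) = zmul D (T (zmul n a))" by (simp add: additive_zmul[OF T] mult.commute)
    also have "\<dots> = (\<Sum>b\<in>B. zmul (u b) (zmul D (T b)))"
      by (simp add: u T.sum additive_zmul[OF T] zmod.scale_sum_right mult.commute)
    also have "\<dots> = (\<Sum>b\<in>B. \<Sum>c\<in>B. zmul (u b * v b c) c)"
      using v(1) by (simp add: zmod.scale_sum_right)
    also have "\<dots> = (\<Sum>c\<in>B. zmul (\<Sum>b\<in>B. u b * v b c) c)"
      by (subst sum.swap) (simp add: zmod.scale_sum_left)
    finally have 1: "zmul (n * D) (T a) = (\<Sum>c\<in>B. zmul (\<Sum>b\<in>B. u b * v b c) c)" .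
    have "\<bar>\<Sum>b\<in>B. u b * v b c\<bar> \<le> s * (int (card B) * r)" if "c \<in> B" for c
    proof -
      have "\<bar>\<Sum>b\<in>B. u b * v b c\<bar> \<le> (\<Sum>b\<in>B. s * r)"
        using u(2) v(2) that n by (intro order.trans[OF sum_abs] sum_mono) (auto simp: abs_mult intro!: mult_mono)
      then show ?thesis by (simp add: mult_ac)
    qed
    then show "height_le B (n * D) (s * (int (card B) * r)) (T a)" using 1 unfolding height_le_def
      by (intro exI[of _ "\<lambda>c. \<Sum>b\<in>B. u b * v b c"]) simp
  qed
  then have "height_growth B D (max D (int (card B) * r)) T" by (rule height_growth_mono) simp
  then show ?thesis using D(1) by (meson max.cobounded1)
qed

section \<open>Counting cosets by heights\<close>

text \<open>Extraction of k-th roots removes the factor linear in \<open>k\<close>. In the proof, a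
  larger \<open>M\<close> would make \<open>z\<close>, the \<open>d\<close>-th root of
  \<open>q ^ d / M\<close>, smaller than 1, and \<open>k * z ^ k\<close> tends to 0.\<close>

lemma power_le_poly_imp_le:
  fixes M q c :: real
  assumes le: "\<And>k::nat. M ^ k \<le> ((c * k + 1) * q ^ k) ^ d" and M: "M \<ge> 0" and q: "q > 0" and c: "c \<ge> 0"
  shows "M \<le> q ^ d"
proof (rule ccontr)
  assume "\<not> M \<le> q ^ d"
  then have gt: "M > q ^ d" by simp
  define y where "y = q ^ d / M"
  have M0: "M > 0" using gt q by (meson less_trans zero_less_power)
  have y: "0 < y" "y < 1" using gt q M0 by (auto simp: y_def)
  have d0: "d > 0"
  proof (rule ccontr)
    assume "\<not> d > 0"
    then have "M \<le> 1" using le[of 1] by simp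
    then show False using gt \<open>\<not> d > 0\<close> by simp
  qed
  define z where "z = root d y"
  have z: "0 < z" "z < 1" "z ^ d = y" using y d0 by (auto simp: z_def)
  have "1 \<le> (c * (real k * z ^ k) + z ^ k) ^ d" for k
  proof -
    have "M ^ k * 1 \<le> M ^ k * ((c * k + 1) ^ d * y ^ k)"
      using le[of k] M0 by (simp add: y_def power_mult_distrib power_divide power_mult[symmetric] mult.commute)
    then have "1 \<le> (c * k + 1) ^ d * y ^ k" using M0 by (simp only: mult_le_cancel_left_pos zero_less_power)
    also have "y ^ k = (z ^ k) ^ d" unfolding z(3)[symmetric] by (simp add: mult.commute flip: power_mult)
    finally show ?thesis by (simp add: power_mult_distrib[symmetric] algebra_simps)
  qed
  moreover have "(\<lambda>k. (c * (real k * z ^ k) + z ^ k) ^ d) \<longlonglongrightarrow> (c * 0 + 0) ^ d"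
    using powser_times_n_limit_0[of z] z by (intro tendsto_intros LIMSEQ_power_zero) auto
  ultimately have "1 \<le> (c * 0 + 0) ^ d" by (intro LIMSEQ_le_const) auto
  then show False using d0 by (simp add: power_0_left)
qed

text \<open>Representatives for the range of \<open>\<phi>\<close> give \<open>card H ^ k\<close> representatives for that of \<open>\<phi> ^^ k\<close>. Their heights
  have order \<open>C ^ k\<close> up to a factor linear in \<open>k\<close>, so that the crude count of elements of bounded height
  becomes sharp as \<open>k\<close> tends to infinity.\<close>

lemma card_cosets_le:
  fixes \<phi> :: "'a::ab_group_add \<Rightarrow> 'a"
  assumes B: "finite B" and mi: "max_independent B" and tf: "torsion_free_type TYPE('a)"
    and \<phi>: "Modules.additive \<phi>" "inj \<phi>" and gr: "height_growth B D C \<phi>" and DC: "D > 0" "D \<le> C"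
    and H: "finite H" "\<And>a b. a \<in> H \<Longrightarrow> b \<in> H \<Longrightarrow> a - b \<in> range \<phi> \<Longrightarrow> a = b"
  shows "card H \<le> nat (C ^ card B)"
proof -
  interpret \<phi>: Modules.additive \<phi> by fact
  obtain n r where n: "n > 0" "r \<ge> 1" "\<forall>a\<in>H. height_le B n r a"
    using height_le_exists_uniform[OF B mi H(1)] by blast
  \<comment> \<open>Horner evaluation of a list as a string of digits in base
    \<open>\<phi>\<close>.\<close>
  define ev where "ev = (\<lambda>xs. foldr (\<lambda>x y. x + \<phi> y) xs 0)"
  have ev: "ev [] = 0" "ev (x # xs) = x + \<phi> (ev xs)" for x xs by (auto simp: ev_def)
  have bd: "height_le B (n * D ^ length xs) (int (length xs) * r * C ^ length xs) (ev xs)" if "set xs \<subseteq> H" for xs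
    using that
  proof (induction xs)
    case Nil
    then show ?case using height_le_0 by (simp add: ev)
  next
    case (Cons x xs)
    let ?k = "length xs"
    have "height_le B (n * D ^ Suc ?k) (r * D ^ Suc ?k) x"
      using n Cons.prems DC by (intro height_le_scale) auto
    then have 1: "height_le B (n * D ^ Suc ?k) (r * C ^ Suc ?k) x"
      using n DC by (elim height_le_mono) (intro mult_left_mono power_mono; simp)
    have "height_le B (n * D ^ ?k * D) (int ?k * r * C ^ ?k * C) (\<phi> (ev xs))"
      using gr Cons n DC unfolding height_growth_def by simp
    then have "height_le B (n * D ^ Suc ?k) (int ?k * r * C ^ Suc ?k) (\<phi> (ev xs))" by (simp add: mult_ac)
    from height_le_add[OF 1 this] show ?case by (simp add: ev algebra_simps)
  qed
  \<comment> \<open>Digits are recovered one by one: the first is determined modulo the range of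
    \<open>\<phi>\<close>, and injectivity of \<open>\<phi>\<close> strips it off.\<close>
  have inj: "xs = ys" if "set xs \<subseteq> H" "set ys \<subseteq> H" "length xs = length ys" "ev xs = ev ys" for xs ys
    using that
  proof (induction xs arbitrary: ys)
    case (Cons x xs)
    then obtain y ys' where ys: "ys = y # ys'" by (cases ys) auto
    have eq: "x - y = \<phi> (ev ys' - ev xs)" using Cons.prems(4) by (simp add: ys ev \<phi>.diff algebra_simps)
    then have xy: "x = y" using H(2)[of x y] Cons.prems by (auto simp: ys)
    then have "\<phi> (ev xs) = \<phi> (ev ys')" using eq by (simp add: \<phi>.diff)
    then have "ev xs = ev ys'" using \<phi>(2) by (simp add: inj_eq)
    then show ?case using Cons ys xy by simp
  qed simp
  have main: "real (card H) ^ k \<le> ((real_of_int (2 * r) * k + 1) * real_of_int C ^ k) ^ card B" for k :: nat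
  proof -
    let ?L = "{xs. set xs \<subseteq> H \<and> length xs = k}"
    let ?R = "int k * r * C ^ k"
    have C1: "C ^ k \<ge> 1" using DC by simp
    have R0: "?R \<ge> 0" using n DC by simp
    have "card H ^ k = card ?L" using H(1) by (simp add: card_lists_length_eq)
    also have "\<dots> = card (ev ` ?L)" by (intro card_image[symmetric] inj_onI inj) auto
    also have "\<dots> \<le> card {a. height_le B (n * D ^ k) ?R a}"
      by (intro card_mono card_height_le[OF B tf]) (use bd n DC R0 in auto)
    also have "\<dots> \<le> nat (2 * ?R + 1) ^ card B"
      using n DC R0 by (intro card_height_le[OF B tf]) auto
    also have "\<dots> \<le> nat ((2 * r * int k + 1) * C ^ k) ^ card B"
      using C1 by (intro power_mono nat_mono) (auto simp: algebra_simps)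
    finally have "real (card H ^ k) \<le> real (nat ((2 * r * int k + 1) * C ^ k) ^ card B)" by linarith
    moreover have "(2 * r * int k + 1) * C ^ k \<ge> 0" using n DC by simp
    ultimately show ?thesis by simp
  qed
  have "real (card H) \<le> real_of_int C ^ card B"
    using power_le_poly_imp_le[of "real (card H)" "real_of_int (2 * r)" "real_of_int C" "card B", OF main] n DC by simp
  then have "real_of_int (int (card H)) \<le> real_of_int (C ^ card B)" by simp
  then have "int (card H) \<le> C ^ card B" by (simp only: of_int_le_iff)
  then show ?thesis by linarith
qed

section \<open>Subgroups of polycyclic-by-finite groups\<close>

context group
begin

text \<open>One factor of the series in terms of elements: \<open>N\<close> is normal in
  \<open>K\<close>, and \<open>K / N\<close> is infinite cyclic, generated by the class of
  \<open>t\<close>.\<close>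

definition cyclic_step :: "'a set \<Rightarrow> 'a set \<Rightarrow> 'a \<Rightarrow> bool" where
  "cyclic_step N K t \<longleftrightarrow> subgroup N G \<and> subgroup K G \<and> N \<subseteq> K \<and> t \<in> K \<and>
     (\<forall>k\<in>K. \<forall>n\<in>N. k \<otimes> n \<otimes> inv k \<in> N) \<and>
     (\<forall>g\<in>K. \<exists>k::int. \<exists>n\<in>N. g = n \<otimes> t [^] k) \<and> (\<forall>k::int. t [^] k \<in> N \<longrightarrow> k = 0)"

text \<open>For \<open>g\<close> in \<open>K\<close>, this is the image of \<open>g\<close> under
  the isomorphism of \<open>K / N\<close> with the integers that sends \<open>t\<close> to 1. As a
  relation it needs no proof of well-definedness before it can be used.\<close>

definition has_exponent :: "'a set \<Rightarrow> 'a \<Rightarrow> int \<Rightarrow> 'a \<Rightarrow> bool" where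
  "has_exponent N t k g \<longleftrightarrow> (\<exists>n\<in>N. g = n \<otimes> t [^] k)"

lemma cyclic_step_exists:
  assumes N: "subgroup N G" and K: "subgroup K G" and nor: "N \<lhd> G\<lparr>carrier := K\<rparr>"
    and cyc: "cyclic_group (G\<lparr>carrier := K\<rparr> Mod N)" and inf: "infinite (carrier (G\<lparr>carrier := K\<rparr> Mod N))"
  obtains t where "cyclic_step N K t"
proof -
  let ?H = "G\<lparr>carrier := K\<rparr>" and ?Q = "G\<lparr>carrier := K\<rparr> Mod N"
  interpret n: normal N ?H by fact
  interpret Q: group ?Q by (rule n.factorgroup_is_group)
  have KG: "K \<subseteq> carrier G" using K by (rule subgroup.subset)
  have NK: "N \<subseteq> K" using n.subset by simp
  have coset: "N #>\<^bsub>?H\<^esub> a = N #> a" for a by (simp add: r_coset_def)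
  obtain X where X: "X \<in> carrier ?Q" "subgroup_generated ?Q {X} = ?Q"
    using cyc unfolding cyclic_group_def by blast
  then obtain t where t: "t \<in> K" "X = N #> t" unfolding FactGroup_def RCOSETS_def by (auto simp: coset)
  have pow: "X [^]\<^bsub>?Q\<^esub> (k::int) = N #> (t [^] k)" for k
    using n.FactGroup_int_pow[of t k] t int_pow_consistent[OF K t(1), of k] by (simp add: coset)
  have rng: "carrier ?Q = range (\<lambda>k::int. X [^]\<^bsub>?Q\<^esub> k)"
    using Q.carrier_subgroup_generated_by_singleton[OF X(1)] X(2) by auto
  have tk: "t [^] (k::int) \<in> K" for k using int_pow_consistent[OF K t(1), of k] n.is_group t(1)
    by (metis group.int_pow_closed partial_object.select_convs(1) partial_object.update_convs(1) n.is_group simp_thms group.axioms(1) partial_object.surjective)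
  have "cyclic_step N K t"
    unfolding cyclic_step_def
  proof (intro conjI ballI allI impI)
    fix k n assume "k \<in> K" "n \<in> N"
    then show "k \<otimes> n \<otimes> inv k \<in> N" using n.inv_op_closed2[of k n] m_inv_consistent[OF K] by simp
  next
    fix g assume g: "g \<in> K"
    then have "N #> g \<in> carrier ?Q" unfolding FactGroup_def RCOSETS_def by (auto simp: coset)
    then obtain k :: int where k: "N #> g = N #> (t [^] k)" unfolding rng pow by blast
    have "g \<in> N #> g" using g KG N by (intro rcos_self) auto
    then show "\<exists>k::int. \<exists>n\<in>N. g = n \<otimes> t [^] k" unfolding k by (auto simp: r_coset_def)
  next
    fix k :: int assume k: "t [^] k \<in> N"
    have "X [^]\<^bsub>?Q\<^esub> k = N" unfolding pow using k KG tk N by (intro coset_join2) auto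
    also have "N = \<one>\<^bsub>?Q\<^esub>" by simp
    finally show "k = 0" using Q.finite_cyclic_subgroup_int[OF X(1)] X(2) inf by auto
  qed (use N K NK t in auto)
  then show ?thesis by (rule that)
qed

context
  fixes N K t
  assumes step: "cyclic_step N K t"
begin

lemmas step_subgroups =
  step[unfolded cyclic_step_def, THEN conjunct1]
  step[unfolded cyclic_step_def, THEN conjunct2, THEN conjunct1]
  step[unfolded cyclic_step_def, THEN conjunct2, THEN conjunct2, THEN conjunct1]
  step[unfolded cyclic_step_def, THEN conjunct2, THEN conjunct2, THEN conjunct2, THEN conjunct1]

lemmas step_facts =
  step[unfolded cyclic_step_def, THEN conjunct2, THEN conjunct2, THEN conjunct2, THEN conjunct2, THEN conjunct1]
  step[unfolded cyclic_step_def, THEN conjunct2, THEN conjunct2, THEN conjunct2, THEN conjunct2, THEN conjunct2, THEN conjunct1]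
  step[unfolded cyclic_step_def, THEN conjunct2, THEN conjunct2, THEN conjunct2, THEN conjunct2, THEN conjunct2, THEN conjunct2]

lemma step_carrier: "k \<in> K \<Longrightarrow> k \<in> carrier G" "n \<in> N \<Longrightarrow> n \<in> carrier G" "t \<in> carrier G" "n \<in> N \<Longrightarrow> n \<in> K"
  by (rule subgroup.mem_carrier[OF step_subgroups(2)], assumption)
    (rule subgroup.mem_carrier[OF step_subgroups(1)], assumption,
     rule subgroup.mem_carrier[OF step_subgroups(2) step_subgroups(4)], rule subsetD[OF step_subgroups(3)])

lemma step_pow_mem: "k \<in> K \<Longrightarrow> k [^] (i::int) \<in> K"
  using step_subgroups(2) int_pow_consistent[of K k i] group.int_pow_closed[OF subgroup_imp_group[OF step_subgroups(2)], of k i]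
  by simp

lemma step_conj: "k \<in> K \<Longrightarrow> n \<in> N \<Longrightarrow> k \<otimes> n \<otimes> inv k \<in> N"
  using step_facts(1) by simp

lemma has_exponent_exists: "g \<in> K \<Longrightarrow> \<exists>k. has_exponent N t k g"
  using step_facts(2) unfolding has_exponent_def by simp

lemma has_exponent_0: "n \<in> N \<Longrightarrow> has_exponent N t 0 n"
  unfolding has_exponent_def using step_carrier by (intro bexI[of _ n]) auto

lemma has_exponent_gen: "has_exponent N t k (t [^] k)"
  unfolding has_exponent_def using step_carrier subgroup.one_closed[OF step_subgroups(1)]
  by (intro bexI[of _ \<one>]) auto

lemma has_exponent_carrier: "has_exponent N t k g \<Longrightarrow> g \<in> carrier G"
  unfolding has_exponent_def using step_carrier by auto

lemma has_exponent_mult: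
  assumes "has_exponent N t a g" "has_exponent N t b h"
  shows "has_exponent N t (a + b) (g \<otimes> h)"
proof -
  obtain n m where n: "n \<in> N" "g = n \<otimes> t [^] a" and m: "m \<in> N" "h = m \<otimes> t [^] b"
    using assms unfolding has_exponent_def by blast
  note c = step_carrier(2)[OF n(1)] step_carrier(2)[OF m(1)] step_carrier(3)
  have "g \<otimes> h = n \<otimes> (t [^] a \<otimes> m \<otimes> inv (t [^] a)) \<otimes> t [^] (a + b)"
    using c by (simp add: n m int_pow_mult[symmetric] m_assoc) (simp add: int_pow_mult m_assoc[symmetric])
  moreover have "n \<otimes> (t [^] a \<otimes> m \<otimes> inv (t [^] a)) \<in> N"
    by (rule subgroup.m_closed[OF step_subgroups(1) n(1) step_conj[OF step_pow_mem[OF step_subgroups(4)] m(1)]])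
  ultimately show ?thesis unfolding has_exponent_def by blast
qed

lemma has_exponent_inv:
  assumes "has_exponent N t a g"
  shows "has_exponent N t (- a) (inv g)"
proof -
  obtain n where n: "n \<in> N" "g = n \<otimes> t [^] a" using assms unfolding has_exponent_def by blast
  note c = step_carrier(2)[OF n(1)] step_carrier(3)
  have "inv g = t [^] (- a) \<otimes> inv n" using c by (simp add: n inv_mult_group int_pow_neg)
  moreover have "has_exponent N t (- a) (t [^] (- a))" by (rule has_exponent_gen)
  moreover have "has_exponent N t 0 (inv n)"
    using n(1) step_subgroups(1) by (intro has_exponent_0) (simp add: subgroup.m_inv_closed)
  ultimately show ?thesis using has_exponent_mult by fastforce
qed

lemma has_exponent_pow:
  assumes "has_exponent N t a g"
  shows "has_exponent N t (a * k) (g [^] (k::int))"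
proof -
  have one: "has_exponent N t 0 \<one>" using step_subgroups(1) by (intro has_exponent_0) (rule subgroup.one_closed)
  have nat: "has_exponent N t (a * int m) (g [^] m)" for m :: nat
  proof (induction m)
    case (Suc m)
    have "a * int m + a = a * int (Suc m)" by (simp add: algebra_simps)
    then show ?case using has_exponent_mult[OF Suc assms] by (simp only: nat_pow_Suc)
  qed (use one in simp)
  show ?thesis
  proof (cases k rule: int_cases2)
    case (nonneg m)
    then show ?thesis using nat[of m] by (simp only: int_pow_int)
  next
    case (nonpos m)
    have "g [^] k = inv (g [^] m)" using has_exponent_carrier[OF assms] by (simp only: nonpos int_pow_neg_int)
    moreover have "a * k = - (a * int m)" by (simp add: nonpos)
    ultimately show ?thesis using has_exponent_inv[OF nat[of m]] by (simp only:)
  qed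
qed

lemma has_exponent_in:
  assumes "has_exponent N t a g" "g \<in> N"
  shows "a = 0"
proof -
  obtain n where n: "n \<in> N" "g = n \<otimes> t [^] a" using assms unfolding has_exponent_def by blast
  then have "t [^] a = inv n \<otimes> g" using step_carrier(2)[OF n(1)] step_carrier(3) by (simp add: m_assoc[symmetric])
  also have "\<dots> \<in> N" using n assms step_subgroups(1) by (simp add: subgroup.m_closed subgroup.m_inv_closed)
  finally show ?thesis using step_facts(3) by simp
qed

lemma has_exponent_unique:
  assumes "has_exponent N t a g" "has_exponent N t b g"
  shows "a = b"
proof -
  have "has_exponent N t (a - b) (g \<otimes> inv g)"
    using has_exponent_mult[OF assms(1) has_exponent_inv[OF assms(2)]] by simp
  moreover have "g \<otimes> inv g \<in> N" using has_exponent_carrier[OF assms(1)] step_subgroups(1) by (simp add: subgroup.one_closed)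
  ultimately show ?thesis using has_exponent_in by fastforce
qed

lemma has_exponent_0_in: "has_exponent N t 0 g \<Longrightarrow> g \<in> N"
  unfolding has_exponent_def using step_carrier by auto

end

text \<open>There are \<open>(s + 1)\<^sup>2\<close> words \<open>x^i y^j\<close>, more than cosets,
  so two share a coset and their quotient lies in \<open>L\<close>. Its exponent modulo
  \<open>K1\<close> is \<open>j - j'\<close>; if that vanishes, the quotient is a nontrivial power
  of \<open>x\<close>. Either way no positive power of it is trivial.\<close>

lemma short_element_of_infinite_order:
  assumes x: "cyclic_step {\<one>} K1 x" and y: "cyclic_step K1 K2 y"
    and L: "subgroup L G" "finite (rcosets L)" and s: "card (rcosets L) < (s + 1)\<^sup>2"
  obtains i j i' j' :: nat where "i \<le> s" "j \<le> s" "i' \<le> s" "j' \<le> s"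
    "x [^] i \<otimes> y [^] j \<otimes> inv (x [^] i' \<otimes> y [^] j') \<in> L"
    "\<And>k::nat. k > 0 \<Longrightarrow> (x [^] i \<otimes> y [^] j \<otimes> inv (x [^] i' \<otimes> y [^] j')) [^] k \<noteq> \<one>"
proof -
  note c = step_carrier(3)[OF x] step_carrier(3)[OF y]
  define f where "f = (\<lambda>(i,j). L #> (x [^] (i::nat) \<otimes> y [^] (j::nat)))"
  let ?D = "{..s} \<times> {..s}"
  have "f ` ?D \<subseteq> rcosets L" using c by (auto simp: f_def intro!: rcosetsI subgroup.subset[OF L(1)])
  then have "card (f ` ?D) \<le> card (rcosets L)" using L(2) card_mono by blast
  also have "\<dots> < card ?D" using s by (simp add: power2_eq_square)
  finally have "\<not> inj_on f ?D" using pigeonhole by blast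
  then obtain i j i' j' where ij: "i \<le> s" "j \<le> s" "i' \<le> s" "j' \<le> s" "(i,j) \<noteq> (i',j')" "f (i,j) = f (i',j')"
    unfolding inj_on_def by auto
  let ?g = "x [^] i \<otimes> y [^] j \<otimes> inv (x [^] i' \<otimes> y [^] j')"
  have gc: "?g \<in> carrier G" using c by simp
  have "x [^] i \<otimes> y [^] j \<in> L #> (x [^] i' \<otimes> y [^] j')"
    using ij(6) c rcos_self[OF _ L(1), of "x [^] i \<otimes> y [^] j"] by (simp add: f_def)
  then have gL: "?g \<in> L" using c by (intro subgroup.rcos_module_imp[OF L(1) is_group]) auto
  have xK1: "x [^] i \<in> K1" for i :: nat
    using step_pow_mem[OF x step_subgroups(4)[OF x], of "int i"] by (simp add: int_pow_int)
  have ey: "has_exponent K1 y (int j) (x [^] i \<otimes> y [^] j)" for i j :: nat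
    using has_exponent_mult[OF y has_exponent_0[OF y xK1] has_exponent_gen[OF y, of "int j"]] by (simp add: int_pow_int)
  have e1: "has_exponent K1 y (int j - int j') ?g"
    using has_exponent_mult[OF y ey has_exponent_inv[OF y ey]] by simp
  have "?g [^] k \<noteq> \<one>" if k: "k > 0" for k :: nat
  proof
    assume 1: "?g [^] k = \<one>"
    have "\<one> \<in> K1" using step_subgroups(2)[OF x] by (rule subgroup.one_closed)
    moreover have "has_exponent K1 y ((int j - int j') * int k) (?g [^] k)"
      using has_exponent_pow[OF y e1, of "int k"] by (simp add: int_pow_int)
    ultimately have "(int j - int j') * int k = 0" using has_exponent_in[OF y] 1 by metis
    then have jj: "j = j'" using k by simp
    have "?g = x [^] i \<otimes> inv (x [^] i')"
      using c by (simp add: jj inv_mult_group m_assoc) (simp add: m_assoc[symmetric])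
    moreover have "has_exponent {\<one>} x (int i - int i') (x [^] i \<otimes> inv (x [^] i'))"
      using has_exponent_mult[OF x has_exponent_gen[OF x, of "int i"] has_exponent_inv[OF x has_exponent_gen[OF x, of "int i'"]]]
      by (simp add: int_pow_int)
    ultimately have "has_exponent {\<one>} x (int i - int i') ?g" by simp
    then have "has_exponent {\<one>} x ((int i - int i') * int k) (?g [^] k)"
      using has_exponent_pow[OF x, of _ _ "int k"] by (metis int_pow_int)
    then have "(int i - int i') * int k = 0" using has_exponent_in[OF x] 1 by (metis singletonI)
    then show False using k jj ij(5) by simp
  qed
  then show ?thesis using that[of i j i' j'] ij gL by blast
qed
end

section \<open>Many subgroups of one index\<close>

context group
begin

text \<open>A coset of \<open>L\<close> is given by the coset of \<open>H\<close> that contains it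
  and, after division by a chosen representative of the latter, by a coset of \<open>L\<close>
  inside \<open>H\<close>.\<close>

lemma card_rcosets_tower:
  assumes L: "subgroup L G" and H: "subgroup H G" and LH: "L \<subseteq> H"
    and f1: "finite ((\<lambda>h. L #> h) ` H)" and f2: "finite (rcosets H)"
  shows "finite (rcosets L)" "card (rcosets L) = card ((\<lambda>h. L #> h) ` H) * card (rcosets H)"
proof -
  note Lc = subgroup.subset[OF L] and Hc = subgroup.subset[OF H]
  define rep :: "'a set \<Rightarrow> 'a" where "rep = (\<lambda>C. SOME g. g \<in> C)"
  have rep: "rep C \<in> C" "rep C \<in> carrier G" "H #> rep C = C" if C: "C \<in> rcosets H" for C
  proof -
    have "C \<noteq> {}" by (rule subgroup.rcosets_non_empty[OF H C])
    then show 1: "rep C \<in> C" unfolding rep_def by (simp add: some_in_eq)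
    then show 2: "rep C \<in> carrier G" using subgroup.rcosets_carrier[OF H is_group C] by blast
    obtain g where g: "g \<in> carrier G" "C = H #> g" using C by (auto simp: RCOSETS_def)
    then show "H #> rep C = C" using repr_independence[of "rep C" H g] 1 H by simp
  qed
  define f where "f = (\<lambda>(A, C). A #> rep C)"
  have "bij_betw f ((\<lambda>h. L #> h) ` H \<times> rcosets H) (rcosets L)"
    unfolding bij_betw_def
  proof
    show "inj_on f ((\<lambda>h. L #> h) ` H \<times> rcosets H)"
    proof (rule inj_onI, clarsimp)
      fix h h' C C' assume h: "h \<in> H" "h' \<in> H" and C: "C \<in> rcosets H" "C' \<in> rcosets H"
        and eq: "f (L #> h, C) = f (L #> h', C')"
      have hc: "h \<in> carrier G" "h' \<in> carrier G" using h Hc by auto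
      have eq': "L #> (h \<otimes> rep C) = L #> (h' \<otimes> rep C')"
        using eq rep(2)[OF C(1)] rep(2)[OF C(2)] hc Lc by (simp add: f_def coset_mult_assoc)
      have "h \<otimes> rep C \<in> L #> (h' \<otimes> rep C')"
        unfolding eq'[symmetric] using rep(2)[OF C(1)] hc L by (intro rcos_self) auto
      then obtain l where l: "l \<in> L" "h \<otimes> rep C = l \<otimes> (h' \<otimes> rep C')" by (auto simp: r_coset_def)
      have lc: "l \<in> carrier G" "l \<in> H" using l Lc LH by auto
      have "rep C = (inv h \<otimes> l \<otimes> h') \<otimes> rep C'"
      proof -
        have "rep C = inv h \<otimes> (h \<otimes> rep C)" using hc rep(2)[OF C(1)] by (simp add: m_assoc[symmetric])
        then show ?thesis unfolding l(2) using hc lc rep(2)[OF C(2)] by (simp add: m_assoc)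
      qed
      moreover have "inv h \<otimes> l \<otimes> h' \<in> H" using h lc H by (simp add: subgroup.m_closed subgroup.m_inv_closed)
      ultimately have "rep C \<in> H #> rep C'" by (auto simp: r_coset_def)
      then have CC: "C = C'" using repr_independence[of "rep C" H "rep C'"] rep(2,3)[OF C(1)] rep(2,3)[OF C(2)] H by simp
      have "L #> h = (L #> (h \<otimes> rep C)) #> inv (rep C)"
        using hc Lc rep(2)[OF C(1)] by (simp add: coset_mult_assoc m_assoc)
      also have "\<dots> = (L #> (h' \<otimes> rep C')) #> inv (rep C')" using eq' CC by simp
      also have "\<dots> = L #> h'"
        using hc Lc rep(2)[OF C(2)] by (simp add: coset_mult_assoc m_assoc)
      finally show "L #> h = L #> h' \<and> C = C'" using CC by simp
    qed
    show "f ` ((\<lambda>h. L #> h) ` H \<times> rcosets H) = rcosets L"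
    proof
      show "f ` ((\<lambda>h. L #> h) ` H \<times> rcosets H) \<subseteq> rcosets L"
      proof clarsimp
        fix h C assume h: "h \<in> H" and C: "C \<in> rcosets H"
        have "h \<in> carrier G" using h Hc by blast
        then show "f (L #> h, C) \<in> rcosets L"
          using Lc rep(2)[OF C] by (simp add: f_def coset_mult_assoc rcosetsI)
      qed
      show "rcosets L \<subseteq> f ` ((\<lambda>h. L #> h) ` H \<times> rcosets H)"
      proof
        fix D assume "D \<in> rcosets L"
        then obtain g where g: "g \<in> carrier G" "D = L #> g" by (auto simp: RCOSETS_def)
        have C: "H #> g \<in> rcosets H" using g Hc by (intro rcosetsI)
        have "g \<in> H #> rep (H #> g)" using rep(3)[OF C] rcos_self[OF g(1) H] by simp
        then obtain h where h: "h \<in> H" "g = h \<otimes> rep (H #> g)" by (auto simp: r_coset_def)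
        have "D = f (L #> h, H #> g)"
          using g h Hc Lc rep(2)[OF C] by (simp add: f_def coset_mult_assoc subset_iff)
        then show "D \<in> f ` ((\<lambda>h. L #> h) ` H \<times> rcosets H)" using h C by blast
      qed
    qed
  qed
  note bij = this
  show "finite (rcosets L)" using f1 f2 bij_betw_finite[OF bij] by simp
  show "card (rcosets L) = card ((\<lambda>h. L #> h) ` H) * card (rcosets H)"
    unfolding bij_betw_same_card[OF bij, symmetric] by (rule card_cartesian_product)
qed

definition power_subgroup :: "nat \<Rightarrow> 'a set \<Rightarrow> 'a set" where
  "power_subgroup k N = generate G ((\<lambda>g. g [^] k) ` N)"

lemma power_subgroup_subgroup:
  assumes "subgroup N G"
  shows "subgroup (power_subgroup k N) G" "power_subgroup k N \<subseteq> N"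
proof -
  have "(\<lambda>g. g [^] k) ` N \<subseteq> N"
    using assms nat_pow_consistent[of _ k N] group.subgroup_self
      monoid.nat_pow_closed[OF group.is_monoid[OF subgroup_imp_group[OF assms]]] by fastforce
  then show "power_subgroup k N \<subseteq> N" unfolding power_subgroup_def by (rule generate_subgroup_incl[OF _ assms])
  show "subgroup (power_subgroup k N) G" unfolding power_subgroup_def
    using \<open>(\<lambda>g. g [^] k) ` N \<subseteq> N\<close> subgroup.subset[OF assms] by (intro generate_is_subgroup) auto
qed

text \<open>Conjugates of k-th powers are k-th powers of conjugates, so normality passes from
  \<open>N\<close> to the subgroup generated by its powers.\<close>

lemma power_subgroup_conj:
  assumes N: "subgroup N G" and conj: "\<And>n. n \<in> N \<Longrightarrow> c \<otimes> n \<otimes> inv c \<in> N" and c: "c \<in> carrier G"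
    and m: "m \<in> power_subgroup k N"
  shows "c \<otimes> m \<otimes> inv c \<in> power_subgroup k N"
proof -
  note sub = power_subgroup_subgroup[OF N, of k]
  have car: "x \<in> carrier G" if "x \<in> power_subgroup k N" for x using that subgroup.mem_carrier[OF sub(1)] by blast
  have pw: "c \<otimes> (n [^] k) \<otimes> inv c = (c \<otimes> n \<otimes> inv c) [^] k" if "n \<in> carrier G" for n and k :: nat
  proof (induction k)
    case (Suc k)
    have "(c \<otimes> n \<otimes> inv c) [^] Suc k = (c \<otimes> (n [^] k) \<otimes> inv c) \<otimes> (c \<otimes> n \<otimes> inv c)" by (simp add: Suc)
    also have "\<dots> = c \<otimes> (n [^] k) \<otimes> (inv c \<otimes> c) \<otimes> n \<otimes> inv c" using c that by (simp only: m_assoc m_closed inv_closed nat_pow_closed)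
    finally show ?case using c that by (simp add: m_assoc)
  qed (use c in simp)
  from m show ?thesis unfolding power_subgroup_def
  proof (induction m rule: generate.induct)
    case one
    then show ?case using c by (simp add: generate.one)
  next
    case (incl h)
    then show ?case using pw conj subgroup.mem_carrier[OF N] by (auto intro!: generate.incl)
  next
    case (inv h)
    then obtain n where n: "n \<in> N" "h = n [^] k" by blast
    have nc: "n \<in> carrier G" using n subgroup.mem_carrier[OF N] by blast
    have "c \<otimes> inv h \<otimes> inv c = inv (c \<otimes> h \<otimes> inv c)" using c nc n by (simp add: inv_mult_group m_assoc)
    also have "\<dots> = inv ((c \<otimes> n \<otimes> inv c) [^] k)" using pw[OF nc] n by simp
    finally show ?case using conj[OF n(1)] by (auto intro!: generate.inv)
  next
    case (eng a b)
    have ab: "a \<in> carrier G" "b \<in> carrier G" using eng(1,2) car unfolding power_subgroup_def by auto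
    have "c \<otimes> (a \<otimes> b) \<otimes> inv c = (c \<otimes> a \<otimes> inv c) \<otimes> (c \<otimes> b \<otimes> inv c)"
    proof -
      have "(c \<otimes> a \<otimes> inv c) \<otimes> (c \<otimes> b \<otimes> inv c) = c \<otimes> a \<otimes> (inv c \<otimes> c) \<otimes> b \<otimes> inv c"
        using c ab by (simp only: m_assoc m_closed inv_closed)
      then show ?thesis using c ab by (simp add: m_assoc)
    qed
    then show ?case using generate.eng[OF eng(3,4)] by simp
  qed
qed

text \<open>The generators have exponents divisible by \<open>k\<close>. This is what bounds the
  number of cosets from below.\<close>

lemma power_subgroup_exponent:
  assumes step: "cyclic_step P N t" and m: "m \<in> power_subgroup k N"
  shows "\<exists>j. has_exponent P t (int k * j) m"
  using m unfolding power_subgroup_def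
proof (induction m rule: generate.induct)
  case one
  show ?case using has_exponent_0[OF step subgroup.one_closed[OF step_subgroups(1)[OF step]]] by (intro exI[of _ 0]) simp
next
  case (incl h)
  then obtain n where n: "n \<in> N" "h = n [^] k" by blast
  obtain a where "has_exponent P t a n" using has_exponent_exists[OF step n(1)] by blast
  from has_exponent_pow[OF step this, of "int k"] show ?case by (auto simp: n int_pow_int mult.commute)
next
  case (inv h)
  then obtain n where n: "n \<in> N" "h = n [^] k" by blast
  obtain a where "has_exponent P t a n" using has_exponent_exists[OF step n(1)] by blast
  from has_exponent_inv[OF step has_exponent_pow[OF step this, of "int k"]] show ?case
    by (intro exI[of _ "- a"]) (auto simp: n int_pow_int mult.commute)
next
  case (eng a b)
  then obtain i j where "has_exponent P t (int k * i) a" "has_exponent P t (int k * j) b" by blast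
  from has_exponent_mult[OF step this] show ?case by (intro exI[of _ "i + j"]) (simp add: distrib_left)
qed

text \<open>Induction along the series: each infinite cyclic factor multiplies the number of cosets
  by at most \<open>k\<close>.\<close>

lemma finite_rcosets_power_subgroup:
  assumes step: "\<And>j. j < n \<Longrightarrow> cyclic_step (S j) (S (Suc j)) (t j)" and S0: "S 0 = {\<one>}" and k: "k > 0"
    and sub: "S n \<subseteq> N" and N: "subgroup N G" and conj: "\<And>m c. c \<in> N \<Longrightarrow> m \<in> power_subgroup k N \<Longrightarrow> c \<otimes> m \<otimes> inv c \<in> power_subgroup k N"
  shows "finite ((\<lambda>h. power_subgroup k N #> h) ` S n)"
proof -
  let ?M = "power_subgroup k N"
  note M = power_subgroup_subgroup[OF N, of k]
  have Mc: "?M \<subseteq> carrier G" using subgroup.subset[OF M(1)] .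
  show ?thesis using step sub
  proof (induction n)
    case 0
    then show ?case by (simp add: S0)
  next
    case (Suc n)
    have st: "cyclic_step (S n) (S (Suc n)) (t n)" using Suc.prems(1) by simp
    have SN: "S n \<subseteq> N" using step_subgroups(3)[OF st] Suc.prems(2) by simp
    have tN: "t n \<in> N" "t n \<in> carrier G" using step_subgroups(4)[OF st] Suc.prems(2) step_carrier(3)[OF st] by auto
    have fin: "finite ((\<lambda>h. ?M #> h) ` S n)" using Suc.IH Suc.prems(1) SN by simp
    have "(\<lambda>h. ?M #> h) ` S (Suc n) \<subseteq> (\<lambda>(C, c). C #> (t n [^] (c::int))) ` (((\<lambda>h. ?M #> h) ` S n) \<times> {0..<int k})"
    proof
      fix C assume "C \<in> (\<lambda>h. ?M #> h) ` S (Suc n)"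
      then obtain g where g: "g \<in> S (Suc n)" "C = ?M #> g" by blast
      obtain a where "has_exponent (S n) (t n) a g" using has_exponent_exists[OF st g(1)] by blast
      then obtain s where s: "s \<in> S n" "g = s \<otimes> t n [^] a" unfolding has_exponent_def by blast
      have sc: "s \<in> carrier G" "s \<in> N" using s(1) SN subgroup.mem_carrier[OF N] by auto
      \<comment> \<open>The exponent is reduced modulo \<open>k\<close>. The discarded factor is a
        k-th power of an element of \<open>N\<close>, and conjugation by \<open>s\<close> carries it
        to the left, where the subgroup absorbs it.\<close>
      define b where "b = a div int k"
      define c where "c = a mod int k"
      have a: "a = b * int k + c" by (simp add: b_def c_def)
      have "t n [^] b \<in> N" using int_pow_consistent[OF N tN(1), of b] group.int_pow_closed[OF subgroup_imp_group[OF N], of "t n" b] tN by simp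
      then have "(t n [^] b) [^] k \<in> ?M" unfolding power_subgroup_def by (intro generate.incl) blast
      moreover have "(t n [^] b) [^] k = t n [^] (b * int k)" using tN(2) by (simp add: int_pow_pow flip: int_pow_int)
      ultimately have m: "t n [^] (b * int k) \<in> ?M" by simp
      have m': "s \<otimes> t n [^] (b * int k) \<otimes> inv s \<in> ?M" using conj[OF sc(2) m] .
      have "g = (s \<otimes> t n [^] (b * int k) \<otimes> inv s) \<otimes> (s \<otimes> t n [^] c)"
        unfolding s(2) a using sc tN by (simp add: m_assoc int_pow_mult) (simp add: m_assoc[symmetric])
      then have "C = (?M #> (s \<otimes> t n [^] (b * int k) \<otimes> inv s)) #> (s \<otimes> t n [^] c)"
        unfolding g(2) using Mc sc tN by (simp add: coset_mult_assoc)
      also have "?M #> (s \<otimes> t n [^] (b * int k) \<otimes> inv s) = ?M"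
        using m' M(1) subgroup.mem_carrier[OF M(1) m'] by (intro coset_join2) auto
      also have "?M #> (s \<otimes> t n [^] c) = (?M #> s) #> t n [^] c" using Mc sc tN by (simp add: coset_mult_assoc)
      finally show "C \<in> (\<lambda>(C, c). C #> (t n [^] (c::int))) ` (((\<lambda>h. ?M #> h) ` S n) \<times> {0..<int k})"
        using s(1) k by (intro image_eqI[of _ _ "(?M #> s, c)"]) (auto simp: c_def)
    qed
    then show ?case by (rule finite_subset) (use fin in simp)
  qed
qed

text \<open>Let \<open>u\<close> generate the top factor \<open>H / N\<close>, and let \<open>M\<close> be generated by the \<open>k\<close>-th powers of \<open>N\<close>. The groups
  generated by \<open>M\<close> and \<open>u \<otimes> c\<close> all have index \<open>[G : H] [N : M]\<close>, and they are distinct for \<open>c\<close> in distinct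
  cosets of \<open>M\<close>.\<close>

lemma many_subgroups_of_same_index:
  assumes step: "\<And>j. j < h \<Longrightarrow> cyclic_step (S j) (S (Suc j)) (t j)" and S0: "S 0 = {\<one>}" and h: "h \<ge> 2"
    and fin: "finite (rcosets (S h))" and k: "k > 0"
  shows "\<exists>n \<A>. n \<ge> 1 \<and> card \<A> \<ge> k \<and> (\<forall>L\<in>\<A>. subgroup L G \<and> finite (rcosets L) \<and> card (rcosets L) = n)"
proof -
  define H where "H = S h"
  define N where "N = S (h - 1)"
  define P where "P = S (h - 2)"
  define u where "u = t (h - 1)"
  define v where "v = t (h - 2)"
  have sH: "cyclic_step N H u" using step[of "h - 1"] h by (simp add: H_def N_def u_def)
  have "Suc (h - 2) = h - 1" using h by simp
  then have sN: "cyclic_step P N v" using step[of "h - 2"] h unfolding P_def N_def v_def by simp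
  note N = step_subgroups(1)[OF sH] and H = step_subgroups(2)[OF sH] and NH = step_subgroups(3)[OF sH]
  define M where "M = power_subgroup k N"
  note M = power_subgroup_subgroup[OF N, of k, folded M_def]
  have Mc: "M \<subseteq> carrier G" using subgroup.subset[OF M(1)] .
  have conj: "c \<otimes> m \<otimes> inv c \<in> M" if "c \<in> H" "m \<in> M" for c m
    using power_subgroup_conj[OF N step_conj[OF sH that(1)] step_carrier(1)[OF sH that(1)]] that(2) unfolding M_def by blast
  define U where "U = (\<lambda>h. M #> h) ` N"
  have finU: "finite U"
    unfolding U_def M_def
  proof (subst (2) N_def, rule finite_rcosets_power_subgroup[where t = t and n = "h - 1" and S = S and N = N and k = k])
    show "cyclic_step (S j) (S (Suc j)) (t j)" if "j < h - 1" for j using step that by simp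
    show "c \<otimes> m \<otimes> inv c \<in> power_subgroup k N" if "c \<in> N" "m \<in> power_subgroup k N" for m c
      using conj that NH unfolding M_def by blast
  qed (use S0 k N in \<open>auto simp: N_def\<close>)
  \<comment> \<open>The powers of \<open>v\<close> with exponents below \<open>k\<close> lie in
    distinct cosets, because elements of \<open>M\<close> have exponents divisible by
    \<open>k\<close>.\<close>
  have kU: "k \<le> card U"
  proof -
    have vN: "v [^] (int i) \<in> N" for i using step_pow_mem[OF sN step_subgroups(4)[OF sN]] .
    have vc: "v \<in> carrier G" using step_carrier(3)[OF sN] .
    have "inj_on (\<lambda>i. M #> v [^] (int i)) {..<k}"
    proof (rule inj_onI)
      fix i j assume ij: "i \<in> {..<k}" "j \<in> {..<k}" "M #> v [^] (int i) = M #> v [^] (int j)"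
      then have "v [^] (int i) \<in> M #> v [^] (int j)" using rcos_self[of "v [^] (int i)" M] vc M(1) by auto
      then have "v [^] (int i) \<otimes> inv (v [^] (int j)) \<in> M"
        using vc by (intro subgroup.rcos_module_imp[OF M(1) is_group]) auto
      then obtain l where l: "has_exponent P v (int k * l) (v [^] (int i) \<otimes> inv (v [^] (int j)))"
        using power_subgroup_exponent[OF sN] unfolding M_def by blast
      have "has_exponent P v (int i - int j) (v [^] (int i) \<otimes> inv (v [^] (int j)))"
        using has_exponent_mult[OF sN has_exponent_gen[OF sN] has_exponent_inv[OF sN has_exponent_gen[OF sN]]] by fastforce
      then have eq: "int i - int j = int k * l" using has_exponent_unique[OF sN l] by simp
      then have "int i mod int k = int j mod int k" by (metis mod_mult_self2 diff_add_cancel add.commute)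
      then show "i = j" using ij by simp
    qed
    then have "k = card ((\<lambda>i. M #> v [^] (int i)) ` {..<k})" by (simp add: card_image)
    also have "\<dots> \<le> card U" using vN finU by (intro card_mono) (auto simp: U_def)
    finally show ?thesis .
  qed
  \<comment> \<open>The product of \<open>M\<close>, which is normalised by \<open>H\<close>, with
    the cyclic group generated by \<open>u \<otimes> c\<close>.\<close>
  define L where "L = (\<lambda>c. {m \<otimes> (u \<otimes> c) [^] (i::int) | m i. m \<in> M})"
  have uc: "u \<in> carrier G" "u \<in> H" using step_carrier(3)[OF sH] step_subgroups(4)[OF sH] by auto
  have ucH: "u \<otimes> c \<in> H" "u \<otimes> c \<in> carrier G" if "c \<in> N" for c
    using that uc NH H subgroup.mem_carrier[OF H] by (auto simp: subgroup.m_closed subset_iff)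
  have ex1: "has_exponent N u 1 (u \<otimes> c)" if "c \<in> N" for c
    using has_exponent_mult[OF sH has_exponent_gen[OF sH, of 1] has_exponent_0[OF sH that]] uc by simp
  have exL: "has_exponent N u i (m \<otimes> (u \<otimes> c) [^] (i::int))" if "c \<in> N" "m \<in> M" for c m i
    using has_exponent_mult[OF sH has_exponent_0[OF sH] has_exponent_pow[OF sH ex1[OF that(1)], of i]] M(2) that by fastforce
  have pc: "(u \<otimes> c) [^] (i::int) \<in> H" if "c \<in> N" for c i using step_pow_mem[OF sH ucH(1)[OF that]] .
  have pcc: "(u \<otimes> c) [^] (i::int) \<in> carrier G" if "c \<in> N" for c i using ucH(2)[OF that] by simp
  have subL: "subgroup (L c) G" if c: "c \<in> N" for c
  proof
    show "L c \<subseteq> carrier G" using Mc ucH(2)[OF c] by (auto simp: L_def)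
    have "\<one> \<otimes> (u \<otimes> c) [^] (0::int) \<in> L c" unfolding L_def using subgroup.one_closed[OF M(1)] by blast
    then show "\<one> \<in> L c" by simp
  next
    fix x y assume "x \<in> L c" "y \<in> L c"
    then obtain m i m' j where x: "m \<in> M" "x = m \<otimes> (u \<otimes> c) [^] (i::int)" and y: "m' \<in> M" "y = m' \<otimes> (u \<otimes> c) [^] (j::int)"
      unfolding L_def by blast
    let ?w = "(u \<otimes> c) [^] i"
    have w: "?w \<in> carrier G" using pcc[OF c] .
    have mc: "m \<in> carrier G" "m' \<in> carrier G" using x y Mc by auto
    have "x \<otimes> y = (m \<otimes> (?w \<otimes> m' \<otimes> inv ?w)) \<otimes> (?w \<otimes> (u \<otimes> c) [^] j)"
      unfolding x y using mc w pcc[OF c, of j] by (simp add: m_assoc) (simp add: m_assoc[symmetric])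
    also have "?w \<otimes> (u \<otimes> c) [^] j = (u \<otimes> c) [^] (i + j)" using ucH(2)[OF c] by (simp add: int_pow_mult)
    finally have "x \<otimes> y = (m \<otimes> (?w \<otimes> m' \<otimes> inv ?w)) \<otimes> (u \<otimes> c) [^] (i + j)" .
    moreover have "m \<otimes> (?w \<otimes> m' \<otimes> inv ?w) \<in> M" using conj[OF pc[OF c] y(1)] x(1) M(1) by (simp add: subgroup.m_closed)
    ultimately show "x \<otimes> y \<in> L c" unfolding L_def by blast
  next
    fix x assume "x \<in> L c"
    then obtain m i where x: "m \<in> M" "x = m \<otimes> (u \<otimes> c) [^] (i::int)" unfolding L_def by blast
    let ?w = "(u \<otimes> c) [^] (- i)"
    have w: "?w \<in> carrier G" using pcc[OF c] .
    have mc: "m \<in> carrier G" using x Mc by auto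
    have "inv x = ?w \<otimes> inv m" unfolding x using mc ucH(2)[OF c] by (simp add: inv_mult_group int_pow_neg)
    also have "\<dots> = (?w \<otimes> inv m \<otimes> inv ?w) \<otimes> ?w" using w mc by (simp add: m_assoc)
    finally have "inv x = (?w \<otimes> inv m \<otimes> inv ?w) \<otimes> ?w" .
    moreover have "?w \<otimes> inv m \<otimes> inv ?w \<in> M" using conj[OF pc[OF c] subgroup.m_inv_closed[OF M(1) x(1)]] .
    ultimately show "inv x \<in> L c" unfolding L_def by blast
  qed
  have LH: "L c \<subseteq> H" if c: "c \<in> N" for c
    using M(2) NH pc[OF c] H unfolding L_def by (auto intro!: subgroup.m_closed[OF H])
  have LN: "x \<in> M" if c: "c \<in> N" and xL: "x \<in> L c" and xN: "x \<in> N" for c x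
  proof -
    obtain m i where x: "m \<in> M" "x = m \<otimes> (u \<otimes> c) [^] (i::int)" using xL unfolding L_def by blast
    then have "i = 0" using has_exponent_in[OF sH exL[OF c x(1)]] xN by metis
    then show ?thesis using x Mc by auto
  qed
  have subM: "M \<subseteq> L c" if "c \<in> N" for c
  proof
    fix m assume "m \<in> M"
    then have "m = m \<otimes> (u \<otimes> c) [^] (0::int)" using Mc by auto
    then show "m \<in> L c" using \<open>m \<in> M\<close> unfolding L_def by blast
  qed
  have genL: "(u \<otimes> c) [^] (i::int) \<in> L c" if "c \<in> N" for c i
  proof -
    have "(u \<otimes> c) [^] i = \<one> \<otimes> (u \<otimes> c) [^] i" using pcc[OF that] by simp
    then show ?thesis unfolding L_def using subgroup.one_closed[OF M(1)] by blast
  qed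
  \<comment> \<open>\<open>L c\<close> meets \<open>N\<close> in \<open>M\<close> and contains
    elements of every exponent. So every coset of \<open>L c\<close> in \<open>H\<close> meets
    \<open>N\<close> in exactly one coset of \<open>M\<close>, whatever \<open>c\<close> is.\<close>
  have cosetsL: "bij_betw (\<lambda>C. L c <#> C) U ((\<lambda>h. L c #> h) ` H)" if c: "c \<in> N" for c
  proof -
    have Lc: "L c \<subseteq> carrier G" using subgroup.subset[OF subL[OF c]] .
    have Lcoset: "L c <#> (M #> n) = L c #> n" if n: "n \<in> N" for n
    proof
      have nc: "n \<in> carrier G" using n subgroup.mem_carrier[OF N] by blast
      show "L c <#> (M #> n) \<subseteq> L c #> n"
      proof
        fix x assume "x \<in> L c <#> (M #> n)"
        then obtain l m where lm: "l \<in> L c" "m \<in> M" "x = l \<otimes> (m \<otimes> n)" unfolding set_mult_def r_coset_def by blast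
        have lc: "l \<in> carrier G" "m \<in> carrier G" using lm(1,2) Lc Mc by blast+
          have "x = (l \<otimes> m) \<otimes> n" unfolding lm(3) using lc nc by (simp only: m_assoc)
        moreover have "l \<otimes> m \<in> L c" using lm subM[OF c] subL[OF c] by (auto intro: subgroup.m_closed)
        ultimately show "x \<in> L c #> n" unfolding r_coset_def by blast
      qed
      show "L c #> n \<subseteq> L c <#> (M #> n)"
      proof
        fix x assume "x \<in> L c #> n"
        then obtain l where l: "l \<in> L c" "x = l \<otimes> n" unfolding r_coset_def by blast
        moreover have "n \<in> M #> n" using nc M(1) by (rule rcos_self)
        ultimately show "x \<in> L c <#> (M #> n)" unfolding set_mult_def by blast
      qed
    qed
    show ?thesis unfolding bij_betw_def
    proof
      show "inj_on (\<lambda>C. L c <#> C) U"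
      proof (rule inj_onI)
        fix C C' assume C: "C \<in> U" "C' \<in> U" "L c <#> C = L c <#> C'"
        obtain n n' where n: "n \<in> N" "C = M #> n" "n' \<in> N" "C' = M #> n'" using C(1,2) unfolding U_def by blast
        have nc: "n \<in> carrier G" "n' \<in> carrier G" using n subgroup.mem_carrier[OF N] by auto
        have "n \<in> L c #> n'" using C(3) n Lcoset rcos_self[OF nc(1) subL[OF c]] by simp
        then have "n \<otimes> inv n' \<in> L c" using nc by (intro subgroup.rcos_module_imp[OF subL[OF c] is_group])
        moreover have "n \<otimes> inv n' \<in> N" using n N by (simp add: subgroup.m_closed subgroup.m_inv_closed)
        ultimately have "n \<otimes> inv n' \<in> M" using LN[OF c] by blast
        then have "n \<in> M #> n'" using nc by (intro subgroup.rcos_module_rev[OF M(1) is_group])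
        then show "C = C'" using n repr_independence[OF _ nc(2) M(1)] by simp
      qed
      show "(\<lambda>C. L c <#> C) ` U = (\<lambda>h. L c #> h) ` H"
      proof
        show "(\<lambda>C. L c <#> C) ` U \<subseteq> (\<lambda>h. L c #> h) ` H" using Lcoset NH unfolding U_def by auto
        show "(\<lambda>h. L c #> h) ` H \<subseteq> (\<lambda>C. L c <#> C) ` U"
        proof
          fix D assume "D \<in> (\<lambda>h. L c #> h) ` H"
          then obtain g where g: "g \<in> H" "D = L c #> g" by blast
          have gc: "g \<in> carrier G" using g subgroup.mem_carrier[OF H] by blast
          obtain i where i: "has_exponent N u i g" using has_exponent_exists[OF sH g(1)] by blast
          let ?w = "(u \<otimes> c) [^] (- i)"
          have "has_exponent N u (- i + i) (?w \<otimes> g)"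
            using has_exponent_mult[OF sH has_exponent_pow[OF sH ex1[OF c], of "- i"] i] by simp
          then have n: "?w \<otimes> g \<in> N" using has_exponent_0_in[OF sH] by simp
          have "?w \<otimes> g \<in> L c #> g" using genL[OF c] unfolding r_coset_def by blast
          then have "D = L c #> (?w \<otimes> g)" using g(2) repr_independence[OF _ gc subL[OF c]] by simp
          then have "D = L c <#> (M #> (?w \<otimes> g))" using Lcoset[OF n] by simp
          then show "D \<in> (\<lambda>C. L c <#> C) ` U" using n unfolding U_def by blast
        qed
      qed
    qed
  qed
  define n where "n = card U * card (rcosets H)"
  have idx: "finite (rcosets (L c)) \<and> card (rcosets (L c)) = n" if c: "c \<in> N" for c
  proof -
    have "finite ((\<lambda>h. L c #> h) ` H)" "card ((\<lambda>h. L c #> h) ` H) = card U"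
      using bij_betw_finite[OF cosetsL[OF c]] bij_betw_same_card[OF cosetsL[OF c]] finU by auto
    then show ?thesis using card_rcosets_tower[OF subL[OF c] H LH[OF c]] fin by (simp add: n_def H_def)
  qed
  define rep where "rep = (\<lambda>C. SOME c. c \<in> C \<and> c \<in> N)"
  have rep: "rep C \<in> C \<and> rep C \<in> N" if "C \<in> U" for C
  proof -
    obtain c where "c \<in> N" "C = M #> c" using \<open>C \<in> U\<close> unfolding U_def by blast
    then have "c \<in> C \<and> c \<in> N" using rcos_self[OF _ M(1)] subgroup.mem_carrier[OF N] by blast
    then show ?thesis unfolding rep_def by (rule someI)
  qed
  \<comment> \<open>An element of exponent 1 in \<open>L c'\<close> has the form
    \<open>m \<otimes> (u \<otimes> c')\<close>. If \<open>u \<otimes> c\<close> is one of them,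
    normality of \<open>M\<close> puts \<open>c\<close> into the coset of \<open>c'\<close>.\<close>
  have injL: "inj_on (\<lambda>C. L (rep C)) U"
  proof (rule inj_onI)
    fix C C' assume C: "C \<in> U" "C' \<in> U" "L (rep C) = L (rep C')"
    define c c' where "c = rep C" and "c' = rep C'"
    have c: "c \<in> C" "c \<in> N" "c' \<in> C'" "c' \<in> N" using rep[OF C(1)] rep[OF C(2)] by (auto simp: c_def c'_def)
    have cc: "c \<in> carrier G" "c' \<in> carrier G" using c subgroup.mem_carrier[OF N] by auto
    have "u \<otimes> c \<in> L c'" using genL[OF c(2), of 1] C(3) ucH(2)[OF c(2)] by (simp add: c_def c'_def)
    then obtain m i where m: "m \<in> M" "u \<otimes> c = m \<otimes> (u \<otimes> c') [^] (i::int)" unfolding L_def by blast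
    have "i = 1" using has_exponent_unique[OF sH exL[OF c(4) m(1), of i]] ex1[OF c(2)] m(2) by metis
    then have uc': "u \<otimes> c = m \<otimes> (u \<otimes> c')" using m(2) ucH(2)[OF c(4)] by simp
    have mc: "m \<in> carrier G" using m Mc by auto
    have "c = (inv u \<otimes> m \<otimes> inv (inv u)) \<otimes> c'"
    proof -
      have "c = inv u \<otimes> (u \<otimes> c)" using cc uc by (simp add: m_assoc[symmetric])
      then show ?thesis unfolding uc' using cc uc mc by (simp add: m_assoc)
    qed
    moreover have "inv u \<otimes> m \<otimes> inv (inv u) \<in> M" by (rule conj[OF subgroup.m_inv_closed[OF H uc(2)] m(1)])
    ultimately have "c \<in> M #> c'" unfolding r_coset_def by blast
    then have 1: "M #> c' = M #> c" using repr_independence[OF _ cc(2) M(1)] by simp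
    have coset: "D = M #> d" if "D \<in> U" "d \<in> D" for D d
    proof -
      obtain e where e: "e \<in> N" "D = M #> e" using \<open>D \<in> U\<close> unfolding U_def by blast
      then show ?thesis using repr_independence[of d M e] \<open>d \<in> D\<close> M(1) subgroup.mem_carrier[OF N] by blast
    qed
    show "C = C'" using coset[OF C(1) c(1)] coset[OF C(2) c(3)] 1 by simp
  qed
  define \<A> where "\<A> = (\<lambda>C. L (rep C)) ` U"
  have "card \<A> = card U" unfolding \<A>_def by (rule card_image[OF injL])
  moreover have "\<forall>K\<in>\<A>. subgroup K G \<and> finite (rcosets K) \<and> card (rcosets K) = n"
    using subL idx rep unfolding \<A>_def by blast
  moreover have "n \<ge> 1"
  proof -
    have "H #> \<one> \<in> rcosets H" using subgroup.subset[OF H] by (intro rcosetsI) auto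
    then have "card (rcosets H) > 0" using fin by (auto simp: H_def card_gt_0_iff)
    moreover have "card U > 0" using kU k by simp
    ultimately show ?thesis by (simp add: n_def Suc_leI)
  qed
  ultimately show ?thesis using kU by metis
qed
end

section \<open>Convolution on compact groups\<close>

locale compact_haar =
  fixes M :: "'x::{topological_ab_group_add, t2_space} measure"
  assumes comp: "compact (UNIV :: 'x set)" and haar: "normalized_Haar_measure M"
begin

lemma sets_M [measurable_cong]: "sets M = sets borel"
  using haar by (simp add: normalized_Haar_measure_def)

lemma space_M [simp]: "space M = UNIV"
  using sets_eq_imp_space_eq[OF sets_M] by simp

sublocale prob_space M
  by (rule prob_spaceI) (use haar in \<open>simp add: normalized_Haar_measure_def\<close>)

lemma prob_UNIV [simp]: "prob UNIV = 1"
  using prob_space by simp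

lemma translate_eq_vimage: "(\<lambda>y. a + y) ` E = (\<lambda>y. - a + y) -` E" for a :: 'x
proof (rule equalityI; rule subsetI)
  fix z assume "z \<in> (\<lambda>y. - a + y) -` E"
  moreover have "z = a + (- a + z)" by (simp add: add.assoc[symmetric])
  ultimately show "z \<in> (\<lambda>y. a + y) ` E" by blast
qed (auto simp: add.assoc[symmetric])

lemma emeasure_translate: "E \<in> sets borel \<Longrightarrow> emeasure M ((\<lambda>y. x + y) ` E) = emeasure M E"
  using haar by (simp add: normalized_Haar_measure_def)

text \<open>By compactness finitely many translates of a nonempty open set cover the group, so it
  cannot be null.\<close>

lemma open_pos:
  fixes U :: "'x set"
  assumes U: "open U" "U \<noteq> {}"
  shows "measure M U > 0"
proof (rule ccontr)
  assume "\<not> measure M U > 0"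
  then have "measure M U = 0" by (simp add: zero_less_measure_iff)
  then have U0: "emeasure M U = 0" by (simp add: emeasure_eq_measure)
  obtain u where u: "u \<in> U" using U by blast
  define T where "T = (\<lambda>x. (\<lambda>y. x + y) ` U)"
  have T: "T x = (\<lambda>y. - x + y) -` U" for x
    unfolding T_def by (rule translate_eq_vimage)
  have oT: "open (T x)" for x unfolding T
    by (rule open_vimage[OF U(1)]) (intro continuous_intros)
  have "UNIV \<subseteq> (\<Union>x\<in>UNIV. T x)"
  proof
    fix z :: 'x
    have "z = (z - u) + u" by simp
    then have "z \<in> T (z - u)" using u unfolding T_def by blast
    then show "z \<in> (\<Union>x\<in>UNIV. T x)" by blast
  qed
  then obtain F where F: "finite F" "UNIV \<subseteq> (\<Union>x\<in>F. T x)"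
    using compactE_image[OF comp, of UNIV T] oT by metis
  have "emeasure M UNIV \<le> emeasure M (\<Union>x\<in>F. T x)" using F oT by (intro emeasure_mono) (auto simp: sets_M)
  also have "\<dots> \<le> (\<Sum>x\<in>F. emeasure M (T x))" using F oT by (intro emeasure_subadditive_finite) (auto simp: sets_M)
  also have "\<dots> = 0" using U0 U(1) emeasure_translate[of U] by (simp add: T_def)
  finally show False using emeasure_space_1 by simp
qed

abbreviation cont :: "('x \<Rightarrow> complex) \<Rightarrow> bool" where "cont f \<equiv> continuous_on UNIV f"

lemma cont_measurable:
  fixes f :: "'x \<Rightarrow> 'b::topological_space"
  assumes "continuous_on UNIV f"
  shows "f \<in> borel_measurable M"
  using borel_measurable_continuous_onI[OF assms] measurable_cong_sets[OF sets_M refl] by blast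

lemma cont_bounded:
  fixes f :: "'x \<Rightarrow> 'b::real_normed_vector"
  assumes "continuous_on UNIV f"
  obtains B where "B > 0" "\<And>x. norm (f x) \<le> B"
proof -
  have "compact (range f)" by (rule compact_continuous_image[OF assms comp])
  then have "bounded (range f)" by (rule compact_imp_bounded)
  then show ?thesis using that unfolding bounded_pos by blast
qed

lemma bounded_integrable:
  fixes f :: "'x \<Rightarrow> 'b::{banach,second_countable_topology}"
  assumes "f \<in> borel_measurable M" "\<And>x. norm (f x) \<le> B"
  shows "integrable M f"
  using assms by (intro integrable_const_bound[of f B]) auto

lemma cont_integrable:
  fixes f :: "'x \<Rightarrow> 'b::{banach,second_countable_topology}"
  assumes "continuous_on UNIV f"
  shows "integrable M f"
  using cont_bounded[OF assms] bounded_integrable cont_measurable[OF assms] by metis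

abbreviation I :: "('x \<Rightarrow> 'b::{banach,second_countable_topology}) \<Rightarrow> 'b" where "I f \<equiv> integral\<^sup>L M f"

lemma norm_I_le:
  fixes f :: "'x \<Rightarrow> 'b::{banach,second_countable_topology}"
  assumes "\<And>x. norm (f x) \<le> B"
  shows "norm (I f) \<le> B"
proof -
  have B: "B \<ge> 0" using assms[of 0] norm_ge_zero order.trans by blast
  show ?thesis
  proof (cases "integrable M f")
    case True
    have "norm (I f) \<le> I (\<lambda>x. norm (f x))" by (rule integral_norm_bound)
    also have "\<dots> \<le> I (\<lambda>x. B)" using True assms by (intro integral_mono) auto
    finally show ?thesis by (simp add: prob_space)
  next
    case False
    then show ?thesis using B by (simp add: not_integrable_integral_eq)
  qed
qed

lemma I_translate:
  fixes f :: "'x \<Rightarrow> 'b::{banach,second_countable_topology}"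
  assumes "continuous_on UNIV f"
  shows "I (\<lambda>x. f (a + x)) = I f"
proof -
  have mt: "(\<lambda>x. a + x) \<in> measurable M M"
  proof -
    have "continuous_on UNIV (\<lambda>x. a + x)" by (intro continuous_intros)
    from cont_measurable[OF this] show ?thesis
      using measurable_cong_sets[OF refl sets_M, of M] by (simp only:)
  qed
  have "distr M M (\<lambda>x. a + x) = M"
  proof (rule measure_eqI)
    fix E assume "E \<in> sets (distr M M (\<lambda>x. a + x))"
    then have E: "E \<in> sets borel" by (simp add: sets_M)
    have "(\<lambda>x. a + x) -` E = (\<lambda>x. - a + x) ` E"
      using translate_eq_vimage[of "- a" E] by simp
    moreover have "emeasure (distr M M (\<lambda>x. a + x)) E = emeasure M ((\<lambda>x. a + x) -` E \<inter> space M)"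
      using E by (intro emeasure_distr[OF mt]) (simp add: sets_M)
    ultimately show "emeasure (distr M M (\<lambda>x. a + x)) E = emeasure M E"
      using emeasure_translate[OF E, of "- a"] by (simp only: space_M Int_UNIV_right)
  qed simp
  then show ?thesis using integral_distr[OF mt cont_measurable[OF assms]] by simp
qed

lemma I_translate':
  fixes f :: "'x \<Rightarrow> 'b::{banach,second_countable_topology}"
  assumes "continuous_on UNIV f"
  shows "I (\<lambda>x. f (x + a)) = I f" "I (\<lambda>x. f (x - a)) = I f"
  using I_translate[OF assms, of a] I_translate[OF assms, of "- a"] by (simp_all add: add.commute)

lemma I_step:
  fixes h :: "'x \<Rightarrow> 'b::{banach,second_countable_topology}"
  assumes P: "finite (range p)" "\<And>a. p -` {a} \<in> sets borel"
  shows "integrable M (\<lambda>x. h (p x))" "I (\<lambda>x. h (p x)) = (\<Sum>a\<in>range p. measure M (p -` {a}) *\<^sub>R h a)"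
proof -
  have eq: "h (p x) = (\<Sum>a\<in>range p. indicator (p -` {a}) x *\<^sub>R h a)" for x
  proof -
    have "(\<Sum>a\<in>range p. indicator (p -` {a}) x *\<^sub>R h a) = (\<Sum>a\<in>{p x}. indicator (p -` {a}) x *\<^sub>R h a)"
      using P(1) by (intro sum.mono_neutral_right) (auto simp: indicator_def)
    then show ?thesis by simp
  qed
  have int: "integrable M (\<lambda>x. indicator (p -` {a}) x *\<^sub>R h a)" for a
    using P(2) by (intro integrable_indicator) (auto simp: sets_M emeasure_eq_measure)
  show "integrable M (\<lambda>x. h (p x))" unfolding eq using int by (intro Bochner_Integration.integrable_sum) auto
  show "I (\<lambda>x. h (p x)) = (\<Sum>a\<in>range p. measure M (p -` {a}) *\<^sub>R h a)"
  proof -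
    have "I (\<lambda>x. indicator (p -` {a}) x *\<^sub>R h a) = measure M (p -` {a}) *\<^sub>R h a" for a
      using P(2) by (subst integral_scaleR_left) (auto simp: sets_M emeasure_eq_measure)
    then show ?thesis unfolding eq by (subst Bochner_Integration.integral_sum) (auto simp: int)
  qed
qed

text \<open>Compactness gives neighbourhoods of the first variable on which \<open>F\<close> is
  nearly constant uniformly in the second. Sending \<open>x\<close> to the centre of the first
  chosen neighbourhood that contains it makes the step map Borel.\<close>

lemma approx_partition:
  fixes F :: "'x \<times> 'x \<Rightarrow> complex"
  assumes F: "continuous_on UNIV F" and e: "e > 0"
  obtains p where "finite (range p)" "\<And>a. p -` {a} \<in> sets borel" "\<And>x y. norm (F (x, y) - F (p x, y)) \<le> e"
proof -
  have "\<exists>X0. x \<in> X0 \<and> open X0 \<and> (\<forall>z\<in>X0. \<forall>y. dist (F (z, y)) (F (x, y)) \<le> e)" for x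
  proof -
    have "continuous_on (UNIV \<times> UNIV) F" using F by simp
    from continuous_on_prod_compactE[OF this comp UNIV_I e, of x] show ?thesis by (metis IntI UNIV_I)
  qed
  then obtain V where V: "\<And>x. x \<in> V x" "\<And>x. open (V x)" "\<And>x z y. z \<in> V x \<Longrightarrow> dist (F (z, y)) (F (x, y)) \<le> e"
    by metis
  have "UNIV \<subseteq> (\<Union>x\<in>UNIV. V x)" using V(1) by blast
  then obtain T where T: "finite T" "UNIV \<subseteq> (\<Union>x\<in>T. V x)"
    using compactE_image[OF comp, of UNIV V] V(2) by metis
  obtain f and n :: nat where f: "T = f ` {i. i < n}" using finite_imp_nat_seg_image_inj_on[OF T(1)] by metis
  define l where "l = (\<lambda>x. LEAST i. i < n \<and> x \<in> V (f i))"
  have ex: "\<exists>i. i < n \<and> x \<in> V (f i)" for x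
  proof -
    have "x \<in> (\<Union>x\<in>T. V x)" using T(2) by blast
    then show ?thesis unfolding f by blast
  qed
  have l: "l x < n" "x \<in> V (f (l x))" for x unfolding l_def using LeastI_ex[OF ex] by auto
  define p where "p = (\<lambda>x. f (l x))"
  have leq: "l x = i \<longleftrightarrow> (i < n \<and> x \<in> V (f i) \<and> (\<forall>j<i. x \<notin> V (f j)))" for x i
  proof
    assume "l x = i"
    then show "i < n \<and> x \<in> V (f i) \<and> (\<forall>j<i. x \<notin> V (f j))"
      using l[of x] not_less_Least[of _ "\<lambda>i. i < n \<and> x \<in> V (f i)"] unfolding l_def by (metis order.strict_trans)
  next
    assume i: "i < n \<and> x \<in> V (f i) \<and> (\<forall>j<i. x \<notin> V (f j))"
    then show "l x = i" using l[of x] Least_le[of "\<lambda>i. i < n \<and> x \<in> V (f i)" i] unfolding l_def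
      by (metis (no_types, lifting) le_neq_implies_less)
  qed
  have lset: "{x. l x = i} \<in> sets borel" for i
  proof (cases "i < n")
    case True
    have "{x. l x = i} = V (f i) - (\<Union>j<i. V (f j))" using True by (auto simp: leq)
    then show ?thesis using V(2) by (auto intro!: sets.Diff sets.countable_UN'' borel_open)
  next
    case False
    then have "{x. l x = i} = {}" by (auto simp: leq)
    then show ?thesis by simp
  qed
  show ?thesis
  proof
    have "range p \<subseteq> T" using l by (auto simp: p_def f)
    then show "finite (range p)" using T(1) finite_subset by blast
    show "p -` {a} \<in> sets borel" for a
    proof -
      have "p -` {a} = (\<Union>i\<in>{i. i < n \<and> f i = a}. {x. l x = i})" using l by (auto simp: p_def)
      then show ?thesis using lset by (auto intro!: sets.finite_UN)
    qed
    show "norm (F (x, y) - F (p x, y)) \<le> e" for x y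
      using V(3)[OF l(2)[of x], of y] by (simp add: p_def dist_norm)
  qed
qed

lemma cont_I:
  fixes F :: "'x \<times> 'x \<Rightarrow> complex"
  assumes F: "continuous_on UNIV F"
  shows "cont (\<lambda>x. I (\<lambda>y. F (x, y)))"
proof -
  have c1: "cont (\<lambda>y. F (x, y))" for x by (rule continuous_on_compose2[OF F]) (auto intro!: continuous_intros)
  have "isCont (\<lambda>x. I (\<lambda>y. F (x, y))) x" for x
    unfolding isCont_def
  proof (rule tendstoI)
    fix e :: real assume e: "e > 0"
    then have e2: "e/2 > 0" by simp
    have "continuous_on (UNIV \<times> UNIV) F" using F by simp
    from continuous_on_prod_compactE[OF this comp UNIV_I e2, of x]
    obtain X0 where X0: "x \<in> X0" "open X0" "\<forall>z\<in>X0 \<inter> UNIV. \<forall>y\<in>UNIV. dist (F (z, y)) (F (x, y)) \<le> e/2" by metis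
    have "dist (I (\<lambda>y. F (z, y))) (I (\<lambda>y. F (x, y))) < e" if "z \<in> X0" for z
    proof -
      have "norm (I (\<lambda>y. F (z, y) - F (x, y))) \<le> e/2" using X0(3) that by (intro norm_I_le) (auto simp: dist_norm)
      then show ?thesis using e by (simp add: dist_norm cont_integrable c1)
    qed
    then show "\<forall>\<^sub>F z in at x. dist (I (\<lambda>y. F (z, y))) (I (\<lambda>y. F (x, y))) < e"
      unfolding eventually_at_topological using X0 by blast
  qed
  then show ?thesis by (simp add: continuous_at_imp_continuous_on)
qed

text \<open>For a function that is a step function in the first variable, exchanging the integrals
  is linearity of the integral over a finite sum. Uniform approximation does the rest, with no
  measurability on the product space.\<close>

lemma Fubini:
  fixes F :: "'x \<times> 'x \<Rightarrow> complex"
  assumes F: "continuous_on UNIV F"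
  shows "I (\<lambda>x. I (\<lambda>y. F (x, y))) = I (\<lambda>y. I (\<lambda>x. F (x, y)))"
proof -
  have c1: "cont (\<lambda>y. F (x, y))" for x by (rule continuous_on_compose2[OF F]) (auto intro!: continuous_intros)
  have c2: "cont (\<lambda>x. F (x, y))" for y by (rule continuous_on_compose2[OF F]) (auto intro!: continuous_intros)
  have Fs: "continuous_on UNIV (\<lambda>(y, x). F (x, y))"
    unfolding case_prod_beta by (rule continuous_on_compose2[OF F]) (auto intro!: continuous_intros)
  have cx: "cont (\<lambda>x. I (\<lambda>y. F (x, y)))" by (rule cont_I[OF F])
  have cy: "cont (\<lambda>y. I (\<lambda>x. F (x, y)))" using cont_I[OF Fs] by simp
  have "dist (I (\<lambda>x. I (\<lambda>y. F (x, y)))) (I (\<lambda>y. I (\<lambda>x. F (x, y)))) \<le> 2 * e" if e: "e > 0" for e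
  proof -
    obtain p where p: "finite (range p)" "\<And>a. p -` {a} \<in> sets borel" "\<And>x y. norm (F (x, y) - F (p x, y)) \<le> e"
      using approx_partition[OF F e] by blast
    define w where "w = (\<lambda>a. measure M (p -` {a}))"
    define S where "S = (\<Sum>a\<in>range p. w a *\<^sub>R I (\<lambda>y. F (a, y)))"
    have 1: "norm (I (\<lambda>x. I (\<lambda>y. F (x, y))) - S) \<le> e"
    proof -
      have "S = I (\<lambda>x. I (\<lambda>y. F (p x, y)))"
        using I_step(2)[OF p(1,2), of "\<lambda>a. I (\<lambda>y. F (a, y))"] by (simp add: S_def w_def)
      then have "I (\<lambda>x. I (\<lambda>y. F (x, y))) - S = I (\<lambda>x. I (\<lambda>y. F (x, y)) - I (\<lambda>y. F (p x, y)))"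
        using cont_integrable[OF cx] I_step(1)[OF p(1,2), of "\<lambda>a. I (\<lambda>y. F (a, y))"] by simp
      also have "\<dots> = I (\<lambda>x. I (\<lambda>y. F (x, y) - F (p x, y)))" by (simp add: cont_integrable c1)
      also have "norm \<dots> \<le> e" by (intro norm_I_le p(3))
      finally show ?thesis .
    qed
    have 2: "norm (I (\<lambda>y. I (\<lambda>x. F (x, y))) - S) \<le> e"
    proof -
      have "S = I (\<lambda>y. \<Sum>a\<in>range p. w a *\<^sub>R F (a, y))"
        unfolding S_def by (subst Bochner_Integration.integral_sum) (auto simp: cont_integrable c1)
      also have "\<dots> = I (\<lambda>y. I (\<lambda>x. F (p x, y)))"
        using I_step(2)[OF p(1,2), of "\<lambda>a. F (a, y)" for y] by (simp add: w_def)
      finally have S: "S = I (\<lambda>y. I (\<lambda>x. F (p x, y)))" .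
      have int: "integrable M (\<lambda>y. I (\<lambda>x. F (p x, y)))"
        unfolding I_step(2)[OF p(1,2), of "\<lambda>a. F (a, _)"] by (intro Bochner_Integration.integrable_sum integrable_scaleR_right cont_integrable c1)
      have "I (\<lambda>y. I (\<lambda>x. F (x, y))) - S = I (\<lambda>y. I (\<lambda>x. F (x, y)) - I (\<lambda>x. F (p x, y)))"
        unfolding S using cont_integrable[OF cy] int by simp
      also have "\<dots> = I (\<lambda>y. I (\<lambda>x. F (x, y) - F (p x, y)))"
        using I_step(1)[OF p(1,2), of "\<lambda>a. F (a, _)"] by (simp add: cont_integrable c2)
      also have "norm \<dots> \<le> e" by (intro norm_I_le p(3))
      finally show ?thesis .
    qed
    show ?thesis using 1 2 norm_triangle_ineq4[of "I (\<lambda>x. I (\<lambda>y. F (x, y))) - S" "I (\<lambda>y. I (\<lambda>x. F (x, y))) - S"]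
      by (simp add: dist_norm)
  qed
  then have "dist (I (\<lambda>x. I (\<lambda>y. F (x, y)))) (I (\<lambda>y. I (\<lambda>x. F (x, y)))) \<le> 0 + e" if "e > 0" for e
    using that by (metis add_0 half_gt_zero mult_2 field_sum_of_halves)
  then have "dist (I (\<lambda>x. I (\<lambda>y. F (x, y)))) (I (\<lambda>y. I (\<lambda>x. F (x, y)))) \<le> 0"
    by (rule field_le_epsilon)
  then show ?thesis by simp
qed

text \<open>Integrating \<open>h (x - y)\<close> first over \<open>x\<close> gives the integral of
  \<open>h\<close>, and first over \<open>y\<close> that of its reflection. So no uniqueness of Haar
  measure is involved.\<close>

lemma I_reflect:
  assumes "cont h"
  shows "I (\<lambda>x. h (- x)) = I h" "I (\<lambda>x. h (a - x)) = I h"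
proof -
  have cm: "cont (\<lambda>x. h (- x))" by (rule continuous_on_compose2[OF assms]) (auto intro!: continuous_intros)
  have cF: "continuous_on UNIV (\<lambda>(x, y). h (x - y))"
    unfolding case_prod_beta by (rule continuous_on_compose2[OF assms]) (auto intro!: continuous_intros)
  have "I (\<lambda>x. I (\<lambda>y. h (x - y))) = I (\<lambda>y. I (\<lambda>x. h (x - y)))" using Fubini[OF cF] by simp
  moreover have "I (\<lambda>x. h (x - y)) = I h" for y by (rule I_translate'(2)[OF assms])
  moreover have "I (\<lambda>y. h (x - y)) = I (\<lambda>x. h (- x))" for x
    using I_translate'(2)[OF cm, of x] by simp
  ultimately show 1: "I (\<lambda>x. h (- x)) = I h" by (simp add: prob_space)
  have ca: "cont (\<lambda>x. h (a + x))" by (rule continuous_on_compose2[OF assms]) (auto intro!: continuous_intros)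
  show "I (\<lambda>x. h (a - x)) = I h"
    using I_translate'(2)[OF cm, of a] 1 by simp
qed
end

section \<open>The convolution algebra\<close>

context compact_haar
begin

definition conv :: "('x \<Rightarrow> complex) \<Rightarrow> ('x \<Rightarrow> complex) \<Rightarrow> 'x \<Rightarrow> complex" where
  "conv f g x = I (\<lambda>y. f (x - y) * g y)"

definition star :: "('x \<Rightarrow> complex) \<Rightarrow> 'x \<Rightarrow> complex" where
  "star f x = cnj (f (- x))"

definition sqn :: "('x \<Rightarrow> complex) \<Rightarrow> real" where
  "sqn f = I (\<lambda>x. (norm (f x))\<^sup>2)"

lemma cont_comp: "cont f \<Longrightarrow> continuous_on S h \<Longrightarrow> continuous_on S (\<lambda>z. f (h z))"
  by (rule continuous_on_compose2[of UNIV f]) auto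

lemma cont_star:
  assumes "cont f" shows "cont (star f)"
  unfolding star_def by (intro continuous_on_cnj cont_comp[OF assms] continuous_intros)

lemma cont_conv_integrand:
  assumes "cont f" "cont g" shows "cont (\<lambda>y. f (x - y) * g y)"
  by (intro continuous_on_mult cont_comp[OF assms(1)] assms(2) continuous_intros)

lemma integrable_conv: "cont f \<Longrightarrow> cont g \<Longrightarrow> integrable M (\<lambda>y. f (x - y) * g y)"
  by (intro cont_integrable cont_conv_integrand)

lemma cont_conv:
  assumes "cont f" "cont g"
  shows "cont (conv f g)"
proof -
  have "continuous_on UNIV (\<lambda>p. f (fst p - snd p) * g (snd p))"
    by (intro continuous_on_mult cont_comp[OF assms(1)] cont_comp[OF assms(2)] continuous_intros)
  from cont_I[OF this] show ?thesis by (simp add: conv_def[abs_def])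
qed

lemma conv_commute:
  assumes "cont f" "cont g"
  shows "conv f g = conv g f"
proof
  fix x
  have "conv f g x = I (\<lambda>y. f (x - (x - y)) * g (x - y))"
    using I_reflect(2)[OF cont_conv_integrand[OF assms, of x], of x] by (simp add: conv_def)
  then show "conv f g x = conv g f x" by (simp add: conv_def mult.commute)
qed

lemma conv_assoc:
  assumes "cont f" "cont g" "cont h"
  shows "conv (conv f g) h = conv f (conv g h)"
proof
  fix x
  have F: "continuous_on UNIV (\<lambda>p. f (x - fst p) * g (fst p - snd p) * h (snd p))"
    by (intro continuous_on_mult cont_comp[OF assms(1)] cont_comp[OF assms(2)] cont_comp[OF assms(3)] continuous_intros)
  have cfg: "cont (\<lambda>z. f (x - y - z) * g z)" for y by (rule cont_conv_integrand[OF assms(1,2)])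
  have "conv f (conv g h) x = I (\<lambda>w. I (\<lambda>y. f (x - w) * g (w - y) * h y))"
    by (simp add: conv_def mult.assoc)
  also have "\<dots> = I (\<lambda>y. I (\<lambda>w. f (x - w) * g (w - y) * h y))" using Fubini[OF F] by simp
  also have "\<dots> = I (\<lambda>y. I (\<lambda>w. f (x - w) * g (w - y)) * h y)" by simp
  also have "\<dots> = I (\<lambda>y. I (\<lambda>z. f (x - y - z) * g z) * h y)"
  proof -
    have "I (\<lambda>w. f (x - w) * g (w - y)) = I (\<lambda>z. f (x - y - z) * g z)" for y
      using I_translate'(2)[OF cfg[of y], of y] by simp
    then show ?thesis by simp
  qed
  also have "\<dots> = conv (conv f g) h x" by (simp add: conv_def)
  finally show "conv (conv f g) h x = conv f (conv g h) x" by simp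
qed

lemma conv_add: "cont f \<Longrightarrow> cont g \<Longrightarrow> cont h \<Longrightarrow> conv f (\<lambda>x. g x + h x) = (\<lambda>x. conv f g x + conv f h x)"
  by (rule ext) (simp add: conv_def distrib_left integrable_conv)

lemma conv_diff: "cont f \<Longrightarrow> cont g \<Longrightarrow> cont h \<Longrightarrow> conv f (\<lambda>x. g x - h x) = (\<lambda>x. conv f g x - conv f h x)"
  by (rule ext) (simp add: conv_def right_diff_distrib integrable_conv)

lemma conv_scale: "conv f (\<lambda>x. c * g x) = (\<lambda>x. c * conv f g x)"
  by (rule ext) (simp add: conv_def mult.left_commute)

lemma star_conv:
  assumes "cont f" "cont g"
  shows "star (conv f g) = conv (star f) (star g)"
proof
  fix x
  have "star (conv f g) x = I (\<lambda>y. cnj (f (- x - y)) * cnj (g y))"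
  proof -
    have "cnj (I (\<lambda>y. f (- x - y) * g y)) = I (\<lambda>y. cnj (f (- x - y) * g y))" by (rule Bochner_Integration.integral_cnj[symmetric])
    then show ?thesis by (simp add: star_def conv_def)
  qed
  also have "\<dots> = I (\<lambda>y. cnj (f (- x - - y)) * cnj (g (- y)))"
    by (rule I_reflect(1)[symmetric]) (intro continuous_on_mult continuous_on_cnj cont_comp[OF assms(1)] cont_comp[OF assms(2)] continuous_intros)
  finally show "star (conv f g) x = conv (star f) (star g) x" by (simp add: star_def conv_def)
qed

lemma star_scale: "star (\<lambda>x. c * f x) = (\<lambda>x. cnj c * star f x)"
  by (simp add: star_def fun_eq_iff)

lemma I_of_real: "I (\<lambda>x. complex_of_real (h x)) = of_real (I h)"
  by (rule integral_bounded_linear'[OF bounded_linear_of_real bounded_linear_Re]) simp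

lemma conv_star_0: "conv (star f) f 0 = of_real (sqn f)"
proof -
  have "conv (star f) f 0 = I (\<lambda>y. of_real ((norm (f y))\<^sup>2))"
    by (simp only: conv_def star_def complex_norm_square mult.commute diff_0 minus_minus)
  then show ?thesis by (simp only: sqn_def I_of_real)
qed

lemma sqn_nonneg: "sqn f \<ge> 0"
  unfolding sqn_def by (rule integral_nonneg_AE) simp

lemma cont_sq: "cont f \<Longrightarrow> continuous_on UNIV (\<lambda>x. (norm (f x))\<^sup>2)"
  by (intro continuous_intros)

lemma sqn_pos:
  assumes f: "cont f" and x: "f x \<noteq> 0"
  shows "sqn f > 0"
proof -
  define c where "c = (norm (f x))\<^sup>2 / 2"
  have c: "c > 0" "c < (norm (f x))\<^sup>2" using x by (auto simp: c_def)
  define U where "U = {z. c < (norm (f z))\<^sup>2}"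
  have U: "open U" unfolding U_def by (intro open_Collect_less cont_sq f continuous_intros)
  have "x \<in> U" using c by (simp add: U_def)
  then have m: "measure M U > 0" using open_pos U by blast
  have Us: "U \<in> sets M" using U by (simp add: sets_M)
  have "c * measure M U = I (\<lambda>z. c * indicator U z)" using Us by (simp add: emeasure_eq_measure)
  also have "\<dots> \<le> sqn f" unfolding sqn_def
  proof (rule integral_mono)
    show "integrable M (\<lambda>z. c * indicator U z)" using Us by (intro integrable_mult_right) (simp add: emeasure_eq_measure)
    show "integrable M (\<lambda>x. (norm (f x))\<^sup>2)" by (intro cont_integrable cont_sq f)
    show "c * indicator U z \<le> (norm (f z))\<^sup>2" for z by (auto simp: U_def indicator_def)
  qed
  finally show ?thesis using m c by (meson mult_pos_pos less_le_trans)
qed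

lemma sqn_le:
  assumes "\<And>x. norm (f x) \<le> B"
  shows "sqn f \<le> B\<^sup>2"
proof -
  have "norm (sqn f) \<le> B\<^sup>2" unfolding sqn_def using assms by (intro norm_I_le) (simp add: power_mono)
  then show ?thesis by simp
qed

text \<open>Cauchy-Schwarz, from the nonnegativity of a quadratic form. The bound is uniform in
  \<open>x\<close>, which lets convolution turn convergence in mean square into uniform convergence;
  this stands in for compactness of the operator.\<close>

lemma norm_conv_le:
  assumes f: "cont f" and g: "cont g"
  shows "norm (conv f g x) \<le> sqrt (sqn f) * sqrt (sqn g)"
proof -
  define a where "a = (\<lambda>y. norm (f (x - y)))"
  define b where "b = (\<lambda>y. norm (g y))"
  have ca: "continuous_on UNIV a" unfolding a_def by (intro continuous_on_norm cont_comp[OF f] continuous_intros)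
  have cb: "continuous_on UNIV b" unfolding b_def by (intro continuous_on_norm g)
  have A: "I (\<lambda>y. (a y)\<^sup>2) = sqn f"
  proof -
    have c: "cont (\<lambda>y. of_real ((norm (f y))\<^sup>2))" by (intro continuous_on_of_real cont_sq f)
    have "complex_of_real (I (\<lambda>y. (a y)\<^sup>2)) = of_real (sqn f)"
      using I_reflect(2)[OF c, of x] unfolding a_def sqn_def by (simp only: I_of_real)
    then show ?thesis by (simp only: of_real_eq_iff)
  qed
  have B: "I (\<lambda>y. (b y)\<^sup>2) = sqn g" by (simp add: b_def sqn_def)
  define T where "T = I (\<lambda>y. a y * b y)"
  have T0: "T \<ge> 0" unfolding T_def by (rule integral_nonneg_AE) (simp add: a_def b_def)
  have le: "norm (conv f g x) \<le> T"
    unfolding conv_def T_def a_def b_def using integral_norm_bound[of M "\<lambda>y. f (x - y) * g y"] by (simp add: norm_mult)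
  have q: "0 \<le> s\<^sup>2 * sqn f - 2 * s * r * T + r\<^sup>2 * sqn g" for s r :: real
  proof -
    have i1: "integrable M (\<lambda>y. (a y)\<^sup>2)" "integrable M (\<lambda>y. (b y)\<^sup>2)" "integrable M (\<lambda>y. a y * b y)"
      using ca cb by (auto intro!: cont_integrable continuous_intros)
    have "0 \<le> I (\<lambda>y. (s * a y - r * b y)\<^sup>2)" by (rule integral_nonneg_AE) simp
    also have "(\<lambda>y. (s * a y - r * b y)\<^sup>2) = (\<lambda>y. s\<^sup>2 * (a y)\<^sup>2 - 2 * s * r * (a y * b y) + r\<^sup>2 * (b y)\<^sup>2)"
      by (rule ext) (simp add: power2_eq_square algebra_simps)
    also have "I \<dots> = s\<^sup>2 * sqn f - 2 * s * r * T + r\<^sup>2 * sqn g" using i1 by (simp add: A B T_def)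
    finally show ?thesis .
  qed
  have "T\<^sup>2 \<le> sqn f * sqn g"
  proof (cases "sqn g = 0")
    case True
    then have "g y = 0" for y using sqn_pos[OF g] by (metis less_irrefl)
    then have "T = 0" by (simp add: T_def b_def)
    then show ?thesis using True by simp
  next
    case False
    then have g0: "sqn g > 0" using sqn_nonneg[of g] by simp
    have "0 \<le> sqn g * (sqn g * sqn f - T\<^sup>2)" using q[of "sqn g" T] by (simp add: power2_eq_square algebra_simps)
    then show ?thesis using g0 by (simp add: zero_le_mult_iff mult.commute)
  qed
  then have "T \<le> sqrt (sqn f * sqn g)" using T0 by (simp add: real_le_rsqrt)
  then show ?thesis using le by (simp add: real_sqrt_mult)
qed

definition herm :: "('x \<Rightarrow> complex) \<Rightarrow> bool" where "herm f \<longleftrightarrow> cont f \<and> star f = f"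

lemma herm_cont: "herm f \<Longrightarrow> cont f" by (simp add: herm_def)

lemma herm_conv: "herm f \<Longrightarrow> herm g \<Longrightarrow> herm (conv f g)"
  by (simp add: herm_def star_conv cont_conv)

lemma herm_conv_0: "herm f \<Longrightarrow> conv f f 0 = of_real (sqn f)"
  using conv_star_0[of f] by (simp add: herm_def)

text \<open>Without a unit for convolution, counting starts at \<open>k\<close> itself:
  \<open>cpow k n\<close> is the power with \<open>n + 1\<close> factors.\<close>

fun cpow :: "('x \<Rightarrow> complex) \<Rightarrow> nat \<Rightarrow> 'x \<Rightarrow> complex" where
  "cpow k 0 = k" | "cpow k (Suc n) = conv k (cpow k n)"

lemma herm_cpow: "herm k \<Longrightarrow> herm (cpow k n)"
  by (induction n) (auto intro: herm_conv)

lemma cpow_add: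
  assumes "herm k"
  shows "conv (cpow k m) (cpow k n) = cpow k (m + n + 1)"
proof (induction m)
  case (Suc m)
  have "conv (conv k (cpow k m)) (cpow k n) = conv k (conv (cpow k m) (cpow k n))"
    by (intro conv_assoc herm_cont herm_cpow assms)
  then show ?case using Suc by simp
qed simp

text \<open>Power iteration for the compact self-adjoint operator of convolution with \<open>k\<close>: the even powers of \<open>k\<close>,
  rescaled by the limiting ratio \<open>lam\<close> of their norms, converge to the projection onto the leading eigenspace.\<close>

lemma idempotent_limit:
  assumes k: "herm k" and k0: "k x0 \<noteq> 0"
  shows "\<exists>p lam t. herm p \<and> conv p p = p \<and> lam > 0 \<and> t \<ge> 1 \<and> p 0 = of_real t \<and>
     conv (conv k k) p = (\<lambda>x. of_real lam * p x) \<and> (\<forall>q. cont q \<longrightarrow> conv q k = k \<longrightarrow> conv q p = p)"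
proof -
  define P where "P = cpow k"
  have hP: "herm (P n)" for n using herm_cpow[OF k] by (simp add: P_def)
  have cP: "cont (P n)" for n using hP herm_cont by blast
  have PP: "conv (P m) (P n) = P (m + n + 1)" for m n using cpow_add[OF k] by (simp add: P_def)
  define a where "a = (\<lambda>n. sqn (P n))"
  have a_eq: "P (2 * n + 1) 0 = of_real (a n)" for n
    using herm_conv_0[OF hP[of n]] PP[of n n] by (simp add: a_def mult_2)
  \<comment> \<open>Cauchy-Schwarz makes the squared norms logarithmically convex, so their
    successive ratios increase.\<close>
  have logconv: "(a (Suc n))\<^sup>2 \<le> a n * a (Suc (Suc n))" for n
  proof -
    have "a (Suc n) = norm (conv (P n) (P (Suc (Suc n))) 0)"
    proof -
      have "n + Suc (Suc n) + 1 = 2 * Suc n + 1" by simp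
      then have "conv (P n) (P (Suc (Suc n))) 0 = of_real (a (Suc n))" using a_eq[of "Suc n"] by (simp only: PP)
      then show ?thesis using sqn_nonneg[of "P (Suc n)"] by (simp add: a_def)
    qed
    also have "\<dots> \<le> sqrt (a n) * sqrt (a (Suc (Suc n)))"
      unfolding a_def by (rule norm_conv_le[OF cP cP])
    finally have "(a (Suc n))\<^sup>2 \<le> (sqrt (a n) * sqrt (a (Suc (Suc n))))\<^sup>2"
      using sqn_nonneg by (intro power_mono) (auto simp: a_def)
    then show ?thesis using sqn_nonneg by (simp add: power_mult_distrib a_def)
  qed
  have a0: "a 0 > 0" unfolding a_def P_def using sqn_pos[OF herm_cont[OF k] k0] by simp
  have "P 1 0 = of_real (a 0)" using a_eq[of 0] by simp
  then have "P 1 0 \<noteq> 0" using a0 by simp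
  from sqn_pos[OF cP this] have a1: "a (Suc 0) > 0" by (simp add: a_def)
  have apos: "a n > 0 \<and> a (Suc n) > 0" for n
  proof (induction n)
    case (Suc n)
    then have "a n * a (Suc (Suc n)) > 0" using logconv[of n] by (meson less_le_trans zero_less_power)
    then show ?case using Suc by (simp add: zero_less_mult_iff)
  qed (use a0 a1 in auto)
  have Psup: "norm (P (2 * n + 1) x) \<le> a n" for n x
    using norm_conv_le[OF cP[of n] cP[of n], of x] sqn_nonneg[of "P n"] by (simp add: PP a_def mult_2)
  \<comment> \<open>Submultiplicativity bounds these ratios from above, and below it yields
    \<open>lam ^ Suc n \<le> a n\<close>, which prevents the rescaled powers from tending to
    0.\<close>
  have submult: "a (n + m + 1) \<le> a n * a m" for n m
  proof -
    have "a (n + m + 1) = norm (conv (P (2 * n + 1)) (P (2 * m + 1)) 0)"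
    proof -
      have "2 * n + 1 + (2 * m + 1) + 1 = 2 * (n + m + 1) + 1" by simp
      then have "conv (P (2 * n + 1)) (P (2 * m + 1)) 0 = of_real (a (n + m + 1))" using a_eq[of "n + m + 1"] by (simp only: PP)
      then show ?thesis using sqn_nonneg[of "P (n + m + 1)"] by (simp add: a_def)
    qed
    also have "\<dots> \<le> a n * a m" unfolding conv_def
    proof (rule norm_I_le)
      fix x
      show "norm (P (2 * n + 1) (0 - x) * P (2 * m + 1) x) \<le> a n * a m"
        unfolding norm_mult using apos[of n] by (intro mult_mono Psup) auto
    qed
    finally show ?thesis .
  qed
  define q where "q = (\<lambda>n. a (Suc n) / a n)"
  have qinc: "incseq q"
  proof (rule incseq_SucI)
    fix n show "q n \<le> q (Suc n)" using logconv[of n] apos[of n] apos[of "Suc n"]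
      by (simp add: q_def field_simps power2_eq_square)
  qed
  have qbd: "q n \<le> a 0" for n
    using submult[of 0 n] apos[of n] by (simp add: q_def field_simps)
  obtain lam where lam: "q \<longlonglongrightarrow> lam" "\<And>n. q n \<le> lam" using incseq_convergent[OF qinc, of "a 0"] qbd by blast
  have lam0: "lam > 0" using lam(2)[of 0] apos[of 0] by (simp add: q_def) (meson divide_pos_pos less_le_trans)
  have astep: "a (Suc n) \<le> lam * a n" for n using lam(2)[of n] apos[of n] by (simp add: q_def field_simps)
  have "(q m) ^ Suc n \<le> a n" for m n
  proof -
    have "a m * (q m) ^ j \<le> a (m + j)" for j
    proof (induction j)
      case (Suc j)
      have "a m * (q m) ^ Suc j = (a m * q m ^ j) * q m" by simp
      also have "\<dots> \<le> a (m + j) * q (m + j)"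
        using Suc qinc apos by (intro mult_mono) (auto simp: incseq_def q_def less_imp_le)
      also have "\<dots> = a (m + Suc j)" using apos[of "m + j"] by (simp add: q_def)
      finally show ?case .
    qed simp
    from this[of "Suc n"] submult[of m n] have "a m * (q m) ^ Suc n \<le> a m * a n" by simp
    then show ?thesis using apos[of m] by (simp only: mult_le_cancel_left_pos)
  qed
  then have lam_le: "lam ^ Suc n \<le> a n" for n
    by (intro LIMSEQ_le_const2[OF tendsto_power[OF lam(1)]]) auto
  define t where "t = (\<lambda>n. a n / lam ^ Suc n)"
  have t1: "1 \<le> t n" for n using lam_le[of n] lam0 by (simp add: t_def)
  have "decseq t"
  proof (rule decseq_SucI)
    fix n show "t (Suc n) \<le> t n" using astep[of n] lam0 by (simp add: t_def field_simps)
  qed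
  then obtain tt where tt: "t \<longlonglongrightarrow> tt" using decseq_convergent[of t 1] t1 by blast
  have tt1: "tt \<ge> 1" using t1 by (intro LIMSEQ_le_const[OF tt]) auto
  \<comment> \<open>This is the power with \<open>n + 1\<close> factors of \<open>conv k k\<close>
    divided by \<open>lam\<close>, so products of such functions only add up the indices.\<close>
  define f where "f = (\<lambda>n x. of_real (inverse (lam ^ Suc n)) * P (2 * n + 1) x)"
  have cf: "cont (f n)" for n unfolding f_def by (intro continuous_intros cP)
  have hf: "herm (f n)" for n using hP[of "2*n+1"] cf[of n] by (simp add: herm_def f_def star_scale)
  have cross: "conv (f m) (f n) = (\<lambda>x. of_real (inverse (lam ^ Suc (m + n + 1))) * P (2 * (m + n + 1) + 1) x)" for m n
  proof -
    have sc: "conv (\<lambda>x. c * P i x) (\<lambda>x. d * P j x) = (\<lambda>x. c * d * P (i + j + 1) x)" for c d i j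
    proof -
      have c: "cont (\<lambda>x. c * P i x)" by (intro continuous_intros cP)
      have "conv (\<lambda>x. c * P i x) (\<lambda>x. d * P j x) = (\<lambda>x. d * conv (\<lambda>x. c * P i x) (P j) x)" by (rule conv_scale)
      also have "conv (\<lambda>x. c * P i x) (P j) = conv (P j) (\<lambda>x. c * P i x)" by (rule conv_commute[OF c cP])
      also have "\<dots> = (\<lambda>x. c * conv (P j) (P i) x)" by (rule conv_scale)
      finally show ?thesis by (simp add: PP add.commute mult_ac)
    qed
    show ?thesis unfolding f_def sc by (simp add: power_add algebra_simps)
  qed
  have cross': "conv (f m) (f n) = f (m + n + 1)" for m n unfolding cross by (simp add: f_def)
  have f0: "f n 0 = of_real (t n)" for n by (simp only: f_def a_eq) (simp add: t_def divide_inverse mult.commute)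
  \<comment> \<open>Expanding the product of the difference with itself at 0 leaves values of the
    convergent sequence \<open>t\<close> only, so \<open>f\<close> is Cauchy in mean square.\<close>
  have sqd: "sqn (\<lambda>x. f n x - f m x) = t (2 * n + 1) - 2 * t (n + m + 1) + t (2 * m + 1)" for n m
  proof -
    define d where "d = (\<lambda>x. f n x - f m x)"
    have cd: "cont d" unfolding d_def by (intro continuous_intros cf)
    have "herm d" using hf[of n] hf[of m] cd by (simp add: herm_def d_def star_def fun_eq_iff)
    have dj: "conv d (f j) = (\<lambda>x. conv (f j) (f n) x - conv (f j) (f m) x)" for j
    proof -
      have "conv d (f j) = conv (f j) d" by (rule conv_commute[OF cd cf])
      also have "\<dots> = (\<lambda>x. conv (f j) (f n) x - conv (f j) (f m) x)" unfolding d_def by (rule conv_diff[OF cf cf cf])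
      finally show ?thesis .
    qed
    have "of_real (sqn d) = conv d d 0" using herm_conv_0[OF \<open>herm d\<close>] by simp
    also have "conv d d = (\<lambda>x. conv d (f n) x - conv d (f m) x)"
      using conv_diff[OF cd cf[of n] cf[of m]] by (simp only: d_def)
    also have "conv d (f n) = (\<lambda>x. conv (f n) (f n) x - conv (f n) (f m) x)" by (rule dj)
    also have "conv d (f m) = (\<lambda>x. conv (f m) (f n) x - conv (f m) (f m) x)" by (rule dj)
    finally have "complex_of_real (sqn d) = f (n + n + 1) 0 - f (n + m + 1) 0 - (f (m + n + 1) 0 - f (m + m + 1) 0)"
      unfolding cross' .
    then have "complex_of_real (sqn d) = of_real (t (n + n + 1) - t (n + m + 1) - (t (m + n + 1) - t (m + m + 1)))"
      unfolding f0 by (simp only: of_real_diff)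
    then have E: "sqn d = t (n + n + 1) - t (n + m + 1) - (t (m + n + 1) - t (m + m + 1))" by (simp only: of_real_eq_iff)
    have "t (n + n + 1) = t (2 * n + 1)" "t (m + m + 1) = t (2 * m + 1)" "t (m + n + 1) = t (n + m + 1)"
      by (rule arg_cong[where f = t]; simp)+
    then show ?thesis using E unfolding d_def by linarith
  qed
  define B where "B = sqrt (sqn (P 1)) / lam + 1"
  have B: "B > 0" using lam0 sqn_nonneg[of "P 1"] by (simp add: B_def add_nonneg_pos)
  have fstep: "f (Suc n) = (\<lambda>x. of_real (inverse lam) * conv (P 1) (f n) x)" for n
  proof -
    have "1 + (2 * n + 1) + 1 = 2 * Suc n + 1" by simp
    then have "conv (P 1) (f n) = (\<lambda>x. of_real (inverse (lam ^ Suc n)) * P (2 * Suc n + 1) x)"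
      unfolding f_def conv_scale PP by (simp only:)
    then show ?thesis by (simp add: f_def fun_eq_iff)
  qed
  have supd: "norm (f (Suc n) x - f (Suc m) x) \<le> B * sqrt (sqn (\<lambda>x. f n x - f m x))" for n m x
  proof -
    define d where "d = (\<lambda>x. f n x - f m x)"
    have cd: "cont d" unfolding d_def by (intro continuous_intros cf)
    have "f (Suc n) x - f (Suc m) x = of_real (inverse lam) * conv (P 1) d x"
      unfolding fstep d_def conv_diff[OF cP cf cf] by (simp add: algebra_simps)
    then have "norm (f (Suc n) x - f (Suc m) x) = inverse lam * norm (conv (P 1) d x)"
      using lam0 by (simp add: norm_mult norm_inverse)
    also have "\<dots> \<le> inverse lam * (sqrt (sqn (P 1)) * sqrt (sqn d))"
      using lam0 norm_conv_le[OF cP cd] by (intro mult_left_mono) auto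
    also have "\<dots> \<le> B * sqrt (sqn d)" using sqn_nonneg[of d] by (simp add: B_def field_simps)
    finally show ?thesis by (simp add: d_def)
  qed
  have "uniformly_Cauchy_on UNIV f"
  proof (rule uniformly_Cauchy_onI)
    fix e :: real assume e: "e > 0"
    define e' where "e' = (e / B)\<^sup>2 / 4"
    have e': "e' > 0" using e B by (simp add: e'_def)
    obtain N where N: "\<And>n. n \<ge> N \<Longrightarrow> \<bar>t n - tt\<bar> < e'" using LIMSEQ_D[OF tt e'] by auto
    have "dist (f m x) (f n x) < e" if mn: "m \<ge> Suc N" "n \<ge> Suc N" for m n x
    proof -
      define m' n' where "m' = m - 1" and "n' = n - 1"
      have m': "m = Suc m'" "n = Suc n'" "m' \<ge> N" "n' \<ge> N" using mn by (auto simp: m'_def n'_def)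
      have "sqn (\<lambda>x. f m' x - f n' x) < 4 * e'"
        using N[of "2*m'+1"] N[of "m'+n'+1"] N[of "2*n'+1"] m'(3,4) unfolding sqd by linarith
      also have "\<dots> = (e / B)\<^sup>2" by (simp add: e'_def)
      finally have "sqrt (sqn (\<lambda>x. f m' x - f n' x)) < e / B" using e B by (intro real_less_lsqrt) auto
      then have "B * sqrt (sqn (\<lambda>x. f m' x - f n' x)) < e" using B by (simp add: field_simps)
      then show ?thesis using supd[of m' x n'] by (simp add: m' dist_norm)
    qed
    then show "\<exists>M. \<forall>x\<in>UNIV. \<forall>m\<ge>M. \<forall>n\<ge>M. dist (f m x) (f n x) < e" by blast
  qed
  then obtain p where p: "uniform_limit UNIV f p sequentially"
    using Cauchy_uniformly_convergent unfolding uniformly_convergent_on_def by blast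
  have cp: "cont p" by (rule uniform_limit_theorem[OF _ p]) (use cf in auto)
  have plim: "(\<lambda>n. f n x) \<longlonglongrightarrow> p x" for x using tendsto_uniform_limitI[OF p] by simp
  have p0: "p 0 = of_real tt"
    using LIMSEQ_unique[OF plim[of 0]] tendsto_of_real[OF tt] by (simp add: f0)
  have hp: "herm p" unfolding herm_def
  proof (intro conjI cp ext)
    fix x
    have "(\<lambda>n. star (f n) x) \<longlonglongrightarrow> star p x" unfolding star_def by (intro tendsto_intros plim)
    moreover have "star (f n) x = f n x" for n using hf[of n] by (simp add: herm_def)
    ultimately show "star p x = p x" using LIMSEQ_unique[OF plim[of x]] by simp
  qed
  have clim: "(\<lambda>n. conv g (f n) x) \<longlonglongrightarrow> conv g p x" if g: "cont g" for g x
  proof -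
    obtain B where B: "B > 0" "\<And>x. norm (g x) \<le> B" using cont_bounded[OF g] by blast
    show ?thesis
    proof (rule LIMSEQ_I)
      fix e :: real assume e: "e > 0"
      have "\<forall>\<^sub>F n in sequentially. \<forall>x\<in>UNIV. dist (f n x) (p x) < e / (2 * B)"
        using p e B unfolding uniform_limit_iff by simp
      then obtain N where N: "\<And>n x. n \<ge> N \<Longrightarrow> dist (f n x) (p x) < e / (2 * B)"
        unfolding eventually_sequentially by blast
      have "norm (conv g (f n) x - conv g p x) < e" if "n \<ge> N" for n
      proof -
        have "conv g (f n) x - conv g p x = conv g (\<lambda>x. f n x - p x) x" using conv_diff[OF g cf cp] by simp
        also have "norm \<dots> \<le> B * (e / (2 * B))" unfolding conv_def
        proof (rule norm_I_le)
          fix y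
          have "norm (f n y - p y) \<le> e / (2 * B)" using N[OF that, of y] by (simp add: dist_norm)
          then show "norm (g (x - y) * (f n y - p y)) \<le> B * (e / (2 * B))"
            unfolding norm_mult using B by (intro mult_mono) auto
        qed
        also have "\<dots> < e" using e B by simp
        finally show ?thesis .
      qed
      then show "\<exists>no. \<forall>n\<ge>no. norm (conv g (f n) x - conv g p x) < e" by blast
    qed
  qed
  have fp: "conv (f m) p = p" for m
  proof
    fix x
    have "(\<lambda>n. f (n + (m + 1)) x) \<longlonglongrightarrow> p x" by (rule LIMSEQ_ignore_initial_segment[OF plim])
    moreover have "(\<lambda>n. f (n + (m + 1)) x) = (\<lambda>n. conv (f m) (f n) x)" by (simp add: cross' algebra_simps)
    ultimately show "conv (f m) p x = p x" using LIMSEQ_unique[OF clim[OF cf]] by simp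
  qed
  have "conv p p = p"
  proof
    fix x
    have "conv p (f n) = p" for n using fp[of n] conv_commute[OF cp cf] by simp
    then show "conv p p x = p x" using clim[OF cp, of x] LIMSEQ_unique[OF _ tendsto_const] by fastforce
  qed
  moreover have "conv (conv k k) p = (\<lambda>x. of_real lam * p x)"
  proof
    fix x
    have P1: "conv k k = P 1" by (simp add: P_def)
    have "conv (P 1) (f n) x = of_real lam * f (Suc n) x" for n using lam0 by (simp add: fstep)
    moreover have "(\<lambda>n. of_real lam * f (Suc n) x) \<longlonglongrightarrow> of_real lam * p x"
      by (intro tendsto_mult tendsto_const LIMSEQ_Suc plim)
    ultimately show "conv (conv k k) p x = of_real lam * p x" unfolding P1
      using LIMSEQ_unique[OF clim[OF cP[of 1], of x]] by simp
  qed
  moreover have "conv r p = p" if r: "cont r" "conv r k = k" for r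
  proof
    fix x
    have "conv r (P n) = P n" for n
    proof (induction n)
      case (Suc n)
      have "conv r (conv k (P n)) = conv (conv r k) (P n)" by (intro conv_assoc[symmetric] r cP herm_cont k)
      then show ?case using r(2) by (simp add: P_def)
    qed (use r in \<open>simp add: P_def\<close>)
    then have "conv r (f n) = f n" for n unfolding f_def conv_scale by simp
    then show "conv r p x = p x" using clim[OF r(1), of x] LIMSEQ_unique[OF plim[of x]] by simp
  qed
  ultimately show ?thesis using hp lam0 tt1 p0 by blast
qed
end

section \<open>Characters from minimal idempotents\<close>

definition is_char :: "('x::topological_ab_group_add \<Rightarrow> complex) \<Rightarrow> bool" where
  "is_char \<psi> \<longleftrightarrow> continuous_on UNIV \<psi> \<and> (\<forall>x y. \<psi> (x + y) = \<psi> x * \<psi> y) \<and> (\<forall>x. norm (\<psi> x) = 1)"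

lemma is_charD:
  assumes "is_char \<psi>"
  shows "continuous_on UNIV \<psi>" "\<psi> (x + y) = \<psi> x * \<psi> y" "norm (\<psi> x) = 1" "\<psi> 0 = 1" "\<psi> (- x) = cnj (\<psi> x)"
    "\<psi> (x - y) = \<psi> x * cnj (\<psi> y)" "\<psi> x * cnj (\<psi> x) = 1"
proof -
  have mult: "\<psi> (x + y) = \<psi> x * \<psi> y" and n: "norm (\<psi> x) = 1" for x y using assms by (auto simp: is_char_def)
  show "continuous_on UNIV \<psi>" using assms by (simp add: is_char_def)
  show "\<psi> (x + y) = \<psi> x * \<psi> y" "norm (\<psi> x) = 1" by (rule mult, rule n)
  have nz: "\<psi> x \<noteq> 0" for x using n[of x] by auto
  show 0: "\<psi> 0 = 1" using mult[of 0 0] nz[of 0] by simp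
  have c: "\<psi> x * cnj (\<psi> x) = 1" for x using complex_norm_square[of "\<psi> x"] n[of x] by simp
  show "\<psi> x * cnj (\<psi> x) = 1" by (rule c)
  have m: "\<psi> (- x) = cnj (\<psi> x)" for x
  proof -
    have "\<psi> x * \<psi> (- x) = \<psi> x * cnj (\<psi> x)" using mult[of x "- x"] 0 c[of x] by simp
    then show ?thesis using nz[of x] by simp
  qed
  show "\<psi> (- x) = cnj (\<psi> x)" by (rule m)
  show "\<psi> (x - y) = \<psi> x * cnj (\<psi> y)" using mult[of x "- y"] m[of y] by simp
qed

context compact_haar
begin

lemma star_add: "star (\<lambda>x. f x + g x) = (\<lambda>x. star f x + star g x)"
  by (simp add: star_def fun_eq_iff)

lemma star_diff: "star (\<lambda>x. f x - g x) = (\<lambda>x. star f x - star g x)"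
  by (simp add: star_def fun_eq_iff)

lemma herm_add: "herm f \<Longrightarrow> herm g \<Longrightarrow> herm (\<lambda>x. f x + g x)"
  unfolding herm_def star_add by (auto intro: continuous_intros)

lemma herm_diff: "herm f \<Longrightarrow> herm g \<Longrightarrow> herm (\<lambda>x. f x - g x)"
  unfolding herm_def star_diff by (auto intro: continuous_intros)

definition idem :: "('x \<Rightarrow> complex) \<Rightarrow> bool" where
  "idem p \<longleftrightarrow> herm p \<and> conv p p = p"

lemma idem_0: "idem p \<Longrightarrow> p 0 = of_real (sqn p)"
  unfolding idem_def using herm_conv_0 by metis

text \<open>From \<open>p = conv p p\<close> the supremum of \<open>p\<close> is at most
  \<open>sqn p\<close>, hence \<open>sqn p\<close> is at most its own square.\<close>

lemma idem_sqn_ge_1: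
  assumes p: "idem p" and x: "p x \<noteq> 0"
  shows "sqn p \<ge> 1"
proof -
  have c: "cont p" using p by (simp add: idem_def herm_def)
  have pos: "sqn p > 0" using sqn_pos[of p x] c x by blast
  have "norm (p z) \<le> sqn p" for z
    using norm_conv_le[OF c c, of z] p sqn_nonneg[of p] by (simp add: idem_def)
  then have "sqn p \<le> (sqn p)\<^sup>2" by (rule sqn_le)
  then show ?thesis using pos by (simp add: power2_eq_square)
qed

text \<open>Splitting an idempotent into \<open>q\<close> and \<open>p - q\<close> splits
  \<open>sqn\<close>, and each nonzero part has at least 1 of it. So the integer part of
  \<open>sqn\<close> drops with every proper splitting, and an idempotent where it is least is
  minimal.\<close>

lemma minimal_idempotent_exists:
  assumes p0: "idem p0" "p0 x0 \<noteq> 0"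
  obtains p where "idem p" "p 0 \<noteq> 0" "conv p0 p = p"
    "\<And>q z. \<lbrakk>idem q; q z \<noteq> 0; conv p q = q\<rbrakk> \<Longrightarrow> q = p"
proof -
  define S where "S = {p. idem p \<and> p \<noteq> (\<lambda>_. 0) \<and> conv p0 p = p}"
  have p0S: "p0 \<in> S" using p0 unfolding S_def idem_def by auto
  define m where "m = (\<lambda>p. nat \<lfloor>sqn p\<rfloor>)"
  define p where "p = arg_min m (\<lambda>p. p \<in> S)"
  have pS: "p \<in> S" and min: "\<And>q. q \<in> S \<Longrightarrow> m p \<le> m q"
    unfolding p_def using arg_min_natI[of "\<lambda>p. p \<in> S" p0 m] arg_min_nat_le[of "\<lambda>p. p \<in> S" _ m] p0S by blast+
  have p: "idem p" "p \<noteq> (\<lambda>_. 0)" "conv p0 p = p" using pS by (auto simp: S_def)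
  have cont_p: "cont p" "cont p0" using p(1) p0(1) by (auto simp: idem_def herm_def)
  have "p 0 \<noteq> 0"
  proof -
    obtain x where "p x \<noteq> 0" using p(2) by auto
    then show ?thesis using idem_0[OF p(1)] idem_sqn_ge_1[OF p(1)] by auto
  qed
  have uniq: "q = p" if q: "idem q" "q z \<noteq> 0" "conv p q = q" for q z
  proof (rule ccontr)
    assume ne: "q \<noteq> p"
    have cq: "cont q" using q by (simp add: idem_def herm_def)
    define d where "d = (\<lambda>x. p x - q x)"
    have cd: "cont d" unfolding d_def by (intro continuous_intros cont_p cq)
    have pp: "conv p p = p" "conv q q = q" using p(1) q(1) by (auto simp: idem_def)
    have pd: "conv p d = d" unfolding d_def using conv_diff[OF cont_p(1) cont_p(1) cq] pp q(3) by simp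
    have qd: "conv q d = (\<lambda>x. 0)"
      unfolding d_def using conv_diff[OF cq cont_p(1) cq] pp q(3) conv_commute[OF cq cont_p(1)] by simp
    have "conv d d = (\<lambda>x. conv d p x - conv d q x)" unfolding d_def by (rule conv_diff) (use cd cont_p cq in \<open>auto simp: d_def\<close>)
    then have "conv d d = d" using pd qd conv_commute[OF cd cont_p(1)] conv_commute[OF cd cq] by simp
    moreover have "herm d" unfolding d_def using p(1) q(1) by (intro herm_diff) (auto simp: idem_def)
    ultimately have d: "idem d" by (simp add: idem_def)
    obtain x where "d x \<noteq> 0" using ne unfolding d_def by (metis ext right_minus_eq)
    then have "sqn d \<ge> 1" using idem_sqn_ge_1[OF d] by blast
    moreover have "complex_of_real (sqn p) = of_real (sqn q + sqn d)"
      using idem_0[OF p(1)] idem_0[OF q(1)] idem_0[OF d] by (simp add: d_def algebra_simps)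
    then have "sqn p = sqn q + sqn d" by (simp only: of_real_eq_iff)
    ultimately have "sqn q + 1 \<le> sqn p" by simp
    then have "\<lfloor>sqn q\<rfloor> + 1 \<le> \<lfloor>sqn p\<rfloor>" by (metis floor_mono floor_add_int of_int_1)
    moreover have "\<lfloor>sqn q\<rfloor> \<ge> 0" using sqn_nonneg[of q] by simp
    ultimately have "m q < m p" using \<open>sqn q + 1 \<le> sqn p\<close> sqn_nonneg[of q] by (simp add: m_def)
    moreover have "conv p0 q = q"
    proof -
      have "conv p0 (conv p q) = conv (conv p0 p) q" by (intro conv_assoc[symmetric] cont_p cq)
      then show ?thesis using p(3) q(3) by simp
    qed
    then have "q \<in> S" using q by (auto simp: S_def)
    ultimately show False using min[of q] by simp
  qed
  show ?thesis by (rule that[OF p(1) \<open>p 0 \<noteq> 0\<close> p(3) uniq])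
qed

text \<open>For a hermitian \<open>h\<close> with \<open>conv p h = h\<close>, the leading spectral
  projection of \<open>h\<close> is an idempotent below \<open>p\<close>, hence \<open>p\<close>
  itself, and so \<open>conv h h\<close> is a multiple of \<open>p\<close>. Applying this to
  \<open>h\<close> and to \<open>h + p\<close> isolates \<open>h\<close>. A general \<open>f\<close>
  is a combination of two hermitian functions.\<close>

lemma minimal_idempotent_scalar:
  assumes p: "idem p" "p 0 \<noteq> 0" and min: "\<And>q z. \<lbrakk>idem q; q z \<noteq> 0; conv p q = q\<rbrakk> \<Longrightarrow> q = p"
    and f: "cont f"
  shows "\<exists>c. conv p f = (\<lambda>x. c * p x)"
proof -
  have hp: "herm p" "cont p" "conv p p = p" using p by (auto simp: idem_def herm_def)
  have sq: "\<exists>\<mu>. conv h h = (\<lambda>x. \<mu> * p x)" if h: "herm h" "conv p h = h" for h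
  proof (cases "\<exists>x. h x \<noteq> 0")
    case False
    then have "h = (\<lambda>x. 0)" by auto
    then show ?thesis by (intro exI[of _ 0]) (auto simp: conv_def)
  next
    case True
    then obtain x where x: "h x \<noteq> 0" by blast
    obtain p1 lam t where p1: "herm p1" "conv p1 p1 = p1" "t \<ge> 1" "p1 0 = complex_of_real t"
       "conv (conv h h) p1 = (\<lambda>x. of_real lam * p1 x)" "conv p h = h \<longrightarrow> conv p p1 = p1"
      using idempotent_limit[OF h(1) x] hp(2) by metis
    have eq: "p1 = p" using min[of p1 0] p1 h by (simp add: idem_def)
    have ch: "cont h" using h by (simp add: herm_def)
    have "conv (conv h h) p = conv h (conv h p)" by (intro conv_assoc ch hp)
    also have "conv h p = h" using conv_commute[OF ch hp(2)] h by simp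
    finally show ?thesis using p1(5) eq by auto
  qed
  have hermc: "\<exists>c. conv p h = (\<lambda>x. c * p x)" if h: "herm h" for h
  proof -
    have ch: "cont h" using h by (simp add: herm_def)
    define h' where "h' = conv p h"
    have h': "herm h'" unfolding h'_def by (intro herm_conv hp h)
    have ch': "cont h'" using h' by (simp add: herm_def)
    have ph': "conv p h' = h'"
      unfolding h'_def using conv_assoc[OF hp(2) hp(2) ch] hp(3) by simp
    obtain \<mu> where \<mu>: "conv h' h' = (\<lambda>x. \<mu> * p x)" using sq[OF h' ph'] by blast
    define k where "k = (\<lambda>x. h' x + p x)"
    have k: "herm k" "cont k" unfolding k_def using herm_add[OF h' hp(1)] by (auto simp: herm_def)
    have pk: "conv p k = k" unfolding k_def using conv_add[OF hp(2) ch' hp(2)] ph' hp(3) by simp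
    obtain \<nu> where \<nu>: "conv k k = (\<lambda>x. \<nu> * p x)" using sq[OF k(1) pk] by blast
    have "conv k k = (\<lambda>x. conv k h' x + conv k p x)"
      using conv_add[OF k(2) ch' hp(2)] by (simp add: k_def)
    also have "conv k h' = (\<lambda>x. conv h' h' x + conv h' p x)"
      using conv_add[OF ch' ch' hp(2)] conv_commute[OF k(2) ch'] by (simp add: k_def)
    also have "conv h' p = h'" using conv_commute[OF ch' hp(2)] ph' by simp
    also have "conv k p = k" using conv_commute[OF k(2) hp(2)] pk by simp
    finally have "conv k k = (\<lambda>x. conv h' h' x + h' x + k x)" .
    from fun_cong[OF this] have e: "\<nu> * p x = \<mu> * p x + h' x + (h' x + p x)" for x
      unfolding \<nu> \<mu> by (simp add: k_def)
    have "h' x = ((\<nu> - \<mu> - 1) / 2) * p x" for x using e[of x] by (simp add: field_simps)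
    then show ?thesis unfolding h'_def by (intro exI[of _ "(\<nu> - \<mu> - 1) / 2"]) (rule ext)
  qed
  have sst: "star (star f) = f" by (simp add: star_def fun_eq_iff)
  have cs: "cont (star f)" by (rule cont_star[OF f])
  define h1 where "h1 = (\<lambda>x. f x + star f x)"
  define h2 where "h2 = (\<lambda>x. \<i> * (f x - star f x))"
  have c12: "cont h1" "cont h2" unfolding h1_def h2_def by (intro continuous_intros f cs)+
  have "herm h1" using c12 unfolding herm_def h1_def star_add sst by (simp add: add.commute)
  moreover have "herm h2" using c12 unfolding herm_def h2_def star_scale star_diff sst by (simp add: algebra_simps)
  ultimately obtain c1 c2 where c: "conv p h1 = (\<lambda>x. c1 * p x)" "conv p h2 = (\<lambda>x. c2 * p x)" using hermc by metis
  have f12: "f = (\<lambda>x. (1/2) * (h1 x + (- \<i>) * h2 x))" by (simp add: h1_def h2_def fun_eq_iff algebra_simps)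
  have "conv p f = (\<lambda>x. (1/2) * conv p (\<lambda>x. h1 x + (- \<i>) * h2 x) x)" by (subst f12) (rule conv_scale)
  also have "conv p (\<lambda>x. h1 x + (- \<i>) * h2 x) = (\<lambda>x. conv p h1 x + conv p (\<lambda>x. (- \<i>) * h2 x) x)"
    by (intro conv_add hp c12 continuous_intros)
  also have "conv p (\<lambda>x. (- \<i>) * h2 x) = (\<lambda>x. (- \<i>) * conv p h2 x)" by (rule conv_scale)
  finally have "conv p f = (\<lambda>x. (1/2) * (c1 * p x + (- \<i>) * (c2 * p x)))" unfolding c .
  then show ?thesis by (intro exI[of _ "(c1 - \<i> * c2) / 2"]) (simp add: fun_eq_iff field_simps)
qed

text \<open>A minimal idempotent is a multiple of a character.\<close>

lemma character_in_spectrum: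
  assumes k: "herm k" "k x0 \<noteq> 0"
  obtains \<psi> z where "is_char \<psi>" "conv k \<psi> z \<noteq> 0"
proof -
  obtain p0 lam t where p0: "herm p0" "conv p0 p0 = p0" "lam > 0" "t \<ge> 1" "p0 0 = complex_of_real t"
     "conv (conv k k) p0 = (\<lambda>x. of_real lam * p0 x)"
    using idempotent_limit[OF k] by metis
  have "idem p0" "p0 0 \<noteq> 0" using p0 by (auto simp: idem_def)
  then obtain p where p: "idem p" "p 0 \<noteq> 0" "conv p0 p = p"
    and min: "\<And>q z. \<lbrakk>idem q; q z \<noteq> 0; conv p q = q\<rbrakk> \<Longrightarrow> q = p"
    using minimal_idempotent_exists by metis
  have cp: "cont p" "conv p p = p" "star p = p" and cp0: "cont p0" and ck: "cont k"
    using p p0 k by (auto simp: idem_def herm_def)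
  \<comment> \<open>A translate of \<open>p\<close> is again fixed by convolution with
    \<open>p\<close>, hence a multiple of \<open>p\<close>; evaluation at 0 determines the
    factor.\<close>
  have mult: "p (x + y) * p 0 = p x * p y" for x y
  proof -
    define f where "f = (\<lambda>z. p (z + x))"
    have cf: "cont f" unfolding f_def by (intro cont_comp[OF cp(1)] continuous_intros)
    obtain c where c: "conv p f = (\<lambda>y. c * p y)" using minimal_idempotent_scalar[OF p(1,2) _ cf] min by blast
    have "conv p f = f"
    proof
      fix y
      have "conv p f y = conv f p y" using conv_commute[OF cp(1) cf] by simp
      also have "\<dots> = conv p p (y + x)" by (simp add: conv_def f_def algebra_simps)
      finally show "conv p f y = f y" by (simp add: cp f_def)
    qed
    then have fy: "p (y + x) = c * p y" for y using c by (simp add: f_def fun_eq_iff)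
    show ?thesis using fy[of y] fy[of 0] by (simp add: add.commute)
  qed
  define \<psi> where "\<psi> = (\<lambda>x. p x / p 0)"
  have c\<psi>: "cont \<psi>" unfolding \<psi>_def using p(2) by (intro continuous_intros cp) auto
  have m\<psi>: "\<psi> (x + y) = \<psi> x * \<psi> y" for x y using mult[of x y] p(2) by (simp add: \<psi>_def field_simps)
  have real: "p 0 = of_real (sqn p)" using idem_0[OF p(1)] .
  have "norm (\<psi> x) = 1" for x
  proof -
    have "p (- x) = cnj (p x)" using cp(3) by (metis star_def complex_cnj_cnj)
    then have "\<psi> (- x) = cnj (\<psi> x)" by (auto simp: \<psi>_def real)
    moreover have "\<psi> (x + - x) = 1" using p(2) by (simp add: \<psi>_def)
    ultimately have "\<psi> x * cnj (\<psi> x) = 1" using m\<psi>[of x "- x"] by simp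
    then have "(norm (\<psi> x))\<^sup>2 = 1" by (metis complex_norm_square of_real_eq_1_iff)
    then show ?thesis by (simp add: power2_eq_1_iff) (smt (verit) norm_ge_zero)
  qed
  then have char: "is_char \<psi>" using c\<psi> m\<psi> by (simp add: is_char_def)
  \<comment> \<open>As \<open>p\<close> lies below the leading projection \<open>p0\<close> of
    \<open>k\<close>, convolving it twice with \<open>k\<close> multiplies it by \<open>lam\<close>,
    so \<open>conv k p\<close> cannot vanish.\<close>
  have "conv (conv k k) p = conv (conv k k) (conv p0 p)" using p(3) by simp
  also have "\<dots> = conv (conv (conv k k) p0) p" by (intro conv_assoc[symmetric] cont_conv ck cp0 cp)
  also have "\<dots> = conv p (\<lambda>x. of_real lam * p0 x)"
    unfolding p0(6) by (intro conv_commute cp continuous_intros cp0)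
  also have "\<dots> = (\<lambda>x. of_real lam * conv p p0 x)" by (rule conv_scale)
  also have "conv p p0 = p" using conv_commute[OF cp(1) cp0] p(3) by simp
  finally have "conv k (conv k p) 0 = of_real lam * p 0" using conv_assoc[OF ck ck cp(1)] by simp
  then have ne: "conv k (conv k p) 0 \<noteq> 0" using p0(3) p(2) by simp
  have "\<exists>z. conv k p z \<noteq> 0"
  proof (rule ccontr)
    assume "\<nexists>z. conv k p z \<noteq> 0"
    then have "conv k (conv k p) 0 = 0" by (simp add: conv_def[of k "conv k p"])
    with ne show False by simp
  qed
  then obtain z where z: "conv k p z \<noteq> 0" by blast
  have "conv k \<psi> z = inverse (p 0) * conv k p z"
  proof -
    have "\<psi> = (\<lambda>x. inverse (p 0) * p x)" by (simp add: \<psi>_def divide_inverse mult.commute)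
    then show ?thesis by (simp add: conv_scale)
  qed
  then have "conv k \<psi> z \<noteq> 0" using z p(2) by simp
  then show ?thesis using that char by blast
qed

lemma exists_separating_function:
  assumes "a \<noteq> (b::'x)"
  obtains f where "cont f" "f a = 0" "f b = 1"
proof -
  have norm: "normal_space (euclidean :: 'x topology)"
    using comp hausdorff
    by (intro compact_Hausdorff_or_regular_imp_normal_space) (auto simp: compact_space_def Hausdorff_space_def disjnt_def)
  obtain g where g: "continuous_map euclidean (top_of_set {0..1::real}) g" "g ` {a} \<subseteq> {0}" "g ` {b} \<subseteq> {1}"
    using Urysohn_lemma[OF norm, of "{a}" "{b}" 0 1] assms by (auto simp: disjnt_def)
  have "continuous_on UNIV g" using g(1) by (simp add: continuous_map_in_subtopology)
  then show ?thesis using g by (intro that[of "\<lambda>x. of_real (g x)"]) (auto intro: continuous_intros)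
qed

text \<open>The kernel \<open>k\<close> is built from the difference \<open>h\<close> of a function
  and its translate by \<open>a\<close>. A character that is trivial at \<open>a\<close> is
  annihilated by \<open>h\<close> and thus by \<open>k\<close>, whereas
  \<open>character_in_spectrum\<close> supplies a character that is not.\<close>

lemma characters_separate_0:
  assumes "a \<noteq> (0::'x)"
  obtains \<psi> where "is_char \<psi>" "\<psi> a \<noteq> 1"
proof -
  obtain f where f: "cont f" "f 0 = 0" "f a = 1" using exists_separating_function[of 0 a] assms by metis
  define h where "h = (\<lambda>y. f (y + a) - f y)"
  have cfa: "cont (\<lambda>y. f (y + a))" by (intro cont_comp[OF f(1)] continuous_intros)
  have ch: "cont h" unfolding h_def by (intro continuous_intros cfa f)
  have cs: "cont (star h)" by (rule cont_star[OF ch])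
  have h0: "h 0 \<noteq> 0" using f by (simp add: h_def)
  define k where "k = conv (star h) h"
  have "star (star h) = h" by (simp add: star_def fun_eq_iff)
  then have "herm k" unfolding k_def herm_def using star_conv[OF cs ch] conv_commute[OF cs ch] cont_conv[OF cs ch] by simp
  moreover have "k 0 \<noteq> 0" using sqn_pos[OF ch h0] by (simp add: k_def conv_star_0)
  ultimately obtain \<psi> z where \<psi>: "is_char \<psi>" "conv k \<psi> z \<noteq> 0" using character_in_spectrum by blast
  note ch\<psi> = is_charD[OF \<psi>(1)]
  have "\<psi> a \<noteq> 1"
  proof
    assume a1: "\<psi> a = 1"
    have "conv h \<psi> x = 0" for x
    proof -
      have c1: "cont (\<lambda>y. f y * \<psi> (x - y))" by (intro continuous_on_mult f cont_comp[OF ch\<psi>(1)] continuous_intros)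
      have e: "\<psi> (x - (y + a)) = \<psi> (x - y)" for y
        using ch\<psi>(6)[of "x - y" a] a1 by (simp add: algebra_simps)
      have "conv h \<psi> x = conv \<psi> h x" using conv_commute[OF ch ch\<psi>(1)] by simp
      also have "\<dots> = I (\<lambda>y. f (y + a) * \<psi> (x - (y + a)) - f y * \<psi> (x - y))"
        unfolding e by (simp add: conv_def h_def algebra_simps)
      also have "\<dots> = I (\<lambda>y. f (y + a) * \<psi> (x - (y + a))) - I (\<lambda>y. f y * \<psi> (x - y))"
        by (intro Bochner_Integration.integral_diff cont_integrable c1 continuous_on_mult cfa cont_comp[OF ch\<psi>(1)] continuous_intros)
      also have "\<dots> = 0" using I_translate'(1)[OF c1, of a] by simp
      finally show ?thesis .
    qed
    then have "conv (star h) (conv h \<psi>) z = 0" by (simp add: conv_def[of "star h" "conv h \<psi>"])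
    then show False using \<psi>(2) conv_assoc[OF cs ch ch\<psi>(1)] by (simp add: k_def)
  qed
  then show ?thesis using that \<psi> by blast
qed

lemma I_character:
  assumes \<psi>: "is_char \<psi>"
  shows "I \<psi> = (if \<psi> = (\<lambda>_. 1) then 1 else 0)"
proof (cases "\<psi> = (\<lambda>_. 1)")
  case True
  then show ?thesis by simp
next
  case False
  then obtain a where a: "\<psi> a \<noteq> 1" by auto
  have "I \<psi> = I (\<lambda>x. \<psi> (a + x))" using I_translate[OF is_charD(1)[OF \<psi>]] by simp
  also have "\<dots> = \<psi> a * I \<psi>" by (simp add: is_charD(2)[OF \<psi>])
  finally have "(1 - \<psi> a) * I \<psi> = 0" by (simp add: algebra_simps)
  then show ?thesis using a False by simp
qed
end

section \<open>Characters\<close>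

lemma is_char_1: "is_char (\<lambda>_. 1)"
  by (simp add: is_char_def)

text \<open>The dual group becomes a type written additively, so that the results on heights apply
  to it.\<close>

typedef (overloaded) 'x character = "{\<psi> :: 'x::topological_ab_group_add \<Rightarrow> complex. is_char \<psi>}"
  morphisms char_eval Char
  using is_char_1 by blast

instantiation character :: (topological_ab_group_add) ab_group_add
begin

definition zero_character :: "'a character" where "zero_character = Char (\<lambda>_. 1)"
definition plus_character :: "'a character \<Rightarrow> 'a character \<Rightarrow> 'a character" where
  "plus_character a b = Char (\<lambda>x. char_eval a x * char_eval b x)"
definition uminus_character :: "'a character \<Rightarrow> 'a character" where
  "uminus_character a = Char (\<lambda>x. cnj (char_eval a x))"
definition minus_character :: "'a character \<Rightarrow> 'a character \<Rightarrow> 'a character" where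
  "minus_character a b = a + - (b :: 'a character)"

lemma is_char_eval: "is_char (char_eval a)"
  using char_eval[of a] by simp

lemma char_eval_0 [simp]: "char_eval 0 x = 1"
  by (simp add: zero_character_def Char_inverse is_char_1)

lemma char_eval_add [simp]: "char_eval (a + b) x = char_eval a x * char_eval b x"
proof -
  have "is_char (\<lambda>x. char_eval a x * char_eval b x)"
    using is_char_eval[of a] is_char_eval[of b] unfolding is_char_def
    by (auto simp: norm_mult mult_ac intro!: continuous_intros)
  then show ?thesis by (simp add: plus_character_def Char_inverse)
qed

lemma char_eval_minus [simp]: "char_eval (- a) x = cnj (char_eval a x)"
proof -
  have "is_char (\<lambda>x. cnj (char_eval a x))"
    using is_char_eval[of a] unfolding is_char_def by (auto intro!: continuous_intros)
  then show ?thesis by (simp add: uminus_character_def Char_inverse)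
qed

lemma char_eqI: "(\<And>x. char_eval a x = char_eval b x) \<Longrightarrow> a = b"
  by (metis char_eval_inject ext)

instance
proof
  fix a b c :: "'a character"
  show "- a + a = 0" by (rule char_eqI) (use is_charD(7)[OF is_char_eval[of a]] in \<open>simp add: mult.commute\<close>)
qed (auto intro!: char_eqI simp: minus_character_def mult_ac)

end

lemma char_eval_diff [simp]: "char_eval (a - b) x = char_eval a x * cnj (char_eval b x)"
  using char_eval_add[of a "- b" x] by simp

lemma char_eval_nmul: "char_eval (nmul n a) x = char_eval a x ^ n"
  by (induction n) auto

lemmas char_eval_norm [simp] = is_charD(3)[OF is_char_eval]
lemmas char_eval_cont = is_charD(1)[OF is_char_eval]
lemma char_eval_nonzero [simp]: "char_eval a x \<noteq> 0"
  using char_eval_norm[of a x] by fastforce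

text \<open>A torsion character takes values in a finite set of roots of unity, so it is constant on
  a connected group.\<close>

lemma torsion_free_characters:
  assumes "connected (UNIV :: 'x set)"
  shows "torsion_free_type TYPE('x::topological_ab_group_add character)"
  unfolding torsion_free_type_def
proof (intro allI impI)
  fix k :: int and a :: "'x character" assume k: "k > 0" "zmul k a = 0"
  have "nmul (nat k) a = 0" using k by (simp add: zmul_def)
  then have pw: "char_eval a x ^ nat k = 1" for x by (metis char_eval_0 char_eval_nmul)
  have "finite (range (char_eval a))"
  proof (rule finite_subset)
    show "range (char_eval a) \<subseteq> {z. z ^ nat k = 1}" using pw by auto
    show "finite {z::complex. z ^ nat k = 1}" using k by (intro finite_roots_unity) simp
  qed
  then have "char_eval a constant_on UNIV"
    using continuous_finite_range_constant[OF assms char_eval_cont] by blast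
  then obtain c where c: "\<And>x. char_eval a x = c" unfolding constant_on_def by blast
  then have "c = 1" using c[of 0] is_charD(4)[OF is_char_eval[of a]] by simp
  then show "a = 0" using c by (intro char_eqI) simp
qed

text \<open>Every point outside \<open>U\<close> is kept away from \<open>e s0\<close> by some
  \<open>f i\<close>, and by compactness finitely many of these conditions suffice. The maps into X
  constructed below are known only through the values of characters.\<close>

lemma continuous_on_into_compact:
  fixes e :: "'a::topological_space \<Rightarrow> 'x::topological_space" and f :: "'i \<Rightarrow> 'x \<Rightarrow> 'b::t2_space"
  assumes comp: "compact (UNIV :: 'x set)" and f: "\<And>i. continuous_on UNIV (f i)"
    and sep: "\<And>x y. x \<noteq> y \<Longrightarrow> \<exists>i. f i x \<noteq> f i y" and fe: "\<And>i. continuous_on S (\<lambda>s. f i (e s))"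
  shows "continuous_on S e"
  unfolding continuous_on_topological
proof (intro ballI allI impI)
  fix s0 U assume s0: "s0 \<in> S" and U: "open U" "e s0 \<in> U"
  have cK: "compact (- U)" using compact_Int_closed[OF comp, of "- U"] U(1) by (simp add: closed_def)
  have "\<exists>W A. open W \<and> y \<in> W \<and> open A \<and> s0 \<in> A \<and> (\<forall>s\<in>S. s \<in> A \<longrightarrow> e s \<notin> W)" if y: "y \<in> - U" for y
  proof -
    obtain i where "f i y \<noteq> f i (e s0)" using sep[of y "e s0"] y U(2) by auto
    then obtain P Q where PQ: "open P" "open Q" "f i y \<in> P" "f i (e s0) \<in> Q" "P \<inter> Q = {}" using hausdorff by meson
    obtain A where A: "open A" "s0 \<in> A" "\<forall>s\<in>S. s \<in> A \<longrightarrow> f i (e s) \<in> Q"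
      using fe[of i] s0 PQ(2,4) unfolding continuous_on_topological by metis
    have "open (f i -` P)" using PQ(1) f by (rule open_vimage)
    then show ?thesis using A PQ by (intro exI[of _ "f i -` P"] exI[of _ A]) auto
  qed
  then obtain W A where WA: "\<And>y. y \<in> - U \<Longrightarrow> open (W y) \<and> y \<in> W y \<and> open (A y) \<and> s0 \<in> A y \<and> (\<forall>s\<in>S. s \<in> A y \<longrightarrow> e s \<notin> W y)"
    by metis
  have "- U \<subseteq> (\<Union>y\<in>- U. W y)" using WA by blast
  then obtain T where T: "T \<subseteq> - U" "finite T" "- U \<subseteq> (\<Union>y\<in>T. W y)"
    using compactE_image[OF cK, of "- U" W] WA by metis
  have "open (\<Inter>y\<in>T. A y)" using T WA by (intro open_INT) auto
  moreover have "s0 \<in> (\<Inter>y\<in>T. A y)" using T WA by auto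
  moreover have "e s \<in> U" if "s \<in> S" "s \<in> (\<Inter>y\<in>T. A y)" for s
  proof (rule ccontr)
    assume "e s \<notin> U"
    then obtain y where "y \<in> T" "e s \<in> W y" using T(3) by auto
    then show False using WA[of y] that T(1) by auto
  qed
  ultimately show "\<exists>A. open A \<and> s0 \<in> A \<and> (\<forall>s\<in>S. s \<in> A \<longrightarrow> e s \<in> U)" by blast
qed

section \<open>Duality and the rank of the dual group\<close>

context compact_haar
begin

lemma characters_separate:
  assumes "x \<noteq> (y::'x)"
  obtains a where "char_eval a x \<noteq> char_eval a y"
proof -
  obtain \<psi> where \<psi>: "is_char \<psi>" "\<psi> (x - y) \<noteq> 1" using characters_separate_0[of "x - y"] assms by auto
  have "\<psi> x \<noteq> \<psi> y" using is_charD(6)[OF \<psi>(1), of x y] is_charD(7)[OF \<psi>(1), of y] \<psi>(2) by auto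
  then show ?thesis using that[of "Char \<psi>"] \<psi>(1) by (simp add: Char_inverse)
qed

lemma I_char_eval: "I (char_eval a) = (if a = 0 then 1 else 0)"
proof -
  have "(char_eval a = (\<lambda>_. 1)) = (a = 0)" by (auto intro!: char_eqI)
  then show ?thesis using I_character[OF is_char_eval[of a]] by simp
qed

text \<open>The twisted sum of characters below has the same moments as the untwisted one,
  because only trivial characters contribute to the integral; so both have the same supremum.\<close>

definition twist :: "('x character \<Rightarrow> complex) \<Rightarrow> 'x character list \<Rightarrow> 'x \<Rightarrow> complex" where
  "twist \<phi> as x = (\<Sum>a\<leftarrow>as. char_eval a x * cnj (\<phi> a))"

lemma cont_twist: "cont (twist \<phi> as)"
  unfolding twist_def by (induction as) (auto intro!: continuous_intros char_eval_cont)

text \<open>All sums of \<open>m\<close> entries, kept as a list because multiplicities matter: they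
  are the coefficients when a power of a sum of characters is expanded.\<close>

fun list_power :: "'b::monoid_add list \<Rightarrow> nat \<Rightarrow> 'b list" where
  "list_power as 0 = [0]"
| "list_power as (Suc m) = [a + b. a \<leftarrow> as, b \<leftarrow> list_power as m]"

context
  fixes \<phi> :: "'x character \<Rightarrow> complex"
  assumes hom: "\<And>a b. \<phi> (a + b) = \<phi> a * \<phi> b" and unit: "\<And>a. norm (\<phi> a) = 1"
begin

lemma hom_0: "\<phi> 0 = 1"
proof -
  have "\<phi> 0 * \<phi> 0 = \<phi> 0" "\<phi> 0 \<noteq> 0" using hom[of 0 0] unit[of 0] by auto
  then show ?thesis by simp
qed

lemma hom_minus: "\<phi> (- a) = cnj (\<phi> a)"
proof -
  have "\<phi> a * \<phi> (- a) = 1" using hom[of a "- a"] hom_0 by simp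
  moreover have "\<phi> a * cnj (\<phi> a) = 1" using complex_norm_square[of "\<phi> a"] unit[of a] by simp
  moreover have "\<phi> a \<noteq> 0" using unit[of a] by auto
  ultimately show ?thesis by (metis mult_left_cancel)
qed

lemma twist_concat: "twist \<phi> [a + b. a \<leftarrow> as, b \<leftarrow> bs] x = twist \<phi> as x * twist \<phi> bs x"
proof -
  have 1: "twist \<phi> (map (\<lambda>b. a + b) bs) x = char_eval a x * cnj (\<phi> a) * twist \<phi> bs x" for a
    by (induction bs) (auto simp: twist_def hom algebra_simps)
  show ?thesis
  proof (induction as)
    case (Cons a as)
    have "twist \<phi> [a + b. a \<leftarrow> a # as, b \<leftarrow> bs] x = twist \<phi> (map (\<lambda>b. a + b) bs) x + twist \<phi> [a + b. a \<leftarrow> as, b \<leftarrow> bs] x"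
      by (simp add: twist_def)
    then show ?case using 1 Cons by (simp add: twist_def algebra_simps)
  qed (simp add: twist_def)
qed

lemma twist_power: "twist \<phi> (list_power as m) x = twist \<phi> as x ^ m"
proof (induction m)
  case 0
  then show ?case by (simp add: twist_def hom_0)
next
  case (Suc m)
  then show ?case using twist_concat[where as = as and bs = "list_power as m"] by simp
qed

lemma twist_minus: "twist \<phi> (map uminus as) x = cnj (twist \<phi> as x)"
  by (induction as) (auto simp: twist_def hom_minus)

lemma I_twist: "I (twist \<phi> as) = of_nat (count_list as 0)"
proof (induction as)
  case Nil
  then show ?case by (simp add: twist_def)
next
  case (Cons a as)
  have "I (\<lambda>x. char_eval a x * cnj (\<phi> a) + twist \<phi> as x) = I (\<lambda>x. char_eval a x * cnj (\<phi> a)) + I (twist \<phi> as)"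
    by (intro Bochner_Integration.integral_add cont_integrable cont_twist continuous_intros char_eval_cont)
  moreover have "twist \<phi> (a # as) = (\<lambda>x. char_eval a x * cnj (\<phi> a) + twist \<phi> as x)"
    by (simp add: twist_def fun_eq_iff)
  moreover have "I (\<lambda>x. char_eval a x * cnj (\<phi> a)) = (if a = 0 then 1 else 0)"
    by (simp add: I_char_eval hom_0)
  ultimately show ?case using Cons by simp
qed

definition moment_list :: "'x character list \<Rightarrow> nat \<Rightarrow> 'x character list" where
  "moment_list as m = [a + b. a \<leftarrow> list_power as m, b \<leftarrow> map uminus (list_power as m)]"

lemma moment: "complex_of_real (I (\<lambda>x. norm (twist \<phi> as x) ^ (2 * m))) = of_nat (count_list (moment_list as m) 0)"
proof -
  have "twist \<phi> (moment_list as m) x = of_real (norm (twist \<phi> as x) ^ (2 * m))" for x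
  proof -
    have "twist \<phi> (moment_list as m) x = twist \<phi> as x ^ m * cnj (twist \<phi> as x ^ m)"
      unfolding moment_list_def twist_concat twist_minus twist_power ..
    also have "\<dots> = of_real ((norm (twist \<phi> as x ^ m))\<^sup>2)" by (rule complex_norm_square[symmetric])
    finally show ?thesis by (simp add: norm_power power_mult mult.commute flip: power_mult)
  qed
  then have "twist \<phi> (moment_list as m) = (\<lambda>x. of_real (norm (twist \<phi> as x) ^ (2 * m)))" by (rule ext)
  then show ?thesis using I_twist[of "moment_list as m"] I_of_real[of "\<lambda>x. norm (twist \<phi> as x) ^ (2 * m)"] by simp
qed

end

text \<open>Equality of suprema makes the twisted sum as large in modulus as its number of terms at
  some point \<open>x0\<close>. The terms are unimodular, so they all coincide there.\<close>

lemma hom_approximated: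
  fixes \<phi> :: "'x character \<Rightarrow> complex"
  assumes hom: "\<And>a b. \<phi> (a + b) = \<phi> a * \<phi> b" and unit: "\<And>a. norm (\<phi> a) = 1"
    and A: "finite A"
  shows "\<exists>x. \<forall>a\<in>A. char_eval a x = \<phi> a"
proof -
  obtain bs where bs: "set bs = A" "distinct bs" using finite_distinct_list[OF A] by blast
  \<comment> \<open>The trivial character contributes the term 1 and thereby fixes the common value
    of all terms.\<close>
  define as where "as = 0 # bs"
  define K where "K = real (length as)"
  note one = moment[of \<phi>, OF hom unit, of as] moment[of "\<lambda>_. 1" as]
  have eqI: "I (\<lambda>x. norm (twist \<phi> as x) ^ (2 * m)) = I (\<lambda>x. norm (twist (\<lambda>_. 1) as x) ^ (2 * m))" for m
  proof -
    have "complex_of_real (I (\<lambda>x. norm (twist \<phi> as x) ^ (2 * m))) = complex_of_real (I (\<lambda>x. norm (twist (\<lambda>_. 1) as x) ^ (2 * m)))"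
      using one by simp
    then show ?thesis by (simp only: of_real_eq_iff)
  qed
  have cn: "continuous_on UNIV (\<lambda>x. norm (twist \<psi> as x))" for \<psi> by (intro continuous_on_norm cont_twist)
  obtain x0 where x0: "\<And>x. norm (twist \<phi> as x) \<le> norm (twist \<phi> as x0)"
    using continuous_attains_sup[OF comp _ cn[of \<phi>]] by blast
  define s where "s = norm (twist \<phi> as x0)"
  \<comment> \<open>Otherwise choose \<open>r\<close> strictly between. The untwisted sum exceeds
    \<open>r\<close> on an open set around 0, so the common moments grow at least like
    \<open>r ^ (2 * m)\<close>, yet they are at most \<open>s ^ (2 * m)\<close>.\<close>
  have "s \<ge> K"
  proof (rule ccontr)
    assume "\<not> s \<ge> K"
    then have sK: "s < K" by simp
    define r where "r = (s + K) / 2"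
    have r: "s < r" "r < K" "0 \<le> s" using sK by (auto simp: r_def s_def)
    define U where "U = {x. r < norm (twist (\<lambda>_. 1) as x)}"
    have U: "open U" unfolding U_def by (intro open_Collect_less cn continuous_intros)
    have "twist (\<lambda>_. 1) as 0 = of_nat (length as)"
      unfolding twist_def by (induction as) (simp_all add: is_charD(4)[OF is_char_eval])
    then have "0 \<in> U" using r by (simp add: U_def K_def)
    then have mU: "measure M U > 0" using open_pos U by blast
    have Us: "U \<in> sets M" using U by (simp add: sets_M)
    have "measure M U * r ^ (2 * m) \<le> s ^ (2 * m)" for m
    proof -
      have "measure M U * r ^ (2 * m) = I (\<lambda>x. r ^ (2 * m) * indicator U x)" using Us by (simp add: emeasure_eq_measure)
      also have "\<dots> \<le> I (\<lambda>x. norm (twist (\<lambda>_. 1) as x) ^ (2 * m))"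
      proof (rule integral_mono)
        show "integrable M (\<lambda>x. r ^ (2 * m) * indicator U x)"
          using Us by (intro integrable_mult_right) (simp add: emeasure_eq_measure)
        show "integrable M (\<lambda>x. norm (twist (\<lambda>_. 1) as x) ^ (2 * m))"
          by (intro cont_integrable continuous_intros cn)
        show "r ^ (2 * m) * indicator U x \<le> norm (twist (\<lambda>_. 1) as x) ^ (2 * m)" for x
          using r by (cases "x \<in> U") (auto simp: U_def intro!: power_mono)
      qed
      also have "\<dots> = I (\<lambda>x. norm (twist \<phi> as x) ^ (2 * m))" by (rule eqI[symmetric])
      also have "\<dots> \<le> s ^ (2 * m)"
      proof -
        have "norm (I (\<lambda>x. norm (twist \<phi> as x) ^ (2 * m))) \<le> s ^ (2 * m)"
          using x0 by (intro norm_I_le) (simp add: s_def power_mono)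
        then show ?thesis by simp
      qed
      finally show ?thesis .
    qed
    then have le: "measure M U \<le> (s / r) ^ (2 * m)" for m
      using r by (simp add: power_divide field_simps)
    have "(\<lambda>m. ((s / r)\<^sup>2) ^ m) \<longlonglongrightarrow> 0" using r by (intro LIMSEQ_power_zero) (simp add: power_less_one_iff abs_square_less_1)
    then have "measure M U \<le> 0" using le by (intro LIMSEQ_le_const) (auto simp: power_mult)
    then show False using mU by simp
  qed
  have sums: "twist \<phi> as x = 1 + (\<Sum>a\<in>A. char_eval a x * cnj (\<phi> a))" for x
  proof -
    have "norm (\<phi> 0) = 1" "\<phi> 0 * \<phi> 0 = \<phi> 0" using unit hom[of 0 0] by auto
    then have "\<phi> 0 = 1" by auto
    then show ?thesis using bs by (simp add: twist_def as_def sum_list_distinct_conv_sum_set)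
  qed
  have "char_eval a x0 = \<phi> a" if a: "a \<in> A" for a
  proof -
    define z where "z = char_eval a x0 * cnj (\<phi> a)"
    have nz: "norm z = 1" by (simp add: z_def norm_mult unit)
    have "twist \<phi> as x0 = (1 + z) + (\<Sum>b\<in>A - {a}. char_eval b x0 * cnj (\<phi> b))"
      unfolding sums z_def using A a by (simp add: sum.remove)
    then have "s \<le> norm (1 + z) + norm (\<Sum>b\<in>A - {a}. char_eval b x0 * cnj (\<phi> b))"
      unfolding s_def by (metis norm_triangle_ineq)
    also have "norm (\<Sum>b\<in>A - {a}. char_eval b x0 * cnj (\<phi> b)) \<le> (\<Sum>b\<in>A - {a}. 1)"
      by (intro sum_norm_le) (simp add: norm_mult unit)
    also have "\<dots> = K - 2"
    proof -
      have "card A \<ge> 1" using A a by (metis One_nat_def Suc_leI card_gt_0_iff empty_iff)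
      moreover have "length bs = card A" using bs distinct_card by metis
      ultimately show ?thesis using A a by (simp add: K_def as_def card_Diff_singleton of_nat_diff)
    qed
    finally have "norm (1 + z) \<ge> 2" using \<open>s \<ge> K\<close> by simp
    then have "4 \<le> (norm (1 + z))\<^sup>2" using power_mono[of 2 "norm (1 + z)" 2] by simp
    also have "\<dots> = 1 + 2 * Re z + (norm z)\<^sup>2" by (simp add: cmod_power2) (simp add: power2_eq_square algebra_simps)
    finally have "Re z \<ge> 1" using nz by simp
    moreover have "(Re z)\<^sup>2 + (Im z)\<^sup>2 = 1" using nz by (metis cmod_power2 one_power2)
    moreover have "Re z \<le> 1" using complex_Re_le_cmod[of z] nz by simp
    ultimately have "z = 1" by (simp add: complex_eq_iff)
    moreover have "\<phi> a * cnj (\<phi> a) = 1" using complex_norm_square[of "\<phi> a"] unit[of a] by simp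
    moreover have "cnj (\<phi> a) \<noteq> 0" using unit[of a] by auto
    ultimately show ?thesis unfolding z_def by (metis mult_right_cancel)
  qed
  then show ?thesis by blast
qed

text \<open>The finite intersection property passes from finitely many characters to all.\<close>

lemma hom_is_evaluation:
  fixes \<phi> :: "'x character \<Rightarrow> complex"
  assumes hom: "\<And>a b. \<phi> (a + b) = \<phi> a * \<phi> b" and unit: "\<And>a. norm (\<phi> a) = 1"
  shows "\<exists>x. \<forall>a. char_eval a x = \<phi> a"
proof -
  define E where "E = (\<lambda>a. {x. char_eval a x = \<phi> a})"
  have "UNIV \<inter> \<Inter> (range E) \<noteq> {}"
  proof (rule compact_imp_fip_image[OF comp])
    show "closed (E a)" for a
      unfolding E_def by (intro closed_Collect_eq char_eval_cont continuous_intros)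
    fix A :: "'x character set" assume "finite A"
    then obtain x where "\<forall>a\<in>A. char_eval a x = \<phi> a" using hom_approximated[of \<phi>, OF hom unit] by blast
    then show "UNIV \<inter> \<Inter> (E ` A) \<noteq> {}" by (auto simp: E_def)
  qed
  then show ?thesis by (auto simp: E_def)
qed

text \<open>A basis larger than the dimension would give a cube that is too large. For
  \<open>s\<close> in the cube, an additive extension and \<open>cis\<close> produce a homomorphism
  with value \<open>cis (s i)\<close> at \<open>b i\<close>; it is evaluation at a point
  \<open>e s\<close>, and the sides of length 1 are shorter than the period of \<open>cis\<close>,
  so \<open>e\<close> is injective.\<close>

lemma finite_rank:
  assumes dim: "(euclidean :: 'x topology) dim_le n" and B: "max_independent (B :: 'x character set)"
  shows "finite B"
proof (rule ccontr)
  assume inf: "infinite B"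
  define N where "N = nat n + 1"
  obtain C where C: "C \<subseteq> B" "finite C" "card C = N" using infinite_arbitrarily_large[OF inf] by blast
  obtain b where b: "bij_betw b {..<N} C" using C by (metis ex_bij_betw_nat_finite atLeast0LessThan)
  have bB: "b i \<in> B" if "i < N" for i using b C that by (auto simp: bij_betw_def)
  have "\<forall>j. \<exists>F. Modules.additive F \<and> (\<forall>a\<in>B. F a = (if a = b j then 1 else (0::real)))"
    by (intro allI max_independent_additive_extension[OF B])
  then obtain F where F: "\<And>j. Modules.additive (F j)" "\<And>j a. a \<in> B \<Longrightarrow> F j a = (if a = b j then 1 else (0::real))" by metis
  define \<phi> where "\<phi> = (\<lambda>(s::nat \<Rightarrow> real) a. cis (\<Sum>j<N. s j * F j a))"
  have "\<exists>x. \<forall>a. char_eval a x = \<phi> s a" for s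
  proof (rule hom_is_evaluation)
    show "\<phi> s (a + b) = \<phi> s a * \<phi> s b" for a b
      by (simp add: \<phi>_def additive.add[OF F(1)] algebra_simps sum.distrib cis_mult)
  qed (simp add: \<phi>_def)
  then obtain e where e: "\<And>s a. char_eval a (e s) = \<phi> s a" by metis
  have eb: "char_eval (b i) (e s) = cis (s i)" if i: "i < N" for i s
  proof -
    have "F j (b i) = (if j = i then 1 else 0)" if "j < N" for j
      using F(2)[OF bB[OF i], of j] b i that by (auto simp: bij_betw_def inj_on_def)
    then have "(\<Sum>j<N. s j * F j (b i)) = (\<Sum>j<N. if j = i then s i else 0)" by (intro sum.cong) auto
    then show ?thesis using i by (simp add: e \<phi>_def)
  qed
  have "inj_on e (cube N)"
  proof (rule inj_onI)
    fix s s' assume s: "s \<in> cube N" "s' \<in> cube N" "e s = e s'"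
    show "s = s'"
    proof
      fix i
      show "s i = s' i"
      proof (cases "i < N")
        case True
        then have "cis (s i) = cis (s' i)" using eb[of i s] eb[of i s'] s(3) by simp
        moreover have "cis (s i - s' i) = cis (s i) / cis (s' i)" by (rule cis_divide[symmetric])
        ultimately have "cis (s i - s' i) = 1" by simp
        then have "Re (cis (s i - s' i)) = 1" by simp
        then have c1: "cos (s i - s' i) = 1" by simp
        have "0 \<le> s i \<and> s i \<le> 1" "0 \<le> s' i \<and> s' i \<le> 1"
          using s(1,2) True unfolding cube_def mem_Collect_eq by metis+
        then have bd: "\<bar>s i - s' i\<bar> \<le> 1" by linarith
        have "cos \<bar>s i - s' i\<bar> = cos 0" using c1 by (simp only: cos_abs_real cos_zero)
        moreover have "\<bar>s i - s' i\<bar> \<le> pi" using bd pi_ge_two by linarith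
        ultimately have "\<bar>s i - s' i\<bar> = 0" by (metis cos_inj_pi abs_ge_zero order_refl pi_ge_zero)
        then show ?thesis by simp
      next
        case False
        then show ?thesis using s by (auto simp: cube_def)
      qed
    qed
  qed
  moreover have "continuous_on (cube N) e"
  proof -
    have "continuous_on (cube N) (\<lambda>s. \<phi> s a)" for a
      unfolding \<phi>_def
      by (intro continuous_intros continuous_on_product_coordinates[THEN continuous_on_subset]) auto
    then have "continuous_on (cube N) (\<lambda>s. char_eval a (e s))" for a by (simp add: e)
    then show ?thesis
      by (intro continuous_on_into_compact[OF comp, of char_eval] char_eval_cont) (use characters_separate in metis)
  qed
  ultimately have "int N \<le> n" using no_cube_embedding[OF dim] by blast
  then show False unfolding N_def by linarith
qed

end

section \<open>Fixed points of mixing actions\<close>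

definition dual :: "('x \<Rightarrow> 'x) \<Rightarrow> 'x character \<Rightarrow> 'x::topological_ab_group_add character" where
  "dual f a = Char (char_eval a \<circ> f)"

lemma char_eval_dual:
  assumes "continuous_on UNIV f" "\<And>x y. f (x + y) = f x + f y"
  shows "char_eval (dual f a) x = char_eval a (f x)"
proof -
  have "is_char (char_eval a \<circ> f)"
    using assms is_char_eval[of a] unfolding is_char_def
    by (auto intro: continuous_on_compose2[of UNIV "char_eval a" UNIV f] simp: o_def)
  then show ?thesis by (simp add: dual_def Char_inverse)
qed

text \<open>Both \<open>card S * card F\<close> and a sum containing the term \<open>(card F)\<^sup>2\<close> (from the trivial character) compute
  the sum over \<open>S\<close> of the squared moduli of the sums of \<open>f\<close> over \<open>F\<close>.\<close>

lemma card_le_card_char_restrictions: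
  fixes H :: "'x::topological_ab_group_add set"
  assumes H: "\<And>x y. x \<in> H \<Longrightarrow> y \<in> H \<Longrightarrow> x - y \<in> H"
    and sep: "\<And>x. x \<in> H \<Longrightarrow> x \<noteq> 0 \<Longrightarrow> \<exists>a. char_eval a x \<noteq> 1"
    and S: "finite (range (\<lambda>a. restrict (char_eval a) H))"
    and F: "finite F" "F \<subseteq> H"
  shows "card F \<le> card (range (\<lambda>a. restrict (char_eval a) H))"
proof (cases "F = {}")
  case False
  let ?S = "range (\<lambda>a. restrict (char_eval a) H)"
  \<comment> \<open>Multiplication by a character \<open>c\<close> permutes the restrictions, so the
    sum is unchanged by the factor \<open>char_eval c z\<close>, which differs from 1.\<close>
  have orth: "(\<Sum>f\<in>?S. f z) = 0" if z: "z \<in> H" "z \<noteq> 0" for z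
  proof -
    obtain c where c: "char_eval c z \<noteq> 1" using sep z by blast
    define m where "m = (\<lambda>f. \<lambda>x\<in>H. f x * char_eval c x)"
    have mS: "m (restrict (char_eval a) H) = restrict (char_eval (a + c)) H" for a
      by (auto simp: m_def restrict_def)
    have inj: "inj_on m ?S"
    proof (rule inj_onI)
      fix f f' assume f: "f \<in> ?S" "f' \<in> ?S" and eq: "m f = m f'"
      have "f x = f' x" for x
      proof (cases "x \<in> H")
        case True
        then have "f x * char_eval c x = f' x * char_eval c x" using fun_cong[OF eq, of x] by (simp add: m_def)
        then show ?thesis by simp
      next
        case False
        then show ?thesis using f by auto
      qed
      then show "f = f'" by (rule ext)
    qed
    have "m ` ?S \<subseteq> ?S" using mS by auto
    then have im: "m ` ?S = ?S" using endo_inj_surj[OF S _ inj] by blast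
    have "(\<Sum>f\<in>?S. f z) = (\<Sum>f\<in>m ` ?S. f z)" by (simp only: im)
    also have "\<dots> = (\<Sum>f\<in>?S. m f z)" using sum.reindex[OF inj, of "\<lambda>f. f z"] by (simp only: comp_def)
    also have "\<dots> = (\<Sum>f\<in>?S. f z) * char_eval c z" using z by (simp add: m_def sum_distrib_right)
    finally have "(\<Sum>f\<in>?S. f z) * (1 - char_eval c z) = 0" by (simp add: algebra_simps)
    then show ?thesis using c by simp
  qed
  have z0: "0 \<in> H" using False F H by (metis all_not_in_conv diff_self subsetD)
  have term0: "(\<Sum>f\<in>?S. f 0) = of_nat (card ?S)"
  proof -
    have "(\<Sum>f\<in>?S. f 0) = (\<Sum>f\<in>?S. 1)" using z0 by (intro sum.cong) (auto simp: is_charD(4)[OF is_char_eval])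
    then show ?thesis by simp
  qed
  have prod: "f x * cnj (f y) = f (x - y)" if "f \<in> ?S" "x \<in> F" "y \<in> F" for f x y
  proof -
    have "x \<in> H" "y \<in> H" "x - y \<in> H" using that F H by auto
    then show ?thesis using that(1) by (auto simp: is_charD(6)[OF is_char_eval])
  qed
  have "complex_of_real (\<Sum>f\<in>?S. (norm (\<Sum>x\<in>F. f x))\<^sup>2) = (\<Sum>f\<in>?S. (\<Sum>x\<in>F. f x) * cnj (\<Sum>x\<in>F. f x))"
    by (simp only: of_real_sum complex_norm_square)
  also have "\<dots> = (\<Sum>f\<in>?S. \<Sum>x\<in>F. \<Sum>y\<in>F. f (x - y))"
    using prod by (intro sum.cong refl) (simp add: sum_product)
  also have "\<dots> = (\<Sum>x\<in>F. \<Sum>y\<in>F. \<Sum>f\<in>?S. f (x - y))"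
    by (subst sum.swap, intro sum.cong refl, rule sum.swap)
  also have "\<dots> = (\<Sum>x\<in>F. \<Sum>y\<in>F. if x = y then of_nat (card ?S) else 0)"
  proof (intro sum.cong refl)
    fix x y assume "x \<in> F" "y \<in> F"
    then show "(\<Sum>f\<in>?S. f (x - y)) = (if x = y then of_nat (card ?S) else 0)"
      using orth[of "x - y"] term0 H[of x y] F by auto
  qed
  also have "\<dots> = of_real (real (card F) * real (card ?S))" using F by simp
  finally have eq: "(\<Sum>f\<in>?S. (norm (\<Sum>x\<in>F. f x))\<^sup>2) = real (card F) * real (card ?S)"
    by (simp only: of_real_eq_iff)
  define one where "one = restrict (char_eval (0::'x character)) H"
  have "(norm (\<Sum>x\<in>F. one x))\<^sup>2 \<le> (\<Sum>f\<in>?S. (norm (\<Sum>x\<in>F. f x))\<^sup>2)"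
  proof (rule member_le_sum[OF _ _ S])
    show "one \<in> ?S" unfolding one_def by (rule rangeI)
  qed simp
  moreover have "(\<Sum>x\<in>F. one x) = (\<Sum>x\<in>F. 1)" using F by (intro sum.cong) (auto simp: one_def)
  ultimately have "(real (card F))\<^sup>2 \<le> real (card F) * real (card ?S)" by (simp only: eq) simp
  moreover have "real (card F) > 0" using False F by (simp add: card_gt_0_iff)
  ultimately show ?thesis by (simp add: power2_eq_square)
qed simp

section \<open>The dual action\<close>

locale mixing_action = compact_haar M + group G
  for M :: "'x::{topological_ab_group_add, t2_space} measure" and G :: "('g, 'b) monoid_scheme" (structure) +
  fixes \<alpha> :: "'g \<Rightarrow> 'x \<Rightarrow> 'x"
  assumes acts: "acts_by_automorphisms G \<alpha>" and mix: "mixing G \<alpha> M"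
    and conn: "connected (UNIV :: 'x set)" and findim: "finite_dimensional_space (euclidean :: 'x topology)"
begin

sublocale act: group_action G UNIV \<alpha>
  using acts by (simp add: acts_by_automorphisms_def)

lemma action_cont: "g \<in> carrier G \<Longrightarrow> continuous_on UNIV (\<alpha> g)"
  and action_add: "g \<in> carrier G \<Longrightarrow> \<alpha> g (x + y) = \<alpha> g x + \<alpha> g y"
  using acts by (auto simp: acts_by_automorphisms_def)

lemma action_mult: "g \<in> carrier G \<Longrightarrow> k \<in> carrier G \<Longrightarrow> \<alpha> (g \<otimes> k) x = \<alpha> g (\<alpha> k x)"
  by (rule act.composition_rule) auto

lemma action_one: "\<alpha> \<one> x = x"
  using act.id_eq_one by (metis UNIV_I restrict_apply')

lemma action_diff: "g \<in> carrier G \<Longrightarrow> \<alpha> g (x - y) = \<alpha> g x - \<alpha> g y"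
  using action_add[of g "x - y" y] by (simp add: eq_diff_eq)

lemma action_zero: "g \<in> carrier G \<Longrightarrow> \<alpha> g 0 = 0"
  using action_add[of g 0 0] by simp

lemma surj_action: "g \<in> carrier G \<Longrightarrow> surj (\<alpha> g)"
  by (metis action_mult action_one inv_closed r_inv surjI)

abbreviation T :: "'g \<Rightarrow> 'x character \<Rightarrow> 'x character" where "T g \<equiv> dual (\<alpha> g)"

lemma char_eval_T: "g \<in> carrier G \<Longrightarrow> char_eval (T g a) x = char_eval a (\<alpha> g x)"
  by (intro char_eval_dual action_cont action_add)

lemma additive_T: "g \<in> carrier G \<Longrightarrow> Modules.additive (T g)"
  by (intro additive.intro char_eqI) (simp add: char_eval_T)

lemma T_mult: "g \<in> carrier G \<Longrightarrow> k \<in> carrier G \<Longrightarrow> T (g \<otimes> k) = T k \<circ> T g"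
  by (intro ext char_eqI) (simp add: char_eval_T action_mult)

lemma T_one: "T \<one> = id"
  by (intro ext char_eqI) (simp add: char_eval_T action_one)

text \<open>A nontrivial invariant character has a level set \<open>E\<close> that is invariant
  under \<open>g\<close> and has measure strictly between 0 and 1. The powers of \<open>g\<close>
  are distinct and leave every finite set, so mixing along them makes the measure of
  \<open>E\<close> equal to its square.\<close>

lemma invariant_character_trivial:
  assumes g: "g \<in> carrier G" and ord: "\<And>k::nat. k > 0 \<Longrightarrow> g [^] k \<noteq> \<one>" and a: "T g a = a"
  shows "a = 0"
proof (rule ccontr)
  assume "a \<noteq> 0"
  define \<psi> where "\<psi> = char_eval a"
  have inv1: "\<psi> (\<alpha> g x) = \<psi> x" for x using char_eval_T[OF g, of a x] a by (simp add: \<psi>_def)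
  have inv: "\<psi> (\<alpha> (g [^] k) x) = \<psi> x" for k :: nat and x
    by (induction k arbitrary: x) (simp_all add: action_one action_mult g inv1)
  obtain x0 where x0: "\<psi> x0 \<noteq> 1" using \<open>a \<noteq> 0\<close> char_eqI[of a 0] by (auto simp: \<psi>_def)
  have "Re (\<psi> x0) < 1"
  proof (rule ccontr)
    assume "\<not> Re (\<psi> x0) < 1"
    moreover have n1: "norm (\<psi> x0) = 1" by (simp add: \<psi>_def)
    ultimately have "Re (\<psi> x0) = 1" using complex_Re_le_cmod[of "\<psi> x0"] by linarith
    moreover have "(Re (\<psi> x0))\<^sup>2 + (Im (\<psi> x0))\<^sup>2 = 1" using n1 by (metis cmod_power2 one_power2)
    ultimately show False using x0 by (simp add: complex_eq_iff)
  qed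
  then obtain t where t: "Re (\<psi> x0) < t" "t < 1" using dense by blast
  define E where "E = {x. t < Re (\<psi> x)}"
  define V where "V = {x. Re (\<psi> x) < t}"
  have c: "continuous_on UNIV (\<lambda>x. Re (\<psi> x))" unfolding \<psi>_def by (intro continuous_intros char_eval_cont)
  have op: "open E" "open V" unfolding E_def V_def by (intro open_Collect_less c continuous_intros)+
  have "0 \<in> E" "x0 \<in> V" using t is_charD(4)[OF is_char_eval[of a]] by (auto simp: E_def V_def \<psi>_def)
  then have pos: "measure M E > 0" "measure M V > 0" using open_pos op by auto
  have sets: "E \<in> sets M" "V \<in> sets M" using op by (auto simp: sets_M)
  have "measure M E + measure M V = measure M (E \<union> V)"
    by (rule finite_measure_Union[symmetric]) (use sets in \<open>auto simp: E_def V_def\<close>)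
  also have "\<dots> \<le> 1" by simp
  finally have lt: "measure M E < 1" using pos by simp
  have im: "\<alpha> (g [^] k) ` E = E" for k :: nat
  proof (rule equalityI; rule subsetI)
    fix x assume x: "x \<in> E"
    obtain y where "x = \<alpha> (g [^] k) y" using surj_action[of "g [^] k"] g by (metis nat_pow_closed surjD)
    then show "x \<in> \<alpha> (g [^] k) ` E" using x by (auto simp: E_def inv)
  qed (auto simp: E_def inv)
  have inj: "inj (\<lambda>k::nat. g [^] k)"
  proof (rule injI)
    fix i j :: nat assume e: "g [^] i = g [^] j"
    have "g [^] (i - j) = \<one>" "g [^] (j - i) = \<one>" using pow_eq_div2[OF g e] pow_eq_div2[OF g e[symmetric]] by auto
    then show "i = j" using ord by (metis diff_is_0_eq' le_antisym nat_le_linear neq0_conv diffs0_imp_equal)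
  qed
  have "filterlim (\<lambda>k::nat. g [^] k) (inf cofinite (principal (carrier G))) sequentially"
    unfolding filterlim_inf
  proof
    show "filterlim (\<lambda>k::nat. g [^] k) cofinite sequentially"
      unfolding filterlim_iff eventually_cofinite cofinite_eq_sequentially[symmetric]
    proof (intro allI impI)
      fix P :: "'g \<Rightarrow> bool" assume "finite {x. \<not> P x}"
      from finite_vimageI[OF this inj] show "finite {k::nat. \<not> P (g [^] k)}" by (simp add: vimage_def)
    qed
  qed (use g in \<open>simp add: filterlim_principal\<close>)
  moreover have "((\<lambda>k. measure M (E \<inter> \<alpha> k ` E)) \<longlongrightarrow> measure M E * measure M E) (inf cofinite (principal (carrier G)))"
    using mix sets unfolding mixing_def sets_M by blast
  ultimately have "(\<lambda>k::nat. measure M (E \<inter> \<alpha> (g [^] k) ` E)) \<longlonglongrightarrow> measure M E * measure M E"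
    by (rule filterlim_compose[rotated])
  then have "(\<lambda>k::nat. measure M E) \<longlonglongrightarrow> measure M E * measure M E" by (simp add: im)
  then have "measure M E * measure M E = measure M E" by (simp add: LIMSEQ_const_iff)
  then show False using pos lt by simp
qed

text \<open>Characters congruent modulo the range of \<open>T g - 1\<close> agree on the fixed
  points. Hence their restrictions to the fixed points are at most as many as the cosets of that
  range, and the fixed points are at most as many as these restrictions.\<close>

lemma card_fixed_points_le:
  assumes B: "max_independent B" and g: "g \<in> carrier G" and ord: "\<And>k::nat. k > 0 \<Longrightarrow> g [^] k \<noteq> \<one>"
    and gr: "height_growth B D C (T g)" "D > 0" "D \<le> C"
  shows "finite {x. \<alpha> g x = x}" "card {x. \<alpha> g x = x} \<le> nat ((2 * C) ^ card B)"
proof -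
  obtain n where "(euclidean :: 'x topology) dim_le n" using findim unfolding finite_dimensional_space_def by blast
  then have finB: "finite B" using finite_rank[OF _ B] by blast
  define H where "H = {x. \<alpha> g x = x}"
  define R where "R = (\<lambda>a. restrict (char_eval a) H)"
  define K where "K = nat ((2 * C) ^ card B)"
  interpret Tg: Modules.additive "T g" by (rule additive_T[OF g])
  have inj: "inj (\<lambda>a. T g a - a)"
  proof (rule injI)
    fix a b assume "T g a - a = T g b - b"
    then have "T g (a - b) = a - b" by (simp add: Tg.diff algebra_simps)
    then have "a - b = 0" by (rule invariant_character_trivial[OF g ord, rotated])
    then show "a = b" by simp
  qed
  have bd: "card A \<le> K" if A: "finite A" "inj_on R A" for A
    unfolding K_def
  proof (rule card_cosets_le[OF finB B torsion_free_characters[OF conn] _ inj height_growth_minus_id[OF gr] gr(2) _ A(1)])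
    show "Modules.additive (\<lambda>a. T g a - a)" by (intro additive.intro) (simp add: Tg.add)
    show "D \<le> 2 * C" using gr by simp
    fix a b assume ab: "a \<in> A" "b \<in> A" "a - b \<in> range (\<lambda>a. T g a - a)"
    then obtain c where "a - b = T g c - c" by blast
    then have c: "a = b + (T g c - c)" by (simp add: algebra_simps)
    have "char_eval a x = char_eval b x" if "x \<in> H" for x
    proof -
      have "\<alpha> g x = x" using that by (simp add: H_def)
      then show ?thesis using is_charD(7)[OF is_char_eval[of c], of x] unfolding c by (simp add: char_eval_T[OF g])
    qed
    then have "R a = R b" by (auto simp: R_def restrict_def)
    then show "a = b" using A(2) ab by (auto dest: inj_onD)
  qed
  \<comment> \<open>Finiteness of the set of restrictions is not known yet, so finite subsets are
    bounded first.\<close>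
  have sub: "card W \<le> K" if W: "finite W" "W \<subseteq> range R" for W
  proof -
    obtain A where "inj_on R A" "R ` A = W" using subset_image_inj[of W R UNIV] W(2) by auto
    then show ?thesis using bd[of A] W(1) by (metis card_image finite_imageD)
  qed
  then have finR: "finite (range R)" "card (range R) \<le> K" using finite_if_finite_subsets_card_bdd[of "range R" K] by blast+
  have le: "card F \<le> card (range R)" if F: "finite F" "F \<subseteq> H" for F
    unfolding R_def
  proof (rule card_le_card_char_restrictions)
    show "finite (range (\<lambda>a. restrict (char_eval a) H))" using finR by (simp add: R_def)
    show "x - y \<in> H" if "x \<in> H" "y \<in> H" for x y using that g by (simp add: H_def action_diff)
    show "\<exists>a. char_eval a x \<noteq> 1" if "x \<noteq> 0" for x :: 'x
      using characters_separate[OF that] is_charD(4)[OF is_char_eval] by metis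
  qed (use F in auto)
  then show "finite {x. \<alpha> g x = x}" "card {x. \<alpha> g x = x} \<le> nat ((2 * C) ^ card B)"
    using finite_if_finite_subsets_card_bdd[of H K] finR(2) unfolding H_def[symmetric] K_def[symmetric]
    by (meson order_trans)+
qed

lemma uniform_height_growth:
  assumes B: "finite B" "max_independent B" and X: "finite X" "X \<subseteq> carrier G"
  shows "\<exists>D>0. \<exists>C\<ge>D. \<forall>g\<in>X. height_growth B D C (T g)"
  using X
proof (induction X)
  case empty
  then show ?case by (auto intro: exI[of _ 1])
next
  case (insert g X)
  then obtain D C where DC: "D > 0" "D \<le> C" "\<And>k. k \<in> X \<Longrightarrow> height_growth B D C (T k)" by auto
  obtain D' C' where DC': "D' > 0" "D' \<le> C'" "height_growth B D' C' (T g)"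
    using height_growth_exists[OF B additive_T[of g]] insert by auto
  have "height_growth B (D * D') (C * C') (T k)" if "k \<in> X" for k
    using height_growth_mono[OF height_growth_scale[OF DC(3)[OF that], of D'], of "C * C'"] DC DC'
    by (simp add: mult_left_mono)
  moreover have "height_growth B (D * D') (C * C') (T g)"
    using height_growth_mono[OF height_growth_scale[OF DC'(3), of D], of "C * C'"] DC DC'
    by (simp add: mult_right_mono mult.commute)
  moreover have "D * D' \<le> C * C'" using DC DC' by (intro mult_mono) auto
  moreover have "D * D' > 0" using DC DC' by simp
  ultimately show ?case by (intro exI[of _ "D * D'"] conjI exI[of _ "C * C'"]) auto
qed

context
  fixes B :: "'x character set" and D C :: int
  assumes DC: "D > 0" "D \<le> C"
begin

text \<open>The growth allowed to a word of \<open>l\<close> letters. Products reverse their order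
  in passing to the dual, but the bounds depend on the length alone.\<close>

definition word_growth :: "nat \<Rightarrow> 'g \<Rightarrow> bool" where
  "word_growth l g \<longleftrightarrow> g \<in> carrier G \<and> height_growth B (D ^ l) (C ^ l) (T g)"

lemma word_growth_mult:
  assumes "word_growth l g" "word_growth m k" shows "word_growth (l + m) (g \<otimes> k)"
proof -
  have "height_growth B (D ^ m * D ^ l) (C ^ m * C ^ l) (T k \<circ> T g)"
    using assms DC by (intro height_growth_comp) (auto simp: word_growth_def)
  then show ?thesis using assms by (simp add: word_growth_def T_mult power_add mult.commute)
qed

lemma word_growth_pow:
  assumes "word_growth 1 g" shows "word_growth l (g [^] l)"
proof (induction l)
  case 0
  then show ?case using height_growth_id by (simp add: word_growth_def T_one)
next
  case (Suc l)
  then show ?case using word_growth_mult[OF Suc assms] by simp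
qed

end

text \<open>The constants come from \<open>x\<close>, \<open>y\<close> and their inverses and do not
  depend on \<open>L\<close>. The element of infinite order found in \<open>L\<close> is a word of
  at most \<open>4 * s\<close> letters in them. The lower bound 1 is due to the fixed point 0; it
  turns the count of subgroups into a lower bound for the coefficients.\<close>

lemma fixed_points_bound:
  assumes x: "cyclic_step {\<one>} K1 x" and y: "cyclic_step K1 K2 y"
  shows "\<exists>C r. \<forall>L\<in>finite_index_subgroups G. \<forall>s. index G L < (s + 1)\<^sup>2 \<longrightarrow> finite (fixed_points \<alpha> L) \<and>
    card (fixed_points \<alpha> L) \<ge> 1 \<and> card (fixed_points \<alpha> L) \<le> (2 * C ^ (4 * s)) ^ r"
proof -
  obtain B :: "'x character set" where B: "max_independent B" using max_independent_exists by blast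
  obtain n where "(euclidean :: 'x topology) dim_le n" using findim unfolding finite_dimensional_space_def by blast
  then have finB: "finite B" using finite_rank[OF _ B] by blast
  have xy: "x \<in> carrier G" "y \<in> carrier G" using step_carrier(3)[OF x] step_carrier(3)[OF y] by auto
  then obtain D C where DC: "D > 0" "D \<le> C" "\<forall>g\<in>{x, y, inv x, inv y}. height_growth B D C (T g)"
    using uniform_height_growth[OF finB B, of "{x, y, inv x, inv y}"] by auto
  note wg = word_growth_mult[OF DC(1,2), where B = B] word_growth_pow[OF DC(1,2), where B = B]
  have w1: "word_growth B D C 1 g" if "g \<in> {x, y, inv x, inv y}" for g
    using that DC xy by (auto simp: word_growth_def[OF DC(1,2)])
  show ?thesis
  proof (rule exI[of _ "nat C"], rule exI[of _ "card B"], intro ballI allI impI)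
    fix L s assume L: "L \<in> finite_index_subgroups G" and s: "index G L < (s + 1)\<^sup>2"
    have L': "subgroup L G" "finite (rcosets L)" "card (rcosets L) < (s + 1)\<^sup>2"
      using L s by (auto simp: finite_index_subgroups_def index_def)
    obtain i j i' j' :: nat where ij: "i \<le> s" "j \<le> s" "i' \<le> s" "j' \<le> s"
      and gL: "x [^] i \<otimes> y [^] j \<otimes> inv (x [^] i' \<otimes> y [^] j') \<in> L"
      and ord: "\<And>k::nat. k > 0 \<Longrightarrow> (x [^] i \<otimes> y [^] j \<otimes> inv (x [^] i' \<otimes> y [^] j')) [^] k \<noteq> \<one>"
      by (rule short_element_of_infinite_order[OF x y L']) (rule that)
    define g where "g = x [^] i \<otimes> y [^] j \<otimes> inv (x [^] i' \<otimes> y [^] j')"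
    define l where "l = i + j + (j' + i')"
    have gc: "g \<in> carrier G" using xy by (simp add: g_def)
    have "g = x [^] i \<otimes> y [^] j \<otimes> (inv y [^] j' \<otimes> inv x [^] i')"
      using xy by (simp add: g_def inv_mult_group nat_pow_inv)
    moreover have "word_growth B D C l (x [^] i \<otimes> y [^] j \<otimes> (inv y [^] j' \<otimes> inv x [^] i'))"
      unfolding l_def by (intro wg w1) auto
    ultimately have "word_growth B D C l g" by simp
    then have gr: "height_growth B (D ^ l) (C ^ l) (T g)" by (simp add: word_growth_def[OF DC(1,2)])
    have Dl: "D ^ l > 0" "D ^ l \<le> C ^ l" using DC by (auto intro: power_mono)
    have ord': "g [^] k \<noteq> \<one>" if "k > 0" for k :: nat using ord that by (simp add: g_def)
    note fin = card_fixed_points_le[OF B gc ord' gr Dl]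
    have sub: "fixed_points \<alpha> L \<subseteq> {x. \<alpha> g x = x}" using gL by (auto simp: fixed_points_def g_def)
    have L0: "0 \<in> fixed_points \<alpha> L"
      using action_zero[OF subgroup.mem_carrier[OF L'(1)]] by (simp add: fixed_points_def)
    have finL: "finite (fixed_points \<alpha> L)" using finite_subset[OF sub] fin(1) by blast
    have C1: "C \<ge> 1" using DC by simp
    have "card (fixed_points \<alpha> L) \<le> nat ((2 * C ^ l) ^ card B)" using card_mono[OF fin(1) sub] fin(2) by linarith
    also have "\<dots> = (2 * nat C ^ l) ^ card B" using C1 by (simp add: nat_power_eq nat_mult_distrib)
    also have "\<dots> \<le> (2 * nat C ^ (4 * s)) ^ card B"
      using C1 ij by (intro power_mono mult_left_mono power_increasing) (auto simp: l_def)
    finally show "finite (fixed_points \<alpha> L) \<and> card (fixed_points \<alpha> L) \<ge> 1 \<and>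
        card (fixed_points \<alpha> L) \<le> (2 * nat C ^ (4 * s)) ^ card B"
      using finL L0 by (auto simp: Suc_le_eq card_gt_0_iff)
  qed
qed

end

section \<open>Natural boundary\<close>

context mixing_action
begin

definition fix_sum :: "nat \<Rightarrow> nat" where
  "fix_sum n = (\<Sum>L\<in>subgroups_of_index G n. card (fixed_points \<alpha> L))"

lemma fix_sum_ge:
  assumes x: "cyclic_step {\<one>} K1 x" and y: "cyclic_step K1 K2 y"
  shows "card (subgroups_of_index G n) \<le> fix_sum n"
proof -
  obtain C r where Cr: "\<forall>L\<in>finite_index_subgroups G. \<forall>s. index G L < (s + 1)\<^sup>2 \<longrightarrow> finite (fixed_points \<alpha> L) \<and>
    card (fixed_points \<alpha> L) \<ge> 1 \<and> card (fixed_points \<alpha> L) \<le> (2 * C ^ (4 * s)) ^ r"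
    using fixed_points_bound[OF x y] by blast
  have "(\<Sum>L\<in>subgroups_of_index G n. 1) \<le> fix_sum n"
    unfolding fix_sum_def
  proof (rule sum_mono)
    fix L assume "L \<in> subgroups_of_index G n"
    then have "L \<in> finite_index_subgroups G" "index G L < (index G L + 1)\<^sup>2"
      by (auto simp: subgroups_of_index_def power2_eq_square)
    then show "1 \<le> card (fixed_points \<alpha> L)" using Cr by blast
  qed
  then show ?thesis by simp
qed

lemma fix_sum_le:
  assumes psg: "polynomial_subgroup_growth G" and x: "cyclic_step {\<one>} K1 x" and y: "cyclic_step K1 K2 y"
  shows "\<exists>K d c. c > 0 \<and> (\<forall>n\<ge>1. real (fix_sum n) \<le> K * real n ^ d * exp (c * sqrt (real n)))"
proof -
  obtain C r where Cr: "\<And>L s. L \<in> finite_index_subgroups G \<Longrightarrow> index G L < (s + 1)\<^sup>2 \<Longrightarrow>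
    card (fixed_points \<alpha> L) \<le> (2 * C ^ (4 * s)) ^ r"
    using fixed_points_bound[OF x y] by blast
  obtain K d where Kd: "\<And>n. n \<ge> 1 \<Longrightarrow> real (card (subgroups_of_index G n)) \<le> K * real n ^ d"
    using psg unfolding polynomial_subgroup_growth_def by blast
  define E where "E = real C + 1"
  have E: "E \<ge> 1" "ln E \<ge> 0" by (auto simp: E_def)
  \<comment> \<open>Adding 1 keeps \<open>c\<close> positive when \<open>r\<close> or
    \<open>ln E\<close> vanishes.\<close>
  define c where "c = real (4 * r) * ln E + 1"
  have c: "c > 0" using E by (simp add: c_def add_nonneg_pos)
  have "real (fix_sum n) \<le> K * 2 ^ r * real n ^ d * exp (c * sqrt (real n))" if n: "n \<ge> 1" for n
  proof -
    \<comment> \<open>The least \<open>s\<close> with \<open>n < (s + 1)\<^sup>2\<close>, which is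
      what the pigeonhole argument requires.\<close>
    define s where "s = nat \<lfloor>sqrt (real n)\<rfloor>"
    have s1: "real s \<le> sqrt (real n)" by (simp add: s_def)
    have s2: "sqrt (real n) < real s + 1" unfolding s_def by (simp add: floor_less_iff)
    have "real n = (sqrt (real n))\<^sup>2" by simp
    also have "\<dots> < (real s + 1)\<^sup>2" using s2 by (intro power_strict_mono) auto
    also have "\<dots> = real ((s + 1)\<^sup>2)" by simp
    finally have ns: "n < (s + 1)\<^sup>2" by (simp only: of_nat_less_iff)
    have bd: "real (card (fixed_points \<alpha> L)) \<le> 2 ^ r * exp (c * sqrt (real n))" if L: "L \<in> subgroups_of_index G n" for L
    proof -
      have "card (fixed_points \<alpha> L) \<le> (2 * C ^ (4 * s)) ^ r"
        using Cr[of L s] L ns by (auto simp: subgroups_of_index_def)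
      then have "real (card (fixed_points \<alpha> L)) \<le> real ((2 * C ^ (4 * s)) ^ r)" by (simp only: of_nat_le_iff)
      also have "\<dots> = (2 * real C ^ (4 * s)) ^ r" by simp
      also have "\<dots> \<le> (2 * E ^ (4 * s)) ^ r" by (intro power_mono mult_left_mono) (auto simp: E_def)
      also have "\<dots> = 2 ^ r * E ^ (4 * s * r)" by (simp add: power_mult_distrib power_mult)
      also have "E ^ (4 * s * r) = exp (real (4 * s * r) * ln E)" using E(1) by (subst exp_of_nat_mult) simp
      also have "real (4 * s * r) * ln E = real (4 * r) * ln E * real s" by simp
      also have "\<dots> \<le> real (4 * r) * ln E * sqrt (real n)" using s1 E by (intro mult_left_mono) auto
      also have "\<dots> \<le> c * sqrt (real n)" by (intro mult_right_mono) (auto simp: c_def)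
      finally show ?thesis by simp
    qed
    have "real (fix_sum n) = (\<Sum>L\<in>subgroups_of_index G n. real (card (fixed_points \<alpha> L)))" by (simp add: fix_sum_def)
    also have "\<dots> \<le> (\<Sum>L\<in>subgroups_of_index G n. 2 ^ r * exp (c * sqrt (real n)))" by (intro sum_mono bd)
    also have "\<dots> = real (card (subgroups_of_index G n)) * (2 ^ r * exp (c * sqrt (real n)))" by simp
    also have "\<dots> \<le> (K * real n ^ d) * (2 ^ r * exp (c * sqrt (real n)))" by (intro mult_right_mono Kd n) simp
    finally show ?thesis by (simp add: mult_ac)
  qed
  then show ?thesis using c by blast
qed

lemma zeta_natural_boundary:
  assumes psg: "polynomial_subgroup_growth G" and hl: "has_Hirsch_length G h" and h: "h \<ge> 2"
    and int: "\<forall>n. fps_nth (dynamical_zeta G \<alpha>) n \<in> \<int>"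
  shows "has_natural_boundary_circle (dynamical_zeta G \<alpha>) 1"
proof -
  obtain S where S: "subnormal_series (\<lambda>Q. cyclic_group Q \<and> infinite (carrier Q)) G S h" "S h \<in> finite_index_subgroups G"
    using hl unfolding has_Hirsch_length_def by blast
  have S0: "S 0 = {\<one>}" using S by (simp add: subnormal_series_def)
  have "\<exists>t. cyclic_step (S j) (S (Suc j)) t" if j: "j < h" for j
  proof -
    have "subgroup (S j) G" "subgroup (S (Suc j)) G" "S j \<lhd> G\<lparr>carrier := S (Suc j)\<rparr>"
      "cyclic_group (G\<lparr>carrier := S (Suc j)\<rparr> Mod S j)" "infinite (carrier (G\<lparr>carrier := S (Suc j)\<rparr> Mod S j))"
      using S(1) j unfolding subnormal_series_def by auto
    then show ?thesis by (rule cyclic_step_exists) blast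
  qed
  then obtain t where t: "\<And>j. j < h \<Longrightarrow> cyclic_step (S j) (S (Suc j)) (t j)" by metis
  have x: "cyclic_step {\<one>} (S 1) (t 0)" using t[of 0] h S0 by simp
  have y: "cyclic_step (S 1) (S 2) (t 1)" using t[of 1] h by (simp add: numeral_2_eq_2)
  define b where "b = Abs_fps (\<lambda>n. \<Sum>L\<in>subgroups_of_index G n. of_nat (card (fixed_points \<alpha> L)) / of_nat (index G L) :: complex)"
  have bn: "fps_nth b n = of_nat (fix_sum n) / of_nat n" for n
  proof -
    have "fps_nth b n = (\<Sum>L\<in>subgroups_of_index G n. of_nat (card (fixed_points \<alpha> L)) / of_nat n)"
      unfolding b_def fps_nth_Abs_fps by (intro sum.cong) (auto simp: subgroups_of_index_def)
    then show ?thesis by (simp add: fix_sum_def sum_divide_distrib)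
  qed
  have b0: "fps_nth b 0 = 0" by (simp add: bn)
  obtain K d c where c: "c > 0" "\<And>n. n \<ge> 1 \<Longrightarrow> real (fix_sum n) \<le> K * real n ^ d * exp (c * sqrt (real n))"
    using fix_sum_le[OF psg x y] by blast
  have "conv_radius (fps_nth b) \<ge> 1"
  proof (rule conv_radius_ge_1_if_subexponential[OF _ c(1)])
    fix n :: nat assume n: "n \<ge> 1"
    have "norm (fps_nth b n) = real (fix_sum n) / real n" by (simp add: bn norm_divide)
    also have "\<dots> \<le> real (fix_sum n)" using n by (simp add: divide_le_eq mult_le_cancel_left1)
    also note c(2)[OF n]
    finally show "norm (fps_nth b n) \<le> K * real n ^ d * exp (c * sqrt (real n))" .
  qed
  then have rad: "fps_conv_radius b \<ge> 1" by (simp add: fps_conv_radius_def)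
  \<comment> \<open>Differentiation cancels the division by the index: coefficient
    \<open>n - 1\<close> of the derivative is \<open>fix_sum n\<close>, which is at least the number
    of subgroups of index \<open>n\<close>.\<close>
  have "\<exists>n. norm (fps_nth (fps_deriv b) n) > R" for R :: real
  proof -
    obtain k :: nat where k: "real k > R" "k > 0" using reals_Archimedean2[of "max R 1"] by (auto intro: gr0I)
    obtain n \<A> where n: "n \<ge> 1" "card \<A> \<ge> k" and sub: "\<forall>L\<in>\<A>. subgroup L G \<and> finite (rcosets L) \<and> card (rcosets L) = n"
      using many_subgroups_of_same_index[OF t S0 h _ k(2)] S(2) unfolding finite_index_subgroups_def by blast
    have "\<A> \<subseteq> subgroups_of_index G n"
      using sub by (auto simp: subgroups_of_index_def finite_index_subgroups_def index_def)
    moreover have "finite (subgroups_of_index G n)" using psg n(1) unfolding polynomial_subgroup_growth_def by blast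
    ultimately have "k \<le> card (subgroups_of_index G n)" using card_mono n(2) by (metis le_trans)
    also have "\<dots> \<le> fix_sum n" by (rule fix_sum_ge[OF x y])
    finally have "R < real (fix_sum n)" using k by linarith
    moreover have "norm (fps_nth (fps_deriv b) (n - 1)) = real (fix_sum n)"
      using n(1) by (simp add: bn norm_mult norm_divide)
    ultimately show ?thesis by metis
  qed
  moreover have "dynamical_zeta G \<alpha> = fps_exp 1 oo b" by (simp add: dynamical_zeta_def b_def)
  ultimately show ?thesis using natural_boundary_exp[OF b0 rad] int by simp
qed

end

theorem corollary2p7:
  fixes G :: "('g, 'b) monoid_scheme"
    and \<alpha> :: "'g \<Rightarrow> 'x \<Rightarrow> 'x :: {topological_ab_group_add, t2_space}"
    and M :: "'x measure"
    and h :: nat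
  assumes "polycyclic_by_finite G"
    and "polynomial_subgroup_growth G"
    and "has_Hirsch_length G h" and "h \<ge> 2"
    and "compact (UNIV :: 'x set)"
    and "connected (UNIV :: 'x set)"
    and "finite_dimensional_space (euclidean :: 'x topology)"
    and "acts_by_automorphisms G \<alpha>"
    and "normalized_Haar_measure M"
    and "mixing G \<alpha> M"
    and "\<forall>n. fps_nth (dynamical_zeta G \<alpha>) n \<in> \<int>"
  shows "has_natural_boundary_circle (dynamical_zeta G \<alpha>) 1"
proof -
  have "group G" using assms(1) by (simp add: polycyclic_by_finite_def)
  then interpret mixing_action M G \<alpha>
    using assms by (intro mixing_action.intro compact_haar.intro mixing_action_axioms.intro)
  show ?thesis using assms by (intro zeta_natural_boundary)
qed

end
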